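(* Let $\mathbb{F}_2$ be the field of two elements, and let $G$ and $H$ be finite $2$-groups of maximal class. Then the groups $V(\mathbb{F}_2G)$ and $V(\mathbb{F}_2H)$ are isomorphic if and only if $G$ and $H$ are isomorphic.
   Context: For a finite $2$-group $G$, $V(\mathbb{F}_2G)$ is the multiplicative group of normalized units of the group algebra $\mathbb{F}_2G$, i.e. the set of all $\sum_{g\in G}\alpha_g g\in\mathbb{F}_2G$ with $\sum_{g\in G}\alpha_g=1$. The finite $2$-groups of maximal class are, up to isomorphism, exactly the following groups of order $2^{n+1}$, where $(a,b)=a^{-1}b^{-1}ab$: the generalized quaternion group $Q_{2^{n+1}}=\langle a,b_1 \mid a^{2^n}=1,\ b_1^2=a^{2^{n-1}},\ (a,b_1)=a^{-2}\rangle$, $n\ge2$; the dihedral group $D_{2^{n+1}}=\langle a,b_2 \mid a^{2^n}=1,\ b_2^2=1,\ (a,b_2)=a^{-2}\rangle$, $n\ge2$; the semidihedral group $SD_{2^{n+1}}=\langle a,b_3 \mid a^{2^n}=1,\ b_3^2=1,\ (a,b_3)=a^{-2+2^{n-1}}\rangle$, $n\ge3$. *)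

theory Defs
  imports "HOL-Algebra.Algebra" "HOL-Library.Z2"
begin

section \<open>Finite 2-groups of maximal class\<close>

definition group_commutator :: "('a, 'm) monoid_scheme \<Rightarrow> 'a \<Rightarrow> 'a \<Rightarrow> 'a" where
  "group_commutator G x y = inv\<^bsub>G\<^esub> x \<otimes>\<^bsub>G\<^esub> inv\<^bsub>G\<^esub> y \<otimes>\<^bsub>G\<^esub> x \<otimes>\<^bsub>G\<^esub> y"

text \<open>The index is shifted by one: \<open>lower_central G i\<close> is the term usually written
  \<open>\<gamma>\<^sub>i\<^sub>+\<^sub>1(G)\<close>.\<close>

primrec lower_central :: "('a, 'm) monoid_scheme \<Rightarrow> nat \<Rightarrow> 'a set" where
  "lower_central G 0 = carrier G"
| "lower_central G (Suc i) =
     generate G {group_commutator G x y | x y. x \<in> lower_central G i \<and> y \<in> carrier G}"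

definition has_nilpotency_class :: "('a, 'm) monoid_scheme \<Rightarrow> nat \<Rightarrow> bool" where
  "has_nilpotency_class G c \<longleftrightarrow>
     lower_central G c = {\<one>\<^bsub>G\<^esub>} \<and> (\<forall>i<c. lower_central G i \<noteq> {\<one>\<^bsub>G\<^esub>})"

text \<open>A group of order \<open>p^m\<close> has maximal class if its nilpotency class is \<open>m - 1\<close>.  Here
  \<open>m = n + 1\<close>, and \<open>n \<ge> 2\<close> excludes the groups of order 4, in accordance with the
  convention that the 2-groups of maximal class are the generalized quaternion, dihedral and
  semidihedral groups of order at least 8.\<close>

definition maximal_class_2_group :: "('a, 'm) monoid_scheme \<Rightarrow> bool" where
  "maximal_class_2_group G \<longleftrightarrow>
     group G \<and> (\<exists>n\<ge>2. order G = 2 ^ (n + 1) \<and> has_nilpotency_class G n)"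

section \<open>Group algebras and normalized units\<close>

text \<open>The group algebra of a finite group \<open>G\<close> over \<open>'k\<close>: the element
  \<open>\<Sum>g\<in>G. \<alpha>\<^sub>g g\<close> is represented by its coefficient function \<open>\<alpha>\<close>, which is \<open>0\<close> outside
  \<open>carrier G\<close>.  No finiteness of support is required, so this is the group algebra only when
  \<open>G\<close> is finite.\<close>

definition group_algebra ::
  "('a, 'm) monoid_scheme \<Rightarrow> ('a \<Rightarrow> 'k::comm_ring_1) ring" where
  "group_algebra G =
     \<lparr>carrier = {f. \<forall>x. x \<notin> carrier G \<longrightarrow> f x = 0},
      Group.monoid.mult = (\<lambda>f g x. if x \<in> carrier G
        then \<Sum>y\<in>carrier G. f y * g (inv\<^bsub>G\<^esub> y \<otimes>\<^bsub>G\<^esub> x) else 0),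
      Group.monoid.one = (\<lambda>x. if x = \<one>\<^bsub>G\<^esub> then 1 else 0),
      Ring.ring.zero = (\<lambda>x. 0),
      Ring.ring.add = (\<lambda>f g x. f x + g x)\<rparr>"

definition augmentation ::
  "('a, 'm) monoid_scheme \<Rightarrow> ('a \<Rightarrow> 'k::comm_ring_1) \<Rightarrow> 'k" where
  "augmentation G f = (\<Sum>x\<in>carrier G. f x)"

text \<open>If \<open>G\<close> is a finite 2-group and \<open>'k\<close> is the field of two elements, then every element of
  augmentation \<open>1\<close> is a unit, so the carrier below consists of all elements of augmentation
  \<open>1\<close>.\<close>

definition normalized_units ::
  "('a, 'm) monoid_scheme \<Rightarrow> ('a \<Rightarrow> 'k::comm_ring_1) monoid" where
  "normalized_units G =
     (units_of (group_algebra G))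
       \<lparr>carrier := {u \<in> Units (group_algebra G). augmentation G u = 1}\<rparr>"

abbreviation V_F2 :: "('a, 'm) monoid_scheme \<Rightarrow> ('a \<Rightarrow> bit) monoid" where
  "V_F2 G \<equiv> normalized_units G"

end

theory Submission
  imports Defs "HOL-Computational_Algebra.Polynomial" "HOL-Number_Theory.Cong"
begin

text \<open>
  An isomorphism of groups induces one of the groups of normalized units, so the content lies in
  the converse.  Let \<open>F\<close> be the field with two elements.  The invariant is the number of \<open>u\<close> in
  \<open>V(FG)\<close> with \<open>u\<^sup>2 = 1\<close>.  Every \<open>u\<close> in the group algebra with \<open>u\<^sup>2 = 1\<close> has augmentation
  \<open>1\<close>, so this is simply the number of solutions of
  \<open>u\<^sup>2 = 1\<close> in \<open>FG\<close>, and it is shown to be different for any two non-isomorphic 2-groups of maximal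
  class.

  First, the classification (\<open>maximal_class_presented\<close>): \<open>G\<close> consists of the elements \<open>a\<^sup>i\<close> and \<open>a\<^sup>ib\<close>,
  where \<open>a\<close> has order \<open>q = 2\<^sup>n\<close>, \<open>ba = a\<^sup>eb\<close> and \<open>b\<^sup>2 = a\<^sup>m\<close>, with \<open>e = q-1\<close> and \<open>m = 0\<close> (dihedral),
  \<open>e = q-1\<close> and \<open>m = q/2\<close> (quaternion), or \<open>e = q/2-1\<close> and \<open>m = 0\<close> (semidihedral, \<open>n \<ge> 3\<close>).
  Counting orders shows that \<open>G/G'\<close> is elementary of order 4 and that all later factors of the lower
  central series have order 2.  The quotient by the third term is not abelian, so some \<open>a\<^sup>2\<close> lies
  outside that term, and such an \<open>a\<close> has order \<open>2\<^sup>n\<close> because its successive squares generate the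
  successive factors (\<open>two_power_not_in_lc\<close>).

  Next, let \<open>R = F[\<xi>]/(\<xi>\<^sup>q+1)\<close> be the group algebra of \<open>\<langle>a\<rangle>\<close>, with the automorphism \<open>\<sigma>: \<xi> \<mapsto> \<xi>\<^sup>e\<close>
  given by conjugation with \<open>b\<close>.  For \<open>u = 1 + x + yb\<close> with \<open>x, y \<in> R\<close> the equation \<open>u\<^sup>2 = 1\<close> says
  \<open>x\<^sup>2 = y \<sigma>(y) \<xi>\<^sup>m\<close> and \<open>y \<sigma>(x) = y x\<close>; the set of these pairs is \<open>sols e m\<close>, and \<open>card_involutions\<close>
  makes the translation.  As \<open>q\<close> is a power of two, \<open>\<xi>\<^sup>q+1 = (\<xi>+1)\<^sup>q\<close>, so \<open>R\<close> is local and an element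
  is a unit if and only if its value at \<open>1\<close> is not zero.

  All three families are compared with subsets of the set \<open>D\<close> of dihedral solutions.  Everything
  rests on \<open>W = 1 + \<xi> + \<dots> + \<xi>\<^bsup>q/2-2\<^esup>\<close>.
  For the quaternion group, looking at coefficients shows that \<open>y\<close> is not a unit.  The dihedral norm of
  \<open>W\<close> agrees with \<open>\<xi>\<^bsup>q/2\<^esup>\<close> up to a term killed by the norm of such a \<open>y\<close>, so \<open>(x,y) \<mapsto> (x,Wy)\<close>
  embeds the quaternion solutions into the set \<open>E\<close> of those pairs in \<open>D\<close> whose \<open>y\<close> is not a unit
  (\<open>nonunit_sols\<close>).
  For the semidihedral group the norm of \<open>W\<close> is \<open>1 + J\<close>, where \<open>J\<close> is the sum of all elements of
  \<open>\<langle>a\<rangle>\<close>.  The substitution \<open>\<xi> \<mapsto> W\<close> is therefore an automorphism of \<open>R\<close> that turns the semidihedral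
  \<open>\<sigma>\<close> into the dihedral one plus a multiple of \<open>J\<close>.  The resulting set \<open>T\<close> of twisted solutions lies
  strictly between \<open>E\<close> and \<open>D\<close>: the pair \<open>(1,1)\<close> is in \<open>T\<close> and not in \<open>E\<close>, and \<open>(1,\<xi>)\<close> is in \<open>D\<close>
  and not in \<open>T\<close>.  So for equal orders the counts satisfy quaternion \<open><\<close> semidihedral \<open><\<close> dihedral.
  Different orders are told apart by the bounds \<open>2\<^sup>q \<le> |sols e m| < 2\<^bsup>2q\<^esup>\<close>.
\<close>

hide_const (open) Polynomials.degree up_ring.coeff up_ring.monom module.smult Polynomial.order

section \<open>Polynomials over the field with two elements\<close>

lemma bit_add_self: "c + c = (0 :: bit)"
  by (cases c) simp_all

text \<open>The next rules make \<open>simp\<close> compute in characteristic 2, where subtraction is addition.\<close>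

lemma bit_poly_double [simp]: "p + p = (0 :: bit poly)"
  by (rule poly_eqI) (simp only: coeff_add bit_add_self coeff_0)

lemma bit_poly_uminus [simp]: "- p = (p :: bit poly)"
  by (rule poly_eqI) simp

lemma bit_poly_diff [simp]: "p - r = p + (r :: bit poly)"
  by (rule poly_eqI) simp

lemma bit_poly_two [simp]: "(2 :: bit poly) = 0"
  using bit_poly_double[of 1] by (simp only: one_add_one)

lemma bit_poly_cancel [simp]: "p + (p + r) = (r :: bit poly)"
  by (simp only: add.assoc[symmetric] bit_poly_double add_0)

lemma frobenius: "(p + r) ^ (2 ^ k) = p ^ (2 ^ k) + (r :: bit poly) ^ (2 ^ k)"
proof (induction k)
  case (Suc k)
  have "(p + r) ^ (2 ^ Suc k) = ((p + r) ^ (2 ^ k))\<^sup>2"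
    by (simp only: power_Suc2 power_mult)
  also have "\<dots> = (p ^ (2 ^ k))\<^sup>2 + (r ^ (2 ^ k))\<^sup>2"
    by (simp add: Suc power2_sum)
  finally show ?case by (simp only: power_Suc2 power_mult)
qed simp

abbreviation \<xi> :: "bit poly" where "\<xi> \<equiv> [:0, 1:]"

lemma poly_1_eq_0_iff: "poly p 1 = 0 \<longleftrightarrow> \<xi> + 1 dvd (p :: bit poly)"
proof -
  have "[:- 1, 1:] = \<xi> + 1" by (simp add: one_pCons)
  then show ?thesis by (simp only: poly_eq_0_iff_dvd)
qed

lemma poly_1_eq_1D: "poly p 1 = 1 \<Longrightarrow> \<xi> + 1 dvd p + (1 :: bit poly)"
  by (simp only: poly_1_eq_0_iff[symmetric] poly_add poly_1 bit_add_self)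

lemma coeff_xi_power: "coeff (\<xi> ^ m) k = of_bool (m = k)"
  using coeff_monom[of "1::bit" m k] by (simp add: monom_altdef)

lemma pcompose_power: "(p ^ k) \<circ>\<^sub>p r = (p \<circ>\<^sub>p r) ^ k" for p r :: "bit poly"
  by (induction k) (simp_all add: pcompose_mult pcompose_1)

lemma pcompose_xi [simp]: "\<xi> \<circ>\<^sub>p r = r"
  by (simp add: pcompose_pCons)

lemma pcompose_cong_right:
  "[r = s] (mod m) \<Longrightarrow> [p \<circ>\<^sub>p r = p \<circ>\<^sub>p s] (mod m)" for p :: "bit poly"
  by (induction p) (auto simp: pcompose_pCons intro!: cong_add cong_mult)

lemma finite_bit_poly: "finite {p :: bit poly. degree p < k}"
  and card_bit_poly: "k > 0 \<Longrightarrow> card {p :: bit poly. degree p < k} = 2 ^ k"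
proof -
  let ?D = "{p :: bit poly. degree p < k}" and ?F = "{..<k} \<rightarrow>\<^sub>E (UNIV :: bit set)"
  let ?r = "\<lambda>p :: bit poly. restrict (coeff p) {..<k}"
  have inj: "inj_on ?r ?D"
  proof (rule inj_onI)
    fix p r :: "bit poly" assume d: "p \<in> ?D" "r \<in> ?D" and eq: "?r p = ?r r"
    have "coeff p i = coeff r i" for i
    proof (cases "i < k")
      case True
      then show ?thesis using fun_cong[OF eq, of i] by simp
    next
      case False
      then show ?thesis using d by (simp add: coeff_eq_0)
    qed
    then show "p = r" by (rule poly_eqI)
  qed
  have UNIV_bit: "(UNIV :: bit set) = {0, 1}"
  proof (rule UNIV_eq_I)
    show "c \<in> {0, 1}" for c :: bit by (cases c) simp_all
  qed
  have F: "finite ?F" "card ?F = 2 ^ k"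
    by (simp_all add: finite_PiE card_PiE UNIV_bit numeral_2_eq_2)
  have sub: "?r ` ?D \<subseteq> ?F" by (rule image_subsetI) (simp add: restrict_PiE_iff)
  show "finite ?D" using inj sub F(1) by (rule inj_on_finite)
  assume k: "k > 0"
  have "?F \<subseteq> ?r ` ?D"
  proof
    fix f assume f: "f \<in> ?F"
    define p where "p = (\<Sum>i<k. monom (f i) i)"
    have c: "coeff p j = (if j < k then f j else 0)" for j
      by (simp add: p_def coeff_sum)
    have "degree p \<le> k - 1"
      by (intro degree_le allI impI) (use k in \<open>simp add: c\<close>)
    then have "p \<in> ?D" using k by simp
    moreover have "f = ?r p"
    proof
      show "f i = ?r p i" for i using PiE_arb[OF f, of i] by (cases "i < k") (simp_all add: c)
    qed
    ultimately show "f \<in> ?r ` ?D" by (rule rev_image_eqI)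
  qed
  with sub have "?r ` ?D = ?F" by (rule subset_antisym)
  then show "card ?D = 2 ^ k" using card_image[OF inj] F(2) by (simp only:)
qed

text \<open>Off the diagonal the terms cancel in pairs.  This is how characteristic 2 enters the computation
  of norms.\<close>

lemma sum_symmetric_bit:
  fixes F :: "'i \<Rightarrow> 'i \<Rightarrow> bit"
  assumes "finite I" "\<And>i j. F i j = F j i"
  shows "(\<Sum>i\<in>I. \<Sum>j\<in>I. F i j) = (\<Sum>i\<in>I. F i i)"
  using assms(1)
proof induction
  case (insert a I)
  have sym: "(\<Sum>i\<in>I. F i a) = (\<Sum>j\<in>I. F a j)" by (intro sum.cong refl assms(2))
  have "(\<Sum>i\<in>insert a I. \<Sum>j\<in>insert a I. F i j)
      = F a a + ((\<Sum>j\<in>I. F a j) + (\<Sum>i\<in>I. F i a)) + (\<Sum>i\<in>I. \<Sum>j\<in>I. F i j)"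
    by (simp only: sum.insert[OF insert.hyps] sum.distrib add_ac)
  also have "\<dots> = F a a + (\<Sum>i\<in>I. F i i)"
    by (simp only: sym insert.IH bit_add_self add_0_right)
  finally show ?case by (simp only: sum.insert[OF insert.hyps])
qed simp

lemma geometric: "(p + 1) * (\<Sum>i<k. p ^ i) = p ^ k + (1 :: bit poly)"
proof (induction k)
  case (Suc k)
  have "(p + 1) * (\<Sum>i<Suc k. p ^ i) = (p + 1) * (\<Sum>i<k. p ^ i) + (p + 1) * p ^ k"
    by (simp only: sum.lessThan_Suc distrib_left)
  also have "\<dots> = p ^ Suc k + 1"
    unfolding Suc by (simp only: distrib_right power_Suc mult_1 add_ac bit_poly_cancel)
  finally show ?case .
qed simp

lemma poly_of_nat_bit: "odd k \<Longrightarrow> of_nat k = (1 :: bit)"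
  by (auto elim!: oddE)

lemma half_dvd:
  fixes q k l :: nat
  assumes "q dvd k + l" "l < q" "k = 0 \<or> k = q div 2" "4 dvd q"
  shows "l = k"
proof -
  obtain c where c: "k + l = q * c" using assms(1) ..
  have "k \<le> q" using assms(3) by auto
  then have "q * c < q * 2" using assms(2) c by linarith
  then have "c = 0 \<or> c = 1" by auto
  moreover have "q = 2 * (q div 2)" using assms(4) by presburger
  ultimately show ?thesis using assms(2,3) c by auto
qed

lemmas ring_expand = distrib_left distrib_right mult_1_left mult_1_right add_ac mult_ac

lemma cong_replace: "[a = a'] (mod m) \<Longrightarrow> [b = b'] (mod m) \<Longrightarrow> [a = b] (mod m) \<longleftrightarrow> [a' = b'] (mod m)"
  by (simp add: cong_def)

section \<open>The group algebra of a cyclic 2-group\<close>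

text \<open>The group algebra of a cyclic group of order \<open>q = 2\<^sup>n\<close> is handled through polynomials modulo
  \<open>\<xi>\<^sup>q + 1\<close>, since substitution of polynomials then provides its endomorphisms.  Its elements are
  represented by the polynomials of degree less than \<open>q\<close>.\<close>

locale cyclic_algebra =
  fixes n q :: nat
  assumes n2: "n \<ge> 2" and q_def: "q = 2 ^ n"
begin

definition M :: "bit poly" where "M = \<xi> ^ q + 1"

lemma q_ge: "q \<ge> 4"
  using power_increasing[OF n2, of "2::nat"] by (simp add: q_def)

lemma q_dvd: "4 dvd q"
  using le_imp_power_dvd[OF n2, of 2] by (simp add: q_def)

lemma frobenius_q: "(p + r) ^ q = p ^ q + (r :: bit poly) ^ q"
  by (simp add: q_def frobenius)

lemma M_eq: "M = (\<xi> + 1) ^ q"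
  by (simp add: M_def frobenius_q)

lemma degree_M: "degree M = q" 
  unfolding M_eq by (subst degree_power_eq) (simp_all add: one_pCons)

lemma M_nz: "M \<noteq> 0"
  using degree_M q_ge by auto

lemma cong_iff_dvd: "[p = r] (mod M) \<longleftrightarrow> M dvd p + r"
  by (simp add: cong_iff_dvd_diff)

text \<open>An element of value \<open>1\<close> at \<open>1\<close> differs from \<open>1\<close> by a multiple of \<open>\<xi> + 1\<close>, and the \<open>q\<close>-th power
  of that multiple vanishes.  So these elements are units, with inverse \<open>p\<^bsup>q-1\<^esup>\<close>.\<close>

lemma power_q_cong_1: "poly p 1 = 1 \<Longrightarrow> [p ^ q = 1] (mod M)"
proof -
  assume "poly p 1 = 1"
  then obtain s where "p + 1 = (\<xi> + 1) * s" using poly_1_eq_1D by blast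
  then have "p ^ q + 1 = M * s ^ q"
    using frobenius_q[of p 1] by (simp only: M_eq power_mult_distrib power_one)
  then show ?thesis by (simp add: cong_iff_dvd)
qed

lemma xi_q: "[\<xi> ^ q = 1] (mod M)"
  by (rule power_q_cong_1) simp

text \<open>Substituting \<open>P\<close> is well defined on residue classes because \<open>P\<^sup>q \<equiv> 1\<close>.\<close>

lemma cong_pcompose:
  assumes "poly P 1 = 1" "[r = s] (mod M)"
  shows "[r \<circ>\<^sub>p P = s \<circ>\<^sub>p P] (mod M)"
proof -
  have "M dvd M \<circ>\<^sub>p P"
    using power_q_cong_1[OF assms(1)]
    by (simp add: M_def[THEN arg_cong[of _ _ "\<lambda>m. m \<circ>\<^sub>p P"]] cong_iff_dvd pcompose_add pcompose_power pcompose_1)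
  moreover from assms(2) obtain t where "r + s = M * t" by (auto simp: cong_iff_dvd)
  then have "r \<circ>\<^sub>p P + s \<circ>\<^sub>p P = (M \<circ>\<^sub>p P) * (t \<circ>\<^sub>p P)"
    by (simp only: pcompose_add[symmetric] pcompose_mult[symmetric])
  ultimately show ?thesis by (simp add: cong_iff_dvd)
qed

lemma unit_cancel:
  assumes "poly u 1 = 1" "[u * p = u * r] (mod M)"
  shows "[p = r] (mod M)"
proof -
  have *: "[u ^ (q - 1) * (u * p) = p] (mod M)" for p
  proof -
    have "u ^ (q - 1) * (u * p) = u ^ q * p"
      using q_ge power_minus_mult[of q u] by (simp only: mult.assoc[symmetric])
    with cong_mult[OF power_q_cong_1[OF assms(1)] cong_refl, of p] show ?thesis
      by (simp only: mult_1)
  qed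
  show ?thesis
    using *[of p] *[of r] cong_mult[OF cong_refl[of "u ^ (q - 1)"] assms(2)]
    by (meson cong_sym cong_trans)
qed

lemma cancel_factor:
  assumes "k \<le> q" "[(\<xi> + 1) ^ k * p = (\<xi> + 1) ^ k * r] (mod M)" "(\<xi> + 1) ^ k dvd s"
  shows "[p * s = r * s] (mod M)"
proof -
  from assms(3) obtain t where "s = (\<xi> + 1) ^ k * t" ..
  then show ?thesis using cong_mult[OF assms(2) cong_refl, of t] by (simp add: mult_ac)
qed

text \<open>The socle of the local ring: \<open>J\<close> is the sum of all powers of \<open>\<xi>\<close>, see \<open>fold_coeff_J\<close> below.\<close>

definition J :: "bit poly" where "J = (\<xi> + 1) ^ (q - 1)"

text \<open>\<open>J\<close> is killed by \<open>\<xi> + 1\<close>, so only the value of \<open>p\<close> at \<open>1\<close> matters.\<close>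

lemma J_mult: "[J * p = smult (poly p 1) J] (mod M)"
proof (cases "poly p 1")
  case zero
  then obtain s where "p = (\<xi> + 1) * s" by (auto simp: poly_1_eq_0_iff)
  then have "J * p = M * s"
    using q_ge by (simp add: J_def M_eq power_eq_if mult_ac)
  then show ?thesis using zero by (simp add: cong_0_iff)
next
  case one
  then obtain s where "p + 1 = (\<xi> + 1) * s" using poly_1_eq_1D by blast
  then have "J * (p + 1) = M * s"
    using q_ge by (simp add: J_def M_eq power_eq_if mult_ac)
  then show ?thesis using one by (simp add: cong_iff_dvd distrib_left)
qed

lemma poly_J [simp]: "poly J 1 = 0"
  using q_ge by (simp add: J_def)

lemma J_J: "[J * J = 0] (mod M)"
  using J_mult[of J] by simp

lemma not_dvd_J: "\<not> M dvd J"
proof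
  assume "M dvd J"
  moreover have "J \<noteq> 0" unfolding J_def by (rule power_not_zero) (simp add: one_pCons)
  ultimately have "degree M \<le> degree J" by (rule dvd_imp_degree_le)
  then show False using q_ge unfolding degree_M J_def by (simp add: degree_power_eq one_pCons)
qed

text \<open>The coefficient of the group element \<open>a\<^sup>k\<close> in the element represented by \<open>p\<close>, for \<open>k < q\<close>.\<close>

definition fold_coeff :: "nat \<Rightarrow> bit poly \<Rightarrow> bit" where "fold_coeff k p = coeff (p mod M) k"

lemma fold_coeff_add: "fold_coeff k (p + r) = fold_coeff k p + fold_coeff k r"
  by (simp add: fold_coeff_def poly_mod_add_left)

lemma fold_coeff_0 [simp]: "fold_coeff k 0 = 0"
  by (simp add: fold_coeff_def)

lemma fold_coeff_sum: "fold_coeff k (\<Sum>i\<in>A. f i) = (\<Sum>i\<in>A. fold_coeff k (f i))"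
  by (induction A rule: infinite_finite_induct) (auto simp: fold_coeff_add fold_coeff_0)

lemma fold_coeff_smult: "fold_coeff k (smult c p) = c * fold_coeff k p"
  by (simp add: fold_coeff_def mod_smult_left)

lemma fold_coeff_cong: "[p = r] (mod M) \<Longrightarrow> fold_coeff k p = fold_coeff k r"
  by (simp add: fold_coeff_def cong_def)

lemma fold_coeff_small: "degree p < q \<Longrightarrow> fold_coeff k p = coeff p k"
  by (simp add: fold_coeff_def mod_poly_less degree_M)

lemma fold_coeff_xi_power: "fold_coeff k (\<xi> ^ m) = of_bool (m mod q = k)"
proof -
  have "\<xi> ^ m = (\<xi> ^ q) ^ (m div q) * \<xi> ^ (m mod q)"
    by (simp flip: power_mult power_add)
  also have "[\<dots> = 1 ^ (m div q) * \<xi> ^ (m mod q)] (mod M)"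
    by (intro cong_mult cong_pow xi_q cong_refl)
  finally have "fold_coeff k (\<xi> ^ m) = fold_coeff k (1 ^ (m div q) * \<xi> ^ (m mod q))"
    by (rule fold_coeff_cong)
  also have "\<dots> = fold_coeff k (\<xi> ^ (m mod q))"
    by (simp only: mult_1 power_one)
  also have "\<dots> = of_bool (m mod q = k)"
    using q_ge by (subst fold_coeff_small) (auto simp: degree_power_eq coeff_xi_power)
  finally show ?thesis .
qed

lemma degree_mod_M: "degree (p mod M) < q"
  using degree_mod_less'[of M p] M_nz q_ge degree_M by (cases "p mod M = 0") auto

lemma dvd_iff_fold_coeff: "M dvd p \<longleftrightarrow> (\<forall>k<q. fold_coeff k p = 0)"
proof
  assume "\<forall>k<q. fold_coeff k p = 0"
  then have "coeff (p mod M) k = 0" for k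
    using degree_mod_M[of p] by (cases "k < q") (auto simp: fold_coeff_def intro: coeff_eq_0)
  then have "p mod M = 0" by (intro poly_eqI) simp
  then show "M dvd p" by (simp add: mod_eq_0_iff_dvd)
qed (auto simp: fold_coeff_def mod_eq_0_iff_dvd)

lemma poly_as_sum:
  assumes "degree p < q"
  shows "p = (\<Sum>i<q. smult (coeff p i) (\<xi> ^ i))"
proof (rule poly_eqI)
  fix k
  have "coeff (\<Sum>i<q. smult (coeff p i) (\<xi> ^ i)) k = (\<Sum>i<q. if i = k then coeff p k else 0)"
    unfolding coeff_sum by (intro sum.cong) (auto simp: coeff_xi_power)
  also have "\<dots> = coeff p k" using assms by (auto simp: coeff_eq_0)
  finally show "coeff p k = coeff (\<Sum>i<q. smult (coeff p i) (\<xi> ^ i)) k" by simp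
qed

text \<open>The automorphism that inverts \<open>\<xi>\<close>, which is conjugation by \<open>b\<close> in the dihedral and quaternion
  groups.\<close>

abbreviation star :: "bit poly \<Rightarrow> bit poly" where "star p \<equiv> p \<circ>\<^sub>p \<xi> ^ (q - 1)"

text \<open>The coefficients of \<open>a\<^sup>i\<close> in \<open>y\<close> and of \<open>a\<^sup>j\<close> in \<open>star y\<close> contribute to the coefficient of \<open>a\<^sup>k\<close>
  if \<open>i - j \<equiv> k\<close>.  For \<open>2k \<equiv> 0\<close> this relation between \<open>i\<close> and \<open>j\<close> is symmetric, so only
  the diagonal survives.  In particular \<open>\<xi>\<^bsup>q/2\<^esup>\<close> is not a norm, which is what separates the quaternion
  from the dihedral case.\<close>

lemma fold_coeff_norm:
  assumes y: "degree y < q" and k: "k = 0 \<or> k = q div 2"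
  shows "fold_coeff k (y * star y) = (if k = 0 then poly y 1 else 0)"
proof -
  let ?c = "coeff y"
  let ?R = "\<lambda>i j. (i + (q - 1) * j) mod q = k"
  have star: "star y = (\<Sum>j<q. smult (?c j) (\<xi> ^ ((q - 1) * j)))"
    by (subst poly_as_sum[OF y])
      (simp only: pcompose_sum pcompose_smult pcompose_power pcompose_xi power_mult)
  have "y * star y = (\<Sum>i<q. \<Sum>j<q. smult (?c i * ?c j) (\<xi> ^ (i + (q - 1) * j)))"
    unfolding star
    by (subst (1) poly_as_sum[OF y])
      (simp only: sum_product power_add mult_smult_left mult_smult_right smult_smult mult.commute)
  then have "fold_coeff k (y * star y) = (\<Sum>i<q. \<Sum>j<q. ?c i * ?c j * of_bool (?R i j))"
    by (simp only: fold_coeff_sum fold_coeff_smult fold_coeff_xi_power)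
  also have "\<dots> = (\<Sum>i<q. ?c i * ?c i * of_bool (?R i i))"
  proof (rule sum_symmetric_bit)
    fix i j
    have R: "?R j i" if "?R i j" for i j
    proof -
      have "(i + (q - 1) * j) + (j + (q - 1) * i) = q * (i + j)"
        using q_ge by (cases q) (simp_all add: algebra_simps)
      then have "((i + (q - 1) * j) mod q + (j + (q - 1) * i) mod q) mod q = 0"
        by (simp add: mod_add_eq)
      then have "q dvd k + (j + (q - 1) * i) mod q" using that by (simp add: mod_eq_0_iff_dvd)
      moreover have "(j + (q - 1) * i) mod q < q" using q_ge by simp
      ultimately show ?thesis using k q_dvd by (intro half_dvd) auto
    qed
    show "?c i * ?c j * of_bool (?R i j) = ?c j * ?c i * of_bool (?R j i)"
      using R[of i j] R[of j i] by (auto simp: mult.commute)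
  qed simp
  also have "\<dots> = (\<Sum>i<q. if k = 0 then ?c i else 0)"
  proof (rule sum.cong)
    fix i
    have "i + (q - 1) * i = q * i" using q_ge by (simp add: diff_mult_distrib)
    moreover have "?c i * ?c i = ?c i" by (cases "?c i") simp_all
    ultimately show "?c i * ?c i * of_bool (?R i i) = (if k = 0 then ?c i else 0)" by simp
  qed simp
  also have "\<dots> = (if k = 0 then poly y 1 else 0)"
  proof -
    have "poly y 1 = (\<Sum>i<q. poly (smult (?c i) (\<xi> ^ i)) 1)"
      by (subst poly_as_sum[OF y]) (simp only: poly_sum)
    also have "\<dots> = (\<Sum>i<q. ?c i)" by (intro sum.cong refl) simp
    finally show ?thesis by simp
  qed
  finally show ?thesis .
qed

text \<open>The element \<open>a\<^sup>0\<close> is its own inverse, so it occurs twice in a trace.\<close>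

lemma fold_coeff_trace:
  assumes x: "degree x < q"
  shows "fold_coeff 0 (x + star x) = 0"
proof -
  have "star x = (\<Sum>j<q. smult (coeff x j) (\<xi> ^ ((q - 1) * j)))"
    by (subst poly_as_sum[OF x])
      (simp only: pcompose_sum pcompose_smult pcompose_power pcompose_xi power_mult)
  then have "fold_coeff 0 (star x) = (\<Sum>j<q. coeff x j * of_bool ((q - 1) * j mod q = 0))"
    by (simp only: fold_coeff_sum fold_coeff_smult fold_coeff_xi_power)
  also have "\<dots> = (\<Sum>j<q. if j = 0 then coeff x 0 else 0)"
  proof (rule sum.cong)
    fix j assume "j \<in> {..<q}"
    then have j: "\<not> q dvd j" if "j \<noteq> 0" using that by (auto dest: dvd_imp_le)
    have "q * j = (q - 1) * j + j" using q_ge by (cases q) simp_all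
    then have "q dvd j" if "q dvd (q - 1) * j" using that by (metis dvd_add_right_iff dvd_triv_left)
    then have "(q - 1) * j mod q = 0 \<longleftrightarrow> j = 0"
      using j by (auto simp: mod_eq_0_iff_dvd)
    then show "coeff x j * of_bool ((q - 1) * j mod q = 0) = (if j = 0 then coeff x 0 else 0)"
      by auto
  qed simp
  also have "\<dots> = fold_coeff 0 x" using q_ge by (simp add: fold_coeff_small[OF x])
  finally show ?thesis by (simp only: fold_coeff_add bit_add_self)
qed

lemma fold_coeff_shift: "fold_coeff (q div 2) (\<xi> ^ (q div 2) * p) = fold_coeff 0 p"
proof -
  let ?r = "p mod M"
  have r: "degree ?r < q" by (rule degree_mod_M)
  have "fold_coeff (q div 2) (\<xi> ^ (q div 2) * p) = fold_coeff (q div 2) (\<xi> ^ (q div 2) * ?r)"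
    by (rule fold_coeff_cong) (simp add: cong_def mod_mult_right_eq)
  also have "\<xi> ^ (q div 2) * ?r = (\<Sum>i<q. smult (coeff ?r i) (\<xi> ^ (q div 2 + i)))"
    by (subst (1) poly_as_sum[OF r]) (simp add: sum_distrib_left power_add)
  also have "fold_coeff (q div 2) \<dots> = (\<Sum>i<q. coeff ?r i * of_bool ((q div 2 + i) mod q = q div 2))"
    by (simp only: fold_coeff_sum fold_coeff_smult fold_coeff_xi_power)
  also have "\<dots> = (\<Sum>i<q. if i = 0 then coeff ?r 0 else 0)"
  proof (rule sum.cong)
    fix i assume "i \<in> {..<q}"
    then have "(q div 2 + i) mod q = q div 2 \<longleftrightarrow> i = 0"
      using q_ge by (cases "q div 2 + i < q") (auto simp: le_mod_geq)
    then show "coeff ?r i * of_bool ((q div 2 + i) mod q = q div 2) = (if i = 0 then coeff ?r 0 else 0)"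
      by auto
  qed simp
  also have "\<dots> = fold_coeff 0 p" using q_ge by (simp add: fold_coeff_def)
  finally show ?thesis .
qed

text \<open>Up to the annihilator of \<open>\<xi> + 1\<close>, the quotient of \<open>1 + \<xi>\<^bsup>q/2-1\<^esup>\<close> by \<open>1 + \<xi>\<close>.  The exponent is that
  of the semidihedral automorphism, so \<open>W\<close> is nearly of norm \<open>1\<close> for it.\<close>

definition W :: "bit poly" where "W = (\<Sum>i<q div 2 - 1. \<xi> ^ i)"

text \<open>The derivative at \<open>1\<close> adds up the coefficients of the odd powers of \<open>\<xi>\<close>.\<close>

definition odd_sum :: "bit poly \<Rightarrow> bit" where "odd_sum x = poly (pderiv x) 1"

lemma W_geometric: "(\<xi> + 1) * W = \<xi> ^ (q div 2 - 1) + 1"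
  by (simp only: W_def geometric)

lemma poly_W [simp]: "poly W 1 = 1"
  unfolding W_def using q_ge q_dvd by (auto simp: poly_sum elim!: dvdE intro!: poly_of_nat_bit)

lemma poly_star [simp]: "poly (star p) 1 = poly p 1"
  by (simp add: poly_pcompose)

lemma xi_power_cong: "[i = j] (mod q) \<Longrightarrow> [\<xi> ^ i = \<xi> ^ j] (mod M)"
proof -
  have *: "[\<xi> ^ i = \<xi> ^ (i mod q)] (mod M)" for i
  proof -
    have "\<xi> ^ i = (\<xi> ^ q) ^ (i div q) * \<xi> ^ (i mod q)"
      by (simp flip: power_mult power_add)
    moreover have "[(\<xi> ^ q) ^ (i div q) * \<xi> ^ (i mod q) = 1 ^ (i div q) * \<xi> ^ (i mod q)] (mod M)"
      by (intro cong_mult cong_pow xi_q cong_refl)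
    ultimately show ?thesis by (simp only: mult_1 power_one)
  qed
  assume "[i = j] (mod q)"
  then show ?thesis using *[of i] *[of j] by (simp add: cong_def)
qed

lemma xi_square: "\<xi>\<^sup>2 + 1 = (\<xi> + 1)\<^sup>2"
  using frobenius[of \<xi> 1 1] by simp

text \<open>The dihedral norm of \<open>W\<close> is \<open>\<xi>\<^bsup>q/2\<^esup>\<close> up to the annihilator of \<open>(\<xi> + 1)\<^sup>2\<close>.  Multiplied by
  \<open>(1 + \<xi>)(1 + \<xi>\<^sup>-\<^sup>1)\<close> the norm becomes \<open>(1 + \<xi>\<^bsup>q/2\<^esup>\<xi>\<^sup>-\<^sup>1)(1 + \<xi>\<^bsup>q/2\<^esup>\<xi>)\<close>, which expands to
  \<open>\<xi>\<^bsup>q/2\<^esup>(\<xi> + \<xi>\<^sup>-\<^sup>1)\<close>.\<close>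

lemma W_norm: "[(\<xi> + 1)\<^sup>2 * (W * star W) = (\<xi> + 1)\<^sup>2 * \<xi> ^ (q div 2)] (mod M)"
proof -
  let ?m = "q div 2 - 1"
  let ?b = "\<xi> ^ (q - 1)"
  obtain r where r: "q = 4 * r" "r > 0" using q_dvd q_ge by (auto elim!: dvdE)
  have 1: "[\<xi> ^ ?m = \<xi> ^ (q div 2) * ?b] (mod M)"
  proof -
    have "q div 2 + (q - 1) = ?m + q" using r by simp
    then have "[\<xi> ^ (q div 2 + (q - 1)) = \<xi> ^ ?m] (mod M)"
      by (intro xi_power_cong) (simp add: cong_def)
    then show ?thesis by (simp only: power_add cong_sym)
  qed
  have 2: "[?b ^ ?m = \<xi> ^ (q div 2) * \<xi>] (mod M)"
  proof -
    have "(q - 1) * ?m = q * (2 * r - 2) + (q div 2 + 1)"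
      using r by (cases r) (simp_all add: algebra_simps)
    then have "[\<xi> ^ ((q - 1) * ?m) = \<xi> ^ (q div 2 + 1)] (mod M)"
      by (intro xi_power_cong) (simp add: cong_def)
    then show ?thesis by (simp only: power_add power_mult power_one_right)
  qed
  \<comment> \<open>\<open>?b\<close> represents the inverse of \<open>\<xi>\<close>\<close>
  have inv: "[\<xi> * ?b = 1] (mod M)"
    using xi_q q_ge by (simp flip: power_Suc)
  have z: "[\<xi> ^ (q div 2) * \<xi> ^ (q div 2) = 1] (mod M)"
    using xi_q r by (simp flip: power_add)
  have star: "(?b + 1) * star W = ?b ^ ?m + 1"
  proof -
    have "((\<xi> + 1) * W) \<circ>\<^sub>p ?b = (\<xi> ^ ?m + 1) \<circ>\<^sub>p ?b" by (simp only: W_geometric)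
    then show ?thesis by (simp only: pcompose_mult pcompose_add pcompose_power pcompose_xi pcompose_1)
  qed
  have b: "[?b + 1 = ?b * (\<xi> + 1)] (mod M)"
  proof -
    have "?b * (\<xi> + 1) = ?b + \<xi> * ?b" by (simp only: distrib_left distrib_right mult_1 mult_1_right add_ac mult_ac)
    then show ?thesis using cong_add[OF cong_refl[of ?b] cong_sym[OF inv]] by (simp only:)
  qed
  have "[?b * ((\<xi> + 1)\<^sup>2 * (W * star W)) = ((\<xi> + 1) * W) * ((?b + 1) * star W)] (mod M)"
  proof -
    have "[(?b * (\<xi> + 1)) * ((\<xi> + 1) * (W * star W)) = (?b + 1) * ((\<xi> + 1) * (W * star W))] (mod M)"
      by (intro cong_mult cong_refl cong_sym[OF b])
    then show ?thesis by (simp only: power2_eq_square mult_ac)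
  qed
  also have "((\<xi> + 1) * W) * ((?b + 1) * star W) = (\<xi> ^ ?m + 1) * (?b ^ ?m + 1)"
    by (simp only: W_geometric star)
  also have "[\<dots> = (\<xi> ^ (q div 2) * ?b + 1) * (\<xi> ^ (q div 2) * \<xi> + 1)] (mod M)"
    by (intro cong_mult cong_add cong_refl 1 2)
  also have "(\<xi> ^ (q div 2) * ?b + 1) * (\<xi> ^ (q div 2) * \<xi> + 1)
     = (\<xi> ^ (q div 2) * \<xi> ^ (q div 2)) * (\<xi> * ?b) + 1 + \<xi> ^ (q div 2) * (\<xi> + ?b)"
    by (simp only: distrib_left distrib_right mult_1 mult_1_right add_ac mult_ac)
  also have "[\<dots> = 1 * 1 + 1 + \<xi> ^ (q div 2) * (\<xi> + ?b)] (mod M)"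
    by (intro cong_mult cong_add cong_refl inv z)
  also have "1 * 1 + 1 + \<xi> ^ (q div 2) * (\<xi> + ?b) = \<xi> ^ (q div 2) * (1 * \<xi> + ?b)"
    by (simp only: mult_1 bit_poly_double add_0)
  also have "[\<dots> = \<xi> ^ (q div 2) * ((\<xi> * ?b) * \<xi> + ?b)] (mod M)"
    by (intro cong_mult cong_add cong_refl cong_sym[OF inv])
  also have "\<xi> ^ (q div 2) * ((\<xi> * ?b) * \<xi> + ?b) = ?b * ((\<xi> + 1)\<^sup>2 * \<xi> ^ (q div 2))"
    unfolding xi_square[symmetric] by (simp only: power2_eq_square ring_expand)
  finally show ?thesis by (rule unit_cancel[rotated]) simp
qed

text \<open>The semidihedral norm of \<open>W\<close>.  With \<open>m = q/2 - 1\<close> the geometric sum gives, as an identity between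
  polynomials, \<open>(1 + \<xi>) W W(\<xi>\<^sup>m) = 1 + \<xi>\<^bsup>m\<^sup>2\<^esup>\<close>, and \<open>m\<^sup>2 = q(q/4 - 1) + 1\<close> with \<open>q/4 - 1\<close> odd;
  dividing by \<open>1 + \<xi>\<close> leaves exactly \<open>1 + J\<close>.\<close>

lemma W_tau:
  assumes "n \<ge> 3"
  shows "[W * (W \<circ>\<^sub>p \<xi> ^ (q div 2 - 1)) = 1 + J] (mod M)"
proof -
  let ?m = "q div 2 - 1"
  define r :: nat where "r = 2 ^ (n - 3)"
  have "r > 0" by (simp add: r_def)
  have "q = 2 ^ 3 * r" unfolding r_def q_def using assms by (simp only: power_add[symmetric]) simp
  then have r: "q = 8 * r" "r > 0" using \<open>r > 0\<close> by simp_all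
  let ?k = "2 * r - 1"
  let ?s = "\<Sum>i<?k. (\<xi> ^ q) ^ i"
  have comp: "(\<xi> ^ ?m + 1) * (W \<circ>\<^sub>p \<xi> ^ ?m) = (\<xi> ^ ?m) ^ ?m + 1"
  proof -
    have "((\<xi> + 1) * W) \<circ>\<^sub>p \<xi> ^ ?m = (\<xi> ^ ?m + 1) \<circ>\<^sub>p \<xi> ^ ?m" by (simp only: W_geometric)
    then show ?thesis by (simp only: pcompose_mult pcompose_add pcompose_power pcompose_xi pcompose_1)
  qed
  have "?m * ?m = q * ?k + 1"
  proof -
    obtain t where "r = Suc t" using r(2) by (cases r) auto
    then show ?thesis by (simp add: r(1) algebra_simps)
  qed
  then have e: "(\<xi> ^ ?m) ^ ?m = \<xi> * (\<xi> ^ q) ^ ?k"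
    by (simp only: power_mult[symmetric] power_add power_one_right mult.commute)
  have J: "(\<xi> + 1) * J = \<xi> ^ q + 1"
  proof -
    have "(\<xi> + 1) * J = (\<xi> + 1) ^ Suc (q - 1)" by (simp only: J_def power_Suc)
    also have "Suc (q - 1) = q" using q_ge by simp
    finally show ?thesis by (simp only: M_eq[symmetric] M_def)
  qed
  have "(\<xi> + 1) * (W * (W \<circ>\<^sub>p \<xi> ^ ?m)) = \<xi> * (\<xi> ^ q) ^ ?k + 1"
    by (simp only: mult.assoc[symmetric] W_geometric comp e)
  also have "\<dots> = \<xi> * ((\<xi> ^ q + 1) * ?s) + (\<xi> + 1)"
    unfolding geometric by (simp only: distrib_left mult_1_right add_ac bit_poly_cancel)
  also have "\<dots> = (\<xi> + 1) * (1 + J * (\<xi> * ?s))"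
    unfolding J[symmetric] by (simp only: ring_expand)
  finally have "W * (W \<circ>\<^sub>p \<xi> ^ ?m) = 1 + J * (\<xi> * ?s)"
    by (subst (asm) mult_left_cancel) (simp_all add: one_pCons)
  moreover have "poly (\<xi> * ?s) 1 = 1"
    using r by (auto simp: poly_sum intro!: poly_of_nat_bit)
  then have "[J * (\<xi> * ?s) = J] (mod M)" using J_mult[of "\<xi> * ?s"] by simp
  ultimately show ?thesis by (simp only: cong_add cong_refl)
qed

section \<open>Counting the pairs that describe elements of order two\<close>

text \<open>The pairs \<open>(x, y)\<close> for which \<open>1 + x + yb\<close> squares to \<open>1\<close>, where \<open>b\<close> acts by \<open>\<xi> \<mapsto> \<xi>\<^sup>e\<close> and
  \<open>b\<^sup>2 = \<xi>\<^sup>m\<close>.\<close>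

definition sols :: "nat \<Rightarrow> nat \<Rightarrow> (bit poly \<times> bit poly) set" where
  "sols e m = {(x, y). degree x < q \<and> degree y < q \<and>
     [x\<^sup>2 = y * (y \<circ>\<^sub>p \<xi> ^ e) * \<xi> ^ m] (mod M) \<and> [y * (x \<circ>\<^sub>p \<xi> ^ e) = y * x] (mod M)}"

text \<open>The semidihedral solutions after the change of generator \<open>\<xi> \<mapsto> W\<close>, see \<open>sols_via_W\<close>: the
  automorphism becomes \<open>p \<mapsto> star p + odd_sum p J\<close>.\<close>

definition twisted_sols :: "(bit poly \<times> bit poly) set" where
  "twisted_sols = {(x, y). degree x < q \<and> degree y < q \<and>
     [x\<^sup>2 = y * (star y + smult (odd_sum y) J)] (mod M) \<and>
     [y * (star x + smult (odd_sum x) J) = y * x] (mod M)}"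

definition nonunit_sols :: "(bit poly \<times> bit poly) set" where
  "nonunit_sols = {(x, y) \<in> sols (q - 1) 0. poly y 1 = 0}"

abbreviation small :: "bit poly set" where "small \<equiv> {p. degree p < q}"

lemma finite_sols: "finite (sols e m)"
  by (rule finite_subset[of _ "small \<times> small"]) (auto simp: sols_def finite_bit_poly)

lemma finite_twisted_sols: "finite twisted_sols"
  by (rule finite_subset[of _ "small \<times> small"]) (auto simp: twisted_sols_def finite_bit_poly)

lemma J_annihilates: "poly y 1 = 0 \<Longrightarrow> [y * (p + smult c J) = y * p] (mod M)"
proof -
  assume y: "poly y 1 = 0"
  have "[y * p + smult c (J * y) = y * p + smult c (smult (poly y 1) J)] (mod M)"
    by (intro cong_add cong_refl) (cases c; simp only: smult_0_left smult_1_left cong_refl J_mult)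
  then show ?thesis using y by (simp add: distrib_left mult.commute)
qed

text \<open>If \<open>y\<close> is not a unit then \<open>y J = 0\<close>, and the twist disappears.\<close>

lemma nonunit_subset_twisted: "nonunit_sols \<subseteq> twisted_sols"
proof
  fix s assume "s \<in> nonunit_sols"
  then obtain x y where s: "s = (x, y)" "degree x < q" "degree y < q" and y: "poly y 1 = 0"
    and 1: "[x\<^sup>2 = y * star y] (mod M)" and 2: "[y * star x = y * x] (mod M)"
    by (auto simp: nonunit_sols_def sols_def)
  have "[x\<^sup>2 = y * (star y + smult (odd_sum y) J)] (mod M)"
    by (rule cong_trans[OF 1 cong_sym[OF J_annihilates[OF y]]])
  moreover have "[y * (star x + smult (odd_sum x) J) = y * x] (mod M)"
    by (rule cong_trans[OF J_annihilates[OF y] 2])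
  ultimately show "s \<in> twisted_sols" using s by (simp add: twisted_sols_def)
qed

lemma one_one_twisted: "(1, 1) \<in> twisted_sols" and one_one_not_in_nonunit: "(1, 1) \<notin> nonunit_sols"
  using q_ge by (simp_all add: twisted_sols_def nonunit_sols_def odd_sum_def pcompose_1 pderiv_1)

text \<open>The square of a symmetric element is its norm.\<close>

lemma sym_square_fold_coeff:
  assumes "degree x < q" "[star x = x] (mod M)"
  shows "fold_coeff (q div 2) (x\<^sup>2) = 0"
proof -
  have "fold_coeff (q div 2) (x * x) = fold_coeff (q div 2) (x * star x)"
    by (intro fold_coeff_cong cong_mult cong_refl cong_sym[OF assms(2)])
  then show ?thesis using fold_coeff_norm[OF assms(1), of "q div 2"] q_ge
    by (simp only: power2_eq_square) simp
qed

lemma fold_coeff_J: "k < q \<Longrightarrow> fold_coeff k J = 1"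
proof -
  assume k: "k < q"
  have "(\<xi> + 1) * J = (\<xi> + 1) ^ Suc (q - 1)" by (simp only: J_def power_Suc)
  also have "Suc (q - 1) = q" using q_ge by simp
  finally have "(\<xi> + 1) * J = (\<xi> + 1) * (\<Sum>i<q. \<xi> ^ i)"
    by (simp only: geometric M_eq[symmetric] M_def)
  then have J: "J = (\<Sum>i<q. \<xi> ^ i)" by (subst (asm) mult_left_cancel) (simp_all add: one_pCons)
  have "fold_coeff k J = (\<Sum>i<q. of_bool (i mod q = k))"
    by (simp only: J fold_coeff_sum fold_coeff_xi_power)
  also have "\<dots> = (\<Sum>i<q. if i = k then 1 else 0)" by (intro sum.cong) auto
  finally show ?thesis using k by simp
qed

text \<open>If \<open>y\<close> is a unit, the second equation reads \<open>star x + odd_sum x J = x\<close>; the coefficient of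
  \<open>a\<^sup>0\<close> forces \<open>odd_sum x = 0\<close>, so \<open>x\<close> is symmetric.  Then the coefficient of \<open>a\<^bsup>q/2\<^esup>\<close> in the
  first equation forces \<open>odd_sum y = 0\<close>.\<close>

lemma twisted_subset_sols: "twisted_sols \<subseteq> sols (q - 1) 0"
proof
  fix s assume "s \<in> twisted_sols"
  then obtain x y where s: "s = (x, y)" and d: "degree x < q" "degree y < q"
    and 1: "[x\<^sup>2 = y * (star y + smult (odd_sum y) J)] (mod M)"
    and 2: "[y * (star x + smult (odd_sum x) J) = y * x] (mod M)"
    by (auto simp: twisted_sols_def)
  have q2: "q div 2 \<noteq> 0" "q div 2 < q" "0 < q" using q_ge by auto
  show "s \<in> sols (q - 1) 0"
  proof (cases "poly y 1")
    case zero
    have "[x\<^sup>2 = y * star y] (mod M)"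
      by (rule cong_trans[OF 1 J_annihilates[OF zero]])
    moreover have "[y * star x = y * x] (mod M)"
      by (rule cong_trans[OF cong_sym[OF J_annihilates[OF zero]] 2])
    ultimately show ?thesis using s d by (simp add: sols_def)
  next
    case one
    have x: "[star x + smult (odd_sum x) J = x] (mod M)" by (rule unit_cancel[OF one 2])
    from fold_coeff_cong[OF x, of 0] have "fold_coeff 0 (star x) + odd_sum x = fold_coeff 0 x"
      by (simp only: fold_coeff_add fold_coeff_smult fold_coeff_J[OF q2(3)] mult_1_right)
    moreover have "fold_coeff 0 x + fold_coeff 0 (star x) = 0" using fold_coeff_trace[OF d(1)] by (simp only: fold_coeff_add)
    ultimately have lx: "odd_sum x = 0"
      by (cases "fold_coeff 0 x"; cases "fold_coeff 0 (star x)"; cases "odd_sum x") simp_all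
    have x': "[star x = x] (mod M)" using x unfolding lx by simp
    have "fold_coeff (q div 2) (x\<^sup>2) = fold_coeff (q div 2) (y * star y) + fold_coeff (q div 2) (smult (odd_sum y) (J * y))"
      unfolding fold_coeff_cong[OF 1] fold_coeff_add[symmetric]
      by (intro arg_cong[of _ _ "fold_coeff (q div 2)"]) (simp add: distrib_left mult.commute)
    also have "fold_coeff (q div 2) (smult (odd_sum y) (J * y)) = odd_sum y"
      using fold_coeff_cong[OF J_mult[of y], of "q div 2"] one fold_coeff_J[OF q2(2)] by (simp only: fold_coeff_smult mult_1_right)
    finally have ly: "odd_sum y = 0"
      using sym_square_fold_coeff[OF d(1) x'] fold_coeff_norm[OF d(2), of "q div 2"] q2(1) by simp
    have "[x\<^sup>2 = y * star y] (mod M)" using 1 unfolding ly by simp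
    moreover have "[y * star x = y * x] (mod M)" by (intro cong_mult cong_refl x')
    ultimately show ?thesis using s d by (simp add: sols_def)
  qed
qed

lemma star_xi: "[\<xi> * star \<xi> = 1] (mod M)"
proof -
  have "\<xi> * star \<xi> = \<xi> ^ Suc (q - 1)" by (simp only: pcompose_xi power_Suc)
  also have "Suc (q - 1) = q" using q_ge by simp
  finally show ?thesis using xi_q by (simp only:)
qed

lemma one_xi_sols: "(1, \<xi>) \<in> sols (q - 1) 0"
  using star_xi q_ge by (simp add: sols_def pcompose_1 cong_sym_eq)

lemma one_xi_not_twisted: "(1, \<xi>) \<notin> twisted_sols"
proof
  assume "(1, \<xi>) \<in> twisted_sols"
  then have "[1\<^sup>2 = \<xi> * (star \<xi> + smult (odd_sum \<xi>) J)] (mod M)" by (simp only: twisted_sols_def) blast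
  moreover have "odd_sum \<xi> = 1" by (simp add: odd_sum_def pderiv_pCons)
  ultimately have "[1 = \<xi> * star \<xi> + J * \<xi>] (mod M)"
    by (simp only: power_one smult_1_left distrib_left mult.commute)
  also have "[\<xi> * star \<xi> + J * \<xi> = 1 + smult (poly \<xi> 1) J] (mod M)"
    by (intro cong_add star_xi J_mult)
  finally have "[1 = 1 + J] (mod M)" by simp
  then show False using not_dvd_J by (simp add: cong_iff_dvd)
qed

lemma card_twisted_less: "card twisted_sols < card (sols (q - 1) 0)"
  using twisted_subset_sols one_xi_sols one_xi_not_twisted finite_sols
  by (intro psubset_card_mono) auto

lemma card_nonunit_less: "card nonunit_sols < card twisted_sols"
  using nonunit_subset_twisted one_one_twisted one_one_not_in_nonunit finite_twisted_sols
  by (intro psubset_card_mono) auto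

lemma mod_M_cong: "[p mod M = p] (mod M)"
  by (simp add: cong_def)

lemma cong_small_eq: "[p = r] (mod M) \<Longrightarrow> degree p < q \<Longrightarrow> degree r < q \<Longrightarrow> p = r"
  by (simp add: cong_def mod_poly_less degree_M)

lemma xi_1_dvd_M: "\<xi> + 1 dvd M"
  unfolding M_eq using q_ge by (intro dvd_power) simp

lemma dvd_M_root: "M dvd p \<Longrightarrow> poly p 1 = 0"
  by (simp only: poly_1_eq_0_iff) (rule dvd_trans[OF xi_1_dvd_M])

text \<open>If \<open>y\<close> were a unit, \<open>x\<close> would be symmetric, so the coefficient of \<open>\<xi>\<^bsup>q/2\<^esup>\<close> in \<open>x\<^sup>2\<close> would be
  \<open>0\<close>; but in \<open>\<xi>\<^bsup>q/2\<^esup> y (star y)\<close> it is \<open>1\<close>.\<close>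

lemma quaternion_nonunit:
  assumes "(x, y) \<in> sols (q - 1) (q div 2)"
  shows "poly y 1 = 0"
proof (rule ccontr)
  assume "poly y 1 \<noteq> 0"
  then have y: "poly y 1 = 1" by simp
  from assms have d: "degree x < q" "degree y < q"
    and 1: "[x\<^sup>2 = \<xi> ^ (q div 2) * (y * star y)] (mod M)" and 2: "[y * star x = y * x] (mod M)"
    by (simp_all add: sols_def mult.commute)
  have "fold_coeff (q div 2) (x\<^sup>2) = 0" using d(1) unit_cancel[OF y 2] by (rule sym_square_fold_coeff)
  moreover have "fold_coeff (q div 2) (x\<^sup>2) = poly y 1"
    using fold_coeff_cong[OF 1] fold_coeff_norm[OF d(2), of 0] by (simp only: fold_coeff_shift) simp
  ultimately show False using y by simp
qed

text \<open>Multiplication of \<open>y\<close> by the unit \<open>W\<close> changes the norm of \<open>y\<close> by the factor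
  \<open>\<xi>\<^bsup>q/2\<^esup>\<close>, because that norm
  is divisible by \<open>(\<xi> + 1)\<^sup>2\<close>; the second equation depends only on the ideal generated by \<open>y\<close>.\<close>

lemma card_quaternion_le: "card (sols (q - 1) (q div 2)) \<le> card nonunit_sols"
proof (rule card_inj_on_le)
  let ?f = "\<lambda>(x, y). (x, (W * y) mod M)"
  show "finite nonunit_sols"
    using finite_subset[OF nonunit_subset_twisted finite_twisted_sols] .
  show "inj_on ?f (sols (q - 1) (q div 2))"
  proof (rule inj_onI)
    fix s t assume st: "s \<in> sols (q - 1) (q div 2)" "t \<in> sols (q - 1) (q div 2)" "?f s = ?f t"
    obtain x y where s: "s = (x, y)" by (cases s)
    obtain x' y' where t: "t = (x', y')" by (cases t)
    from st(1,2) have d: "degree y < q" "degree y' < q" by (simp_all add: s t sols_def)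
    from st(3) have x: "x = x'" and "(W * y) mod M = (W * y') mod M"
      by (simp_all only: s t prod.case prod.inject)
    then have "[W * y = W * y'] (mod M)" by (simp only: cong_def)
    then have "[y = y'] (mod M)" by (rule unit_cancel[OF poly_W])
    then have "y = y'" using d by (rule cong_small_eq)
    then show "s = t" using x by (simp only: s t)
  qed
  show "?f ` sols (q - 1) (q div 2) \<subseteq> nonunit_sols"
  proof (rule image_subsetI)
    fix s assume s: "s \<in> sols (q - 1) (q div 2)"
    obtain x y where xy: "s = (x, y)" by (cases s)
    have y0: "poly y 1 = 0" using s unfolding xy by (rule quaternion_nonunit)
    from s have d: "degree x < q" "degree y < q"
      and 1: "[x\<^sup>2 = y * star y * \<xi> ^ (q div 2)] (mod M)" and 2: "[y * star x = y * x] (mod M)"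
      by (simp_all add: xy sols_def)
    define y' where "y' = (W * y) mod M"
    have y: "[y' = W * y] (mod M)" unfolding y'_def by (rule mod_M_cong)
    have sy: "[star y' = star W * star y] (mod M)"
      using cong_pcompose[OF _ y, of "\<xi> ^ (q - 1)"] by (simp only: pcompose_mult) simp
    have "\<xi> + 1 dvd y" "\<xi> + 1 dvd star y" using y0 by (simp_all only: poly_1_eq_0_iff[symmetric] poly_star)
    then have dvd: "(\<xi> + 1)\<^sup>2 dvd y * star y" unfolding power2_eq_square by (rule mult_dvd_mono)
    have "[x\<^sup>2 = \<xi> ^ (q div 2) * (y * star y)] (mod M)" using 1 by (simp only: mult.commute)
    also have "[\<xi> ^ (q div 2) * (y * star y) = W * star W * (y * star y)] (mod M)"
      by (rule cong_sym, rule cancel_factor[OF _ W_norm dvd]) (use q_ge in simp)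
    also have "W * star W * (y * star y) = (W * y) * (star W * star y)" by (simp only: mult_ac)
    also have "[\<dots> = y' * star y'] (mod M)"
      by (intro cong_mult cong_sym[OF y] cong_sym[OF sy])
    finally have 3: "[x\<^sup>2 = y' * star y'] (mod M)" .
    have "[y' * star x = W * y * star x] (mod M)" by (intro cong_mult cong_refl y)
    also have "[W * y * star x = W * (y * x)] (mod M)"
      unfolding mult.assoc by (intro cong_mult cong_refl 2)
    also have "W * (y * x) = (W * y) * x" by (simp only: mult.assoc)
    also have "[\<dots> = y' * x] (mod M)" by (intro cong_mult cong_refl cong_sym[OF y])
    finally have 4: "[y' * star x = y' * x] (mod M)" .
    have "\<xi> + 1 dvd y'" unfolding y'_def using \<open>\<xi> + 1 dvd y\<close> by (intro dvd_mod xi_1_dvd_M dvd_mult)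
    then have "poly y' 1 = 0" by (simp only: poly_1_eq_0_iff)
    moreover have "degree y' < q" unfolding y'_def by (rule degree_mod_M)
    moreover have "?f s = (x, y')" by (simp only: xy y'_def prod.case)
    ultimately show "?f s \<in> nonunit_sols"
      using 3 4 d by (simp add: nonunit_sols_def sols_def)
  qed
qed

text \<open>\<open>W\<close> is again a generator: \<open>W + 1\<close> is a unit times \<open>\<xi> + 1\<close>.  The unit \<open>V\<close> has
  \<open>q/4 - 1\<close> terms, an odd number for \<open>n \<ge> 3\<close>.\<close>

lemma W_plus_1:
  assumes "n \<ge> 3"
  obtains V where "W + 1 = (\<xi> + 1) * V" "poly V 1 = 1"
proof -
  define r :: nat where "r = 2 ^ (n - 3)"
  have "r > 0" by (simp add: r_def)
  have "q = 2 ^ 3 * r" unfolding r_def q_def using assms by (simp only: power_add[symmetric]) simp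
  then have r: "q = 8 * r" "r > 0" using \<open>r > 0\<close> by simp_all
  \<comment> \<open>\<open>W + 1 = \<xi> + \<dots> + \<xi>\<^bsup>q/2-2\<^esup>\<close>, divided by \<open>\<xi> + 1\<close> by grouping the terms in pairs\<close>
  define V where "V = \<xi> * (\<Sum>i<2 * r - 1. (\<xi>\<^sup>2) ^ i)"
  have "q div 2 - 1 = Suc (2 * (2 * r - 1))" using r by (cases r) simp_all
  then have "\<xi> ^ (q div 2 - 1) = \<xi> * (\<xi>\<^sup>2) ^ (2 * r - 1)" by (simp only: power_Suc power_mult)
  then have "(\<xi> + 1) * (W + 1) = \<xi> * (\<xi>\<^sup>2) ^ (2 * r - 1) + 1 + (\<xi> + 1)"
    by (simp only: distrib_left[of _ W] W_geometric mult_1_right)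
  also have "\<dots> = \<xi> * ((\<xi>\<^sup>2) ^ (2 * r - 1) + 1)"
    by (simp only: distrib_left mult_1_right add_ac bit_poly_cancel)
  also have "\<dots> = (\<xi> + 1) * ((\<xi> + 1) * V)"
    unfolding geometric[of "\<xi>\<^sup>2" "2 * r - 1", symmetric] V_def xi_square by (simp only: power2_eq_square mult_ac)
  finally have "W + 1 = (\<xi> + 1) * V"
    by (subst (asm) mult_left_cancel) (simp_all add: one_pCons)
  moreover have "poly V 1 = 1"
    using r unfolding V_def by (auto simp: poly_sum intro!: poly_of_nat_bit)
  ultimately show thesis by (rule that)
qed

text \<open>Substitution of \<open>W\<close> preserves the multiplicity of the root \<open>1\<close>, hence is injective modulo \<open>M\<close>.\<close>

lemma dvd_pcompose_W:
  assumes n: "n \<ge> 3" and P: "M dvd P \<circ>\<^sub>p W"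
  shows "M dvd P"
proof (cases "P = 0")
  case False
  have X1: "[:- 1, 1:] = \<xi> + 1" by (simp add: one_pCons)
  obtain k r where r: "P = (\<xi> + 1) ^ k * r" "\<not> \<xi> + 1 dvd r"
    using order_decomp[OF False, of 1] unfolding X1 by blast
  obtain V where V: "W + 1 = (\<xi> + 1) * V" "poly V 1 = 1" using W_plus_1[OF n] .
  have "P \<circ>\<^sub>p W = (\<xi> + 1) ^ k * (V ^ k * (r \<circ>\<^sub>p W))"
    unfolding r(1) pcompose_mult pcompose_power pcompose_add pcompose_xi pcompose_1 V(1) power_mult_distrib
    by (simp only: mult.assoc)
  moreover have "poly (V ^ k * (r \<circ>\<^sub>p W)) 1 = 1"
    using r(2) V(2) by (simp add: poly_pcompose poly_1_eq_0_iff[symmetric])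
  moreover have "k \<ge> q"
  proof (rule ccontr)
    assume "\<not> k \<ge> q"
    then have "q = k + (q - k)" "q - k > 0" by simp_all
    then have "M = (\<xi> + 1) ^ k * (\<xi> + 1) ^ (q - k)" by (metis M_eq power_add)
    then have "(\<xi> + 1) ^ (q - k) dvd V ^ k * (r \<circ>\<^sub>p W)"
      using P calculation(1) by (simp add: one_pCons)
    then have "\<xi> + 1 dvd V ^ k * (r \<circ>\<^sub>p W)"
      using \<open>q - k > 0\<close> by (meson dvd_power dvd_trans)
    then show False using calculation(2) by (simp only: poly_1_eq_0_iff[symmetric]) simp
  qed
  ultimately show ?thesis unfolding r(1) M_eq by (intro dvd_mult2 le_imp_power_dvd)
qed simp

lemma pcompose_W_cong_iff:
  assumes "n \<ge> 3"
  shows "[P \<circ>\<^sub>p W = R \<circ>\<^sub>p W] (mod M) \<longleftrightarrow> [P = R] (mod M)"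
proof
  assume "[P \<circ>\<^sub>p W = R \<circ>\<^sub>p W] (mod M)"
  then show "[P = R] (mod M)"
    using dvd_pcompose_W[OF assms, of "P + R"] by (simp add: cong_iff_dvd pcompose_add)
qed (rule cong_pcompose[OF poly_W])

text \<open>As \<open>J\<^sup>2 = 0\<close>, this is a Taylor expansion to first order; the derivative enters only through its
  value at \<open>1\<close>.\<close>

lemma pcompose_plus_J:
  assumes V: "poly V 1 = 1"
  shows "[p \<circ>\<^sub>p (V + J) = p \<circ>\<^sub>p V + smult (odd_sum p) J] (mod M)"
proof (induction p)
  case (pCons a p)
  let ?c = "odd_sum p"
  have odd_sum: "odd_sum (pCons a p) = poly p 1 + ?c" by (simp add: odd_sum_def pderiv_pCons)
  have "(V + J) * (p \<circ>\<^sub>p V + smult ?c J)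
      = V * (p \<circ>\<^sub>p V) + (J * (p \<circ>\<^sub>p V) + (smult ?c (J * V) + smult ?c (J * J)))"
    by (simp only: distrib_left distrib_right mult_smult_right mult_smult_left smult_add_right add_ac mult_ac)
  also have "[\<dots> = V * (p \<circ>\<^sub>p V) + (smult (poly (p \<circ>\<^sub>p V) 1) J + (smult ?c (smult (poly V 1) J) + smult ?c 0))] (mod M)"
    by (intro cong_add cong_refl J_mult)
      (cases ?c; simp only: smult_0_left smult_1_left cong_refl J_mult J_J)+
  also have "V * (p \<circ>\<^sub>p V) + (smult (poly (p \<circ>\<^sub>p V) 1) J + (smult ?c (smult (poly V 1) J) + smult ?c 0))
      = V * (p \<circ>\<^sub>p V) + smult (poly p 1 + ?c) J"
    unfolding V poly_pcompose smult_add_left by (simp only: smult_1_left smult_0_right add_0_right)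
  finally have *: "[(V + J) * (p \<circ>\<^sub>p V + smult ?c J) = V * (p \<circ>\<^sub>p V) + smult (poly p 1 + ?c) J] (mod M)" .
  have "[(V + J) * (p \<circ>\<^sub>p (V + J)) = (V + J) * (p \<circ>\<^sub>p V + smult ?c J)] (mod M)"
    by (intro cong_mult cong_refl pCons.IH)
  from cong_trans[OF this *] show ?case
    unfolding pcompose_pCons odd_sum add.assoc by (intro cong_add cong_refl)
qed (simp add: odd_sum_def)

lemma J_pcompose_W:
  assumes "n \<ge> 3"
  shows "[J \<circ>\<^sub>p W = J] (mod M)"
proof -
  obtain V where V: "W + 1 = (\<xi> + 1) * V" "poly V 1 = 1" using W_plus_1[OF assms] .
  have "J \<circ>\<^sub>p W = J * V ^ (q - 1)"
    unfolding J_def by (simp only: pcompose_power pcompose_add pcompose_xi pcompose_1 V(1) power_mult_distrib)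
  then show ?thesis using J_mult[of "V ^ (q - 1)"] V(2) by simp
qed

text \<open>By \<open>W_tau\<close> the semidihedral automorphism maps \<open>W\<close> to \<open>W\<^sup>-\<^sup>1(1 + J) = W\<^sup>-\<^sup>1 + J\<close>.\<close>

lemma twist_W:
  assumes "n \<ge> 3"
  shows "[(x \<circ>\<^sub>p W) \<circ>\<^sub>p \<xi> ^ (q div 2 - 1) = (star x + smult (odd_sum x) J) \<circ>\<^sub>p W] (mod M)"
proof -
  let ?A = "\<xi> ^ (q div 2 - 1)"
  have W': "[W \<circ>\<^sub>p ?A = W ^ (q - 1) + J] (mod M)"
  proof (rule unit_cancel[OF poly_W])
    have "W * W ^ (q - 1) = W ^ q" using q_ge by (simp flip: power_Suc)
    then have "[W * (W ^ (q - 1) + J) = 1 + smult (poly W 1) J] (mod M)"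
      unfolding distrib_left mult.commute[of W J] by (intro cong_add J_mult) (simp add: power_q_cong_1)
    then have "[W * (W ^ (q - 1) + J) = 1 + J] (mod M)" by simp
    then show "[W * (W \<circ>\<^sub>p ?A) = W * (W ^ (q - 1) + J)] (mod M)"
      by (rule cong_trans[OF W_tau[OF assms] cong_sym])
  qed
  have "(x \<circ>\<^sub>p W) \<circ>\<^sub>p ?A = x \<circ>\<^sub>p (W \<circ>\<^sub>p ?A)" by (simp only: pcompose_assoc)
  also have "[\<dots> = x \<circ>\<^sub>p (W ^ (q - 1) + J)] (mod M)" by (rule pcompose_cong_right[OF W'])
  also have "[x \<circ>\<^sub>p (W ^ (q - 1) + J) = x \<circ>\<^sub>p W ^ (q - 1) + smult (odd_sum x) J] (mod M)"
    by (rule pcompose_plus_J) simp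
  also have "[x \<circ>\<^sub>p W ^ (q - 1) + smult (odd_sum x) J = x \<circ>\<^sub>p W ^ (q - 1) + smult (odd_sum x) (J \<circ>\<^sub>p W)] (mod M)"
    by (intro cong_add cong_refl)
      (cases "odd_sum x"; simp only: smult_0_left smult_1_left cong_refl cong_sym[OF J_pcompose_W[OF assms]])
  also have "x \<circ>\<^sub>p W ^ (q - 1) + smult (odd_sum x) (J \<circ>\<^sub>p W) = (star x + smult (odd_sum x) J) \<circ>\<^sub>p W"
    by (simp only: pcompose_add pcompose_smult pcompose_assoc[symmetric] pcompose_power pcompose_xi)
  finally show ?thesis .
qed

text \<open>By \<open>twist_W\<close> the equations for the substituted pair are the images of the twisted equations, and
  substitution of \<open>W\<close> is injective.\<close>

lemma sols_via_W:
  assumes n: "n \<ge> 3" and d: "degree x < q" "degree y < q"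
  shows "((x \<circ>\<^sub>p W) mod M, (y \<circ>\<^sub>p W) mod M) \<in> sols (q div 2 - 1) 0 \<longleftrightarrow> (x, y) \<in> twisted_sols"
proof -
  let ?A = "\<xi> ^ (q div 2 - 1)"
  let ?x = "(x \<circ>\<^sub>p W) mod M" and ?y = "(y \<circ>\<^sub>p W) mod M"
  have x: "[?x = x \<circ>\<^sub>p W] (mod M)" and y: "[?y = y \<circ>\<^sub>p W] (mod M)" by (rule mod_M_cong)+
  have t: "[((p \<circ>\<^sub>p W) mod M) \<circ>\<^sub>p ?A = (star p + smult (odd_sum p) J) \<circ>\<^sub>p W] (mod M)" for p
    by (rule cong_trans[OF cong_pcompose[OF _ mod_M_cong] twist_W[OF n]]) simp
  have a: "[?y * (?y \<circ>\<^sub>p ?A) * \<xi> ^ 0 = (y * (star y + smult (odd_sum y) J)) \<circ>\<^sub>p W] (mod M)"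
    unfolding power_0 mult_1_right pcompose_mult by (intro cong_mult y t)
  have b: "[?x\<^sup>2 = x\<^sup>2 \<circ>\<^sub>p W] (mod M)"
    unfolding pcompose_power by (intro cong_pow x)
  from cong_replace[OF b a] have 1: "[?x\<^sup>2 = ?y * (?y \<circ>\<^sub>p ?A) * \<xi> ^ 0] (mod M) \<longleftrightarrow>
      [x\<^sup>2 = y * (star y + smult (odd_sum y) J)] (mod M)"
    unfolding pcompose_W_cong_iff[OF n] .
  have c: "[?y * (?x \<circ>\<^sub>p ?A) = (y * (star x + smult (odd_sum x) J)) \<circ>\<^sub>p W] (mod M)"
    unfolding pcompose_mult by (intro cong_mult y t)
  have d': "[?y * ?x = (y * x) \<circ>\<^sub>p W] (mod M)"
    unfolding pcompose_mult by (intro cong_mult y x)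
  from cong_replace[OF c d'] have 2: "[?y * (?x \<circ>\<^sub>p ?A) = ?y * ?x] (mod M) \<longleftrightarrow>
      [y * (star x + smult (odd_sum x) J) = y * x] (mod M)"
    unfolding pcompose_W_cong_iff[OF n] .
  show ?thesis
    unfolding sols_def twisted_sols_def mem_Collect_eq prod.case 1 2
    using d by (simp only: degree_mod_M simp_thms)
qed

lemma card_semidihedral:
  assumes n: "n \<ge> 3"
  shows "card (sols (q div 2 - 1) 0) = card twisted_sols"
proof -
  let ?g = "\<lambda>p. (p \<circ>\<^sub>p W) mod M"
  let ?f = "map_prod ?g ?g"
  have inj: "inj_on ?g small"
  proof (rule inj_onI)
    fix p r assume "p \<in> small" "r \<in> small" "?g p = ?g r"
    then have "[p \<circ>\<^sub>p W = r \<circ>\<^sub>p W] (mod M)" "degree p < q" "degree r < q"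
      by (simp_all only: cong_def mem_Collect_eq)
    then show "p = r" by (simp only: pcompose_W_cong_iff[OF n] cong_small_eq)
  qed
  have "?g ` small = small"
    by (rule endo_inj_surj[OF finite_bit_poly _ inj]) (auto simp: degree_mod_M)
  then have surj: "?f ` (small \<times> small) = small \<times> small" by (simp add: map_prod_surj_on)
  have "?f ` twisted_sols = sols (q div 2 - 1) 0"
  proof (intro subset_antisym subsetI)
    fix s assume "s \<in> ?f ` twisted_sols"
    then obtain x y where s: "s = (?g x, ?g y)" and xy: "(x, y) \<in> twisted_sols" by auto
    then have "degree x < q" "degree y < q" by (simp_all add: twisted_sols_def)
    then show "s \<in> sols (q div 2 - 1) 0" using sols_via_W[OF n] xy s by simp
  next
    fix s assume s: "s \<in> sols (q div 2 - 1) 0"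
    then have "s \<in> small \<times> small" by (auto simp: sols_def)
    then have "s \<in> ?f ` (small \<times> small)" unfolding surj .
    then obtain x y where xy: "s = (?g x, ?g y)" "degree x < q" "degree y < q" by auto
    then have "(x, y) \<in> twisted_sols" using sols_via_W[OF n] s by simp
    then show "s \<in> ?f ` twisted_sols" using xy(1) by (intro image_eqI[of _ _ "(x, y)"]) simp_all
  qed
  moreover have "inj_on ?f twisted_sols"
    by (rule inj_on_subset[OF map_prod_inj_on[OF inj inj]]) (auto simp: twisted_sols_def)
  ultimately show ?thesis using card_image by fastforce
qed

text \<open>The pair \<open>(0, 1)\<close> is never a solution, so the trivial bound is strict.\<close>

lemma card_sols_less: "card (sols e m) < 2 ^ (2 * q)"
proof -
  have "(0, 1) \<notin> sols e m"
  proof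
    assume "(0, 1) \<in> sols e m"
    then have "[0\<^sup>2 = 1 * (1 \<circ>\<^sub>p \<xi> ^ e) * \<xi> ^ m] (mod M)" by (simp only: sols_def) blast
    then have "M dvd \<xi> ^ m" by (simp add: cong_iff_dvd pcompose_1)
    from dvd_M_root[OF this] show False by simp
  qed
  moreover have "(0, 1) \<in> small \<times> small" using q_ge by simp
  moreover have "sols e m \<subseteq> small \<times> small" by (auto simp: sols_def)
  ultimately have "sols e m \<subset> small \<times> small" by blast
  then have "card (sols e m) < card (small \<times> small)"
    by (intro psubset_card_mono) (simp_all add: finite_bit_poly)
  also have "\<dots> = 2 ^ (2 * q)"
    using q_ge by (simp add: card_cartesian_product card_bit_poly mult_2 power_add)
  finally show ?thesis .
qed

text \<open>If \<open>x\<close> and \<open>y\<close> are both divisible by \<open>(\<xi> + 1)\<^bsup>q/2\<^esup>\<close>, all products in the equations vanish.\<close>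

lemma card_sols_ge: "2 ^ q \<le> card (sols e m)"
proof -
  let ?h = "q div 2" and ?T = "(\<xi> + 1) ^ (q div 2)"
  let ?D = "{p :: bit poly. degree p < ?h}"
  let ?f = "map_prod ((*) ?T) ((*) ?T)"
  have h: "?h + ?h = q" "?h > 0" using q_dvd q_ge by auto
  have T: "?T \<noteq> 0" "degree ?T = ?h" by (simp_all add: one_pCons degree_power_eq)
  have TT: "?T * ?T = M" by (simp only: power_add[symmetric] h M_eq)
  have zero: "[(?T * u) * ((?T * v) \<circ>\<^sub>p \<xi> ^ k) = 0] (mod M)" for u v k
  proof -
    have "\<xi> + 1 dvd (\<xi> + 1) \<circ>\<^sub>p \<xi> ^ k" by (simp only: poly_1_eq_0_iff[symmetric] poly_pcompose) simp
    then have "?T dvd ?T \<circ>\<^sub>p \<xi> ^ k" unfolding pcompose_power by (rule dvd_power_same)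
    then have "?T * ?T dvd (?T * u) * ((?T * v) \<circ>\<^sub>p \<xi> ^ k)"
      unfolding pcompose_mult by (intro mult_dvd_mono dvd_mult2 dvd_refl)
    then show ?thesis by (simp only: TT cong_0_iff)
  qed
  have sub: "?f ` (?D \<times> ?D) \<subseteq> sols e m"
  proof
    fix s assume "s \<in> ?f ` (?D \<times> ?D)"
    then obtain u v where s: "s = (?T * u, ?T * v)" and d: "degree u < ?h" "degree v < ?h" by auto
    have "degree (?T * p) < q" if "degree p < ?h" for p
      using degree_mult_le[of ?T p] that T h by linarith
    moreover have "[(?T * u)\<^sup>2 = 0] (mod M)" "[(?T * v) * (?T * u) = 0] (mod M)"
      using zero[of u u 1] zero[of v u 1] by (simp_all only: power_one_right pcompose_idR power2_eq_square)
    moreover have "[(?T * v) * ((?T * v) \<circ>\<^sub>p \<xi> ^ e) * \<xi> ^ m = 0 * \<xi> ^ m] (mod M)"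
      by (intro cong_mult cong_refl zero)
    ultimately show "s \<in> sols e m"
      using d zero[of v u e] unfolding sols_def s mem_Collect_eq prod.case mult_zero_left
      by (simp add: cong_def)
  qed
  have "inj_on ?f (?D \<times> ?D)"
    using T(1) by (intro map_prod_inj_on inj_onI) simp_all
  then have "card (?D \<times> ?D) \<le> card (sols e m)" using sub finite_sols by (rule card_inj_on_le)
  moreover have "card (?D \<times> ?D) = 2 ^ ?h * 2 ^ ?h" using h by (simp only: card_cartesian_product card_bit_poly)
  ultimately show ?thesis by (simp only: power_add[symmetric] h)
qed

end

section \<open>Classification of the 2-groups of maximal class\<close>

lemma (in group) inv_mult_eq_one_iff:
  assumes "u \<in> carrier G" "v \<in> carrier G"
  shows "inv u \<otimes> v = \<one> \<longleftrightarrow> v = u"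
proof
  assume "inv u \<otimes> v = \<one>"
  then have "u \<otimes> (inv u \<otimes> v) = u \<otimes> \<one>" by simp
  then show "v = u" using assms by (simp flip: m_assoc)
qed (use assms in simp)

lemma (in group) commutator_alt:
  assumes "x \<in> carrier G" "y \<in> carrier G"
  shows "group_commutator G x y = inv (y \<otimes> x) \<otimes> (x \<otimes> y)"
  using assms by (simp add: group_commutator_def inv_mult_group m_assoc)

lemma (in group) commutator_closed [simp]:
  "x \<in> carrier G \<Longrightarrow> y \<in> carrier G \<Longrightarrow> group_commutator G x y \<in> carrier G"
  by (simp add: group_commutator_def)

lemma (in group) commutator_eq_one_iff:
  assumes "x \<in> carrier G" "y \<in> carrier G"
  shows "group_commutator G x y = \<one> \<longleftrightarrow> x \<otimes> y = y \<otimes> x"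
  unfolding commutator_alt[OF assms] using assms by (intro inv_mult_eq_one_iff) simp_all

text \<open>Computations modulo a normal subgroup are carried out in an arbitrary group \<open>Q\<close> with a
  homomorphism of kernel \<open>N\<close>, so that products of cosets do not appear.\<close>

locale projection = group_hom G Q p for G (structure) and Q (structure) and p +
  fixes N
  assumes kernel_iff: "x \<in> carrier G \<Longrightarrow> p x = \<one>\<^bsub>Q\<^esub> \<longleftrightarrow> x \<in> N"
begin

lemma p_commutator:
  assumes "x \<in> carrier G" "y \<in> carrier G"
  shows "p (group_commutator G x y) = group_commutator Q (p x) (p y)"
  using assms by (simp add: group_commutator_def)

lemma commutator_in_iff:
  assumes "x \<in> carrier G" "y \<in> carrier G"
  shows "group_commutator G x y \<in> N \<longleftrightarrow> p x \<otimes>\<^bsub>Q\<^esub> p y = p y \<otimes>\<^bsub>Q\<^esub> p x"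
  using assms by (simp flip: kernel_iff add: p_commutator H.commutator_eq_one_iff)

end

lemma (in group) conj_pow:
  assumes "x \<in> carrier G" "y \<in> carrier G"
  shows "(inv y \<otimes> x \<otimes> y) [^] (k::nat) = inv y \<otimes> x [^] k \<otimes> y"
proof (induction k)
  case (Suc k)
  have "y \<otimes> (inv y \<otimes> (x \<otimes> y)) = x \<otimes> y" using assms by (simp flip: m_assoc)
  then show ?case unfolding nat_pow_Suc Suc using assms by (simp add: m_assoc)
qed (use assms in simp)

lemma (in group) commute_mult:
  assumes "x \<in> carrier G" "y \<in> carrier G" "z \<in> carrier G"
    and "x \<otimes> z = z \<otimes> x" "y \<otimes> z = z \<otimes> y"
  shows "(x \<otimes> y) \<otimes> z = z \<otimes> (x \<otimes> y)"
  using assms by (metis m_assoc)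

context projection
begin

text \<open>A group generated by central elements and one further element is abelian.\<close>

lemma central_by_cyclic:
  assumes b: "b \<in> carrier G" and C: "C \<subseteq> carrier G"
    and central: "\<And>h y. h \<in> C \<Longrightarrow> y \<in> carrier G \<Longrightarrow> group_commutator G h y \<in> N"
    and gen: "\<And>g. g \<in> carrier G \<Longrightarrow> \<exists>k::nat. \<exists>h\<in>C. g = b [^] k \<otimes> h"
    and x: "x \<in> carrier G" and y: "y \<in> carrier G"
  shows "group_commutator G x y \<in> N"
proof -
  obtain k h where kh: "h \<in> C" "x = b [^] (k::nat) \<otimes> h" using gen[OF x] by blast
  obtain l j where lj: "j \<in> C" "y = b [^] (l::nat) \<otimes> j" using gen[OF y] by blast
  have c: "h \<in> carrier G" "j \<in> carrier G" "b [^] k \<in> carrier G" "b [^] l \<in> carrier G"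
    using kh lj C b by auto
  have comm: "p u \<otimes>\<^bsub>Q\<^esub> p v = p v \<otimes>\<^bsub>Q\<^esub> p u" if "u \<in> C" "v \<in> carrier G" for u v
    using commutator_in_iff[of u v] central[OF that] that C by blast
  have "p (b [^] l) \<otimes>\<^bsub>Q\<^esub> p (b [^] k) = p (b [^] k) \<otimes>\<^bsub>Q\<^esub> p (b [^] l)"
    using b by (simp only: hom_mult[symmetric] G.nat_pow_closed G.nat_pow_mult add.commute)
  then have "p y \<otimes>\<^bsub>Q\<^esub> p (b [^] k) = p (b [^] k) \<otimes>\<^bsub>Q\<^esub> p y"
    unfolding lj(2) hom_mult[OF c(4) c(2)]
    by (rule H.commute_mult[OF hom_closed[OF c(4)] hom_closed[OF c(2)] hom_closed[OF c(3)] _ comm[OF lj(1) c(3)]])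
  then have "p x \<otimes>\<^bsub>Q\<^esub> p y = p y \<otimes>\<^bsub>Q\<^esub> p x"
    unfolding kh(2) hom_mult[OF c(3) c(1)]
    by (intro H.commute_mult[OF hom_closed[OF c(3)] hom_closed[OF c(1)] hom_closed[OF y] _ comm[OF kh(1) y]]) simp
  then show ?thesis using commutator_in_iff[OF x y] by simp
qed

end

lemma (in group) projection_Mod:
  assumes "N \<lhd> G"
  shows "projection G (G Mod N) (\<lambda>x. N #> x) N"
proof -
  interpret N: normal N G by fact
  interpret Q: group "G Mod N" by (rule N.factorgroup_is_group)
  have "group_hom G (G Mod N) (\<lambda>x. N #> x)"
    by unfold_locales (rule N.r_coset_hom_Mod)
  moreover have "N #> x = \<one>\<^bsub>G Mod N\<^esub> \<longleftrightarrow> x \<in> N" if "x \<in> carrier G" for x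
    using that coset_join1[of N x] coset_join2[of x N] N.subgroup_axioms by auto
  ultimately show ?thesis by (simp add: projection_def projection_axioms_def)
qed

text \<open>Normality is automatic: \<open>x h x\<^sup>-\<^sup>1\<close> is \<open>h\<close> times a commutator of \<open>h\<close>.\<close>

lemma (in group) commutator_subgroup_normal:
  assumes "N \<lhd> G"
  defines "K \<equiv> generate G {group_commutator G x y |x y. x \<in> N \<and> y \<in> carrier G}"
  shows "K \<subseteq> N" "K \<lhd> G"
proof -
  interpret N: normal N G by fact
  let ?S = "{group_commutator G x y |x y. x \<in> N \<and> y \<in> carrier G}"
  have S: "?S \<subseteq> N"
  proof clarify
    fix x y assume xy: "x \<in> N" "y \<in> carrier G"
    then have "inv x \<otimes> (inv y \<otimes> x \<otimes> y) \<in> N" by (simp add: N.inv_op_closed1)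
    then show "group_commutator G x y \<in> N"
      using xy N.subset by (simp add: group_commutator_def m_assoc subset_iff)
  qed
  then show "K \<subseteq> N" unfolding K_def by (rule generate_subgroup_incl) (rule N.subgroup_axioms)
  have sub: "subgroup K G"
    unfolding K_def by (rule generate_is_subgroup) (use S N.subset in blast)
  interpret K: subgroup K G by (rule sub)
  show "K \<lhd> G"
  proof (rule normal_invI[OF sub])
    fix x h assume x: "x \<in> carrier G" and h: "h \<in> K"
    then have hN: "h \<in> N" using \<open>K \<subseteq> N\<close> by blast
    have "group_commutator G h (inv x) \<in> K"
      unfolding K_def by (rule generate.incl) (use hN x in blast)
    then have "h \<otimes> group_commutator G h (inv x) \<in> K" using h by simp
    moreover have "h \<otimes> group_commutator G h (inv x) = x \<otimes> h \<otimes> inv x"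
      using x N.subset hN by (simp add: group_commutator_def subset_iff m_assoc[symmetric])
    ultimately show "x \<otimes> h \<otimes> inv x \<in> K" by simp
  qed
qed

lemma (in group) lower_central_normal: "lower_central G i \<lhd> G"
proof (induction i)
  case 0
  then show ?case using normal_self by simp
qed (simp add: commutator_subgroup_normal)

lemma (in group) lower_central_Suc_subset: "lower_central G (Suc i) \<subseteq> lower_central G i"
  using commutator_subgroup_normal(1)[OF lower_central_normal] by simp

lemma (in group) lower_central_Suc_subset_iff:
  assumes "N \<lhd> G"
  shows "lower_central G (Suc i) \<subseteq> N \<longleftrightarrow>
    (\<forall>x\<in>lower_central G i. \<forall>y\<in>carrier G. group_commutator G x y \<in> N)"
proof
  assume "lower_central G (Suc i) \<subseteq> N"
  then show "\<forall>x\<in>lower_central G i. \<forall>y\<in>carrier G. group_commutator G x y \<in> N"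
    by (auto intro: generate.incl)
next
  assume "\<forall>x\<in>lower_central G i. \<forall>y\<in>carrier G. group_commutator G x y \<in> N"
  then have "{group_commutator G x y |x y. x \<in> lower_central G i \<and> y \<in> carrier G} \<subseteq> N" by blast
  then show "lower_central G (Suc i) \<subseteq> N"
    using generate_subgroup_incl normal_imp_subgroup[OF assms] by simp
qed

lemma (in group) index_two:
  assumes "subgroup K G" "subgroup H G" "K \<subseteq> H" "finite H" "card H \<le> 2 * card K"
    and x: "x \<in> H" "x \<notin> K" and y: "y \<in> H" "y \<notin> K"
  shows "y \<otimes> inv x \<in> K"
proof -
  interpret K: subgroup K G by fact
  interpret H: subgroup H G by fact
  have disj: "K \<inter> (K #> x) = {}"
  proof (rule ccontr)
    assume "K \<inter> (K #> x) \<noteq> {}"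
    then obtain k where k: "k \<in> K" "k \<otimes> x \<in> K" by (auto simp: r_coset_def)
    have "inv k \<otimes> (k \<otimes> x) \<in> K" using k(2) by (rule K.m_closed[OF K.m_inv_closed[OF k(1)]])
    moreover have "inv k \<otimes> (k \<otimes> x) = x"
      using K.mem_carrier[OF k(1)] H.mem_carrier[OF x(1)] by (simp flip: m_assoc)
    ultimately show False using x(2) by simp
  qed
  have sub: "K \<union> (K #> x) \<subseteq> H" using assms(3) x by (auto simp: r_coset_def)
  have fin: "finite K" using assms(3,4) by (rule finite_subset)
  have "card (K #> x) = card K"
    using card_rcosets_equal[OF rcosetsI[OF K.subset H.mem_carrier[OF x(1)]] K.subset] by simp
  then have "card (K \<union> (K #> x)) = 2 * card K"
    using disj fin finite_subset[OF sub assms(4)] by (subst card_Un_disjoint) auto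
  then have "K \<union> (K #> x) = H" using assms(4,5) sub by (intro card_seteq) simp_all
  then obtain k where "k \<in> K" "y = k \<otimes> x" using y by (auto simp: r_coset_def)
  then show ?thesis using x by (simp add: m_assoc)
qed

lemma (in group) index_two_coset:
  assumes "subgroup K G" "subgroup H G" "K \<subseteq> H" "finite H" "card H \<le> 2 * card K"
    and x: "x \<in> H" "x \<notin> K" and y: "y \<in> H"
  obtains d where "d \<in> K" "y = d \<or> y = x \<otimes> d"
proof (cases "y \<in> K")
  case False
  interpret K: subgroup K G by fact
  interpret H: subgroup H G by fact
  have yi: "inv y \<in> H" "inv y \<notin> K" and xi: "inv x \<in> H" "inv x \<notin> K"
    using x y False K.m_inv_closed[of "inv y"] K.m_inv_closed[of "inv x"] by auto
  have "inv y \<otimes> inv (inv x) \<in> K"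
    by (rule index_two[OF assms(1-5) xi yi])
  then have "inv (inv y \<otimes> inv (inv x)) \<in> K" by (rule K.m_inv_closed)
  moreover have "inv (inv y \<otimes> inv (inv x)) = inv x \<otimes> y"
    using x y by (simp add: inv_mult_group)
  ultimately have d: "inv x \<otimes> y \<in> K" by simp
  have "y = x \<otimes> (inv x \<otimes> y)" using x y by (simp flip: m_assoc)
  with d show thesis using that by blast
qed (use that in blast)

lemma (in group) involutions_commute:
  assumes "x \<in> carrier G" "y \<in> carrier G" "x \<otimes> x = \<one>" "y \<otimes> y = \<one>" "(x \<otimes> y) \<otimes> (x \<otimes> y) = \<one>"
  shows "x \<otimes> y = y \<otimes> x"
proof -
  have "inv x = x" "inv y = y" "inv (x \<otimes> y) = x \<otimes> y"
    using assms by (simp_all add: inv_equality)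
  then show ?thesis using inv_mult_group[OF assms(1,2)] by simp
qed

lemma (in projection) same_image: "g \<in> carrier G \<Longrightarrow> u \<in> carrier G \<Longrightarrow> p g = p u \<Longrightarrow> inv u \<otimes> g \<in> N"
  by (subst kernel_iff[symmetric]) simp_all

text \<open>If \<open>x\<^sup>2\<close> were outside \<open>K\<close>, so would be \<open>x\<close>, and the quotient \<open>x\<close> of the two would lie in \<open>K\<close>.\<close>

lemma (in group) index_two_square:
  assumes "K \<lhd> G" "subgroup H G" "K \<subseteq> H" "finite H" "card H \<le> 2 * card K" and x: "x \<in> H"
  shows "x \<otimes> x \<in> K"
proof (rule ccontr)
  interpret K: normal K G by fact
  interpret H: subgroup H G by fact
  assume n: "x \<otimes> x \<notin> K"
  then have xK: "x \<notin> K" by auto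
  have "x \<otimes> x \<otimes> inv x \<in> K"
    using index_two[OF K.subgroup_axioms assms(2-5) x xK _ n] x by simp
  then show False using x xK by (simp add: m_assoc)
qed

locale maximal_class = group G for G (structure) +
  fixes n :: nat
  assumes n2: "n \<ge> 2" and order_G: "order G = 2 ^ (n + 1)" and class_n: "has_nilpotency_class G n"
begin

abbreviation lc :: "nat \<Rightarrow> 'a set" where "lc \<equiv> lower_central G"

lemma fin: "finite (carrier G)"
  using order_G order_gt_0_iff_finite by simp

lemma lc_subgroup: "subgroup (lc i) G"
  by (rule normal_imp_subgroup[OF lower_central_normal])

lemma lc_closed: "x \<in> lc i \<Longrightarrow> x \<in> carrier G"
  using subgroup.subset[OF lc_subgroup] by blast

lemma lc_fin: "finite (lc i)"
  using finite_subset[OF subgroup.subset[OF lc_subgroup] fin] .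

lemma lc_n: "lc n = {\<one>}" and lc_not_trivial: "i < n \<Longrightarrow> lc i \<noteq> {\<one>}"
  using class_n by (auto simp: has_nilpotency_class_def)

text \<open>Once two consecutive terms agree, the series is constant.\<close>

lemma lc_strict: "i < n \<Longrightarrow> \<not> lc i \<subseteq> lc (Suc i)"
proof
  assume i: "i < n" and sub: "lc i \<subseteq> lc (Suc i)"
  then have eq: "lc (Suc i) = lc i" using lower_central_Suc_subset by blast
  have "lc (i + k) = lc i" for k
  proof (induction k)
    case (Suc k)
    then have "lc (Suc (i + k)) = lc (Suc i)" by simp
    then show ?case using eq by simp
  qed simp
  from this[of "n - i"] show False using i lc_n lc_not_trivial[OF i] by simp
qed

lemma proj: "projection G (G Mod lc i) (\<lambda>x. lc i #> x) (lc i)"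
  by (rule projection_Mod[OF lower_central_normal])

declare lower_central.simps(2) [simp del]

lemma lc_commutator: "x \<in> lc i \<Longrightarrow> y \<in> carrier G \<Longrightarrow> group_commutator G x y \<in> lc (Suc i)"
  using lower_central_Suc_subset_iff[OF lower_central_normal[of "Suc i"], of i] by blast

lemma not_all_commutators:
  assumes "\<And>x y. x \<in> lc i \<Longrightarrow> y \<in> carrier G \<Longrightarrow> group_commutator G x y \<in> lc (Suc (Suc i))"
    and "Suc i < n"
  shows False
  using lc_strict[OF assms(2)] lower_central_Suc_subset_iff[OF lower_central_normal, of i "Suc (Suc i)"] assms(1)
  by blast

text \<open>The factor \<open>G/G'\<close> of a nilpotent group is not cyclic unless \<open>G'\<close> is trivial.\<close>

lemma not_cyclic_mod:
  assumes b: "b \<in> carrier G"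
    and gen: "\<And>g. g \<in> carrier G \<Longrightarrow> \<exists>k::nat. \<exists>h\<in>lc (Suc 0). g = b [^] k \<otimes> h"
  shows False
proof -
  have "group_commutator G x y \<in> lc (Suc (Suc 0))" if "x \<in> carrier G" "y \<in> carrier G" for x y
    by (rule projection.central_by_cyclic[OF proj b _ lc_commutator gen that]) (blast dest: lc_closed)
  then show False using not_all_commutators[of 0] n2 by simp
qed

lemma card_lc_power: "\<exists>k. card (lc i) = 2 ^ k"
proof -
  have "card (lc i) dvd 2 ^ (n + 1)" using lagrange[OF lc_subgroup[of i]] order_G by (metis dvd_triv_right)
  then show ?thesis using divides_primepow_nat[OF two_is_prime_nat, of "card (lc i)" "n + 1"] by blast
qed

lemma card_lc_Suc: "i < n \<Longrightarrow> 2 * card (lc (Suc i)) \<le> card (lc i)"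
proof -
  assume "i < n"
  then have "lc (Suc i) \<subset> lc i" using lc_strict lower_central_Suc_subset by blast
  then have less: "card (lc (Suc i)) < card (lc i)" by (rule psubset_card_mono[OF lc_fin])
  obtain k l where kl: "card (lc (Suc i)) = 2 ^ k" "card (lc i) = 2 ^ l" using card_lc_power by blast
  then have "k < l" using less by simp
  then have "(2 :: nat) ^ Suc k \<le> 2 ^ l" by (intro power_increasing) simp_all
  then show ?thesis using kl by simp
qed

lemma card_lc_ge: "i \<le> n \<Longrightarrow> 2 ^ (n - i) \<le> card (lc i)"
proof (induction i rule: inc_induct)
  case base
  then show ?case by (simp add: lc_n)
next
  case (step i)
  then have "n - i = Suc (n - Suc i)" by simp
  then show ?case using step card_lc_Suc[of i] by simp
qed

text \<open>Each of the \<open>n\<close> strict inclusions has index at least 2, and the first one has index at least 4 by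
  \<open>not_cyclic_mod\<close>.  As the product of the indices is \<open>2\<^bsup>n+1\<^esup>\<close>, there is no further room.\<close>

lemma card_lc_1: "card (lc (Suc 0)) = 2 ^ (n - 1)"
proof -
  obtain k where k: "card (lc (Suc 0)) = 2 ^ k" using card_lc_power by blast
  have lc0: "lc 0 = carrier G" by simp
  have "k \<le> n" using card_lc_Suc[of 0] k n2 order_G by (simp add: Coset.order_def)
  have "k \<noteq> n"
  proof
    assume "k = n"
    then have le: "card (lc 0) \<le> 2 * card (lc (Suc 0))" using k order_G by (simp add: Coset.order_def)
    obtain b where b: "b \<in> lc 0" "b \<notin> lc (Suc 0)" using lc_strict[of 0] n2 by auto
    have "\<exists>k::nat. \<exists>h\<in>lc (Suc 0). g = b [^] k \<otimes> h" if g: "g \<in> carrier G" for g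
    proof -
      obtain d where d: "d \<in> lc (Suc 0)" "g = d \<or> g = b \<otimes> d"
        using index_two_coset[OF lc_subgroup lc_subgroup lower_central_Suc_subset lc_fin le b] g lc0 by metis
      then have "g = b [^] (0::nat) \<otimes> d \<or> g = b [^] (1::nat) \<otimes> d"
        using b(1) lc_closed by auto
      then show ?thesis using d(1) by blast
    qed
    then show False using not_cyclic_mod[of b] b(1) by simp
  qed
  then have "k \<le> n - 1" using \<open>k \<le> n\<close> by simp
  moreover have "n - 1 \<le> k" using card_lc_ge[of "Suc 0"] n2 k by simp
  ultimately show ?thesis using k by simp
qed

lemma card_lc: "1 \<le> i \<Longrightarrow> i \<le> n \<Longrightarrow> card (lc i) = 2 ^ (n - i)"
proof (induction i rule: dec_induct)
  case base
  then show ?case using card_lc_1 by simp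
next
  case (step i)
  have "2 * card (lc (Suc i)) \<le> 2 ^ (n - i)" using card_lc_Suc[of i] step by simp
  moreover have "n - i = Suc (n - Suc i)" using step by simp
  ultimately have "card (lc (Suc i)) \<le> 2 ^ (n - Suc i)" by simp
  then show ?case using card_lc_ge[of "Suc i"] step by simp
qed

text \<open>An element of order 4 modulo \<open>G'\<close> would generate the factor group, which has order 4.\<close>

lemma square_in_lc1:
  assumes x: "x \<in> carrier G"
  shows "x \<otimes> x \<in> lc (Suc 0)"
proof (rule ccontr)
  let ?N = "lc (Suc 0)"
  let ?p = "\<lambda>x. ?N #> x"
  interpret P: projection G "G Mod ?N" ?p ?N by (rule proj)
  assume n: "x \<otimes> x \<notin> ?N"
  have "card (rcosets ?N) * 2 ^ (n - 1) = 2 ^ (n + 1)"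
    using lagrange[OF lc_subgroup[of "Suc 0"]] order_G card_lc_1 by simp
  also have "\<dots> = 4 * 2 ^ (n - 1)" using n2 by (cases n) simp_all
  finally have "card (rcosets ?N) = 4" by simp
  then have order4: "order (G Mod ?N) = 4" "card (carrier (G Mod ?N)) = 4"
    by (simp_all add: Coset.order_def FactGroup_def)
  then have finQ: "finite (carrier (G Mod ?N))" by (intro card_ge_0_finite) simp
  have px: "?p x \<in> carrier (G Mod ?N)" using x by (rule P.hom_closed)
  let ?o = "group.ord (G Mod ?N) (?p x)"
  have "?o dvd 4" using P.H.ord_dvd_group_order[OF px] order4 by simp
  moreover have "\<not> ?o dvd 2"
  proof
    assume "?o dvd 2"
    then have "?p x [^]\<^bsub>G Mod ?N\<^esub> (2::nat) = \<one>\<^bsub>G Mod ?N\<^esub>" using P.H.pow_eq_id[OF px] by blast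
    then have "?p (x \<otimes> x) = \<one>\<^bsub>G Mod ?N\<^esub>"
      using P.hom_nat_pow[OF x, of 2] x by (simp add: numeral_2_eq_2 del: one_FactGroup mult_FactGroup)
    then show False using n P.kernel_iff[of "x \<otimes> x"] x by blast
  qed
  ultimately have "?o = 4"
  proof -
    assume a: "?o dvd 4" "\<not> ?o dvd 2"
    have "?o \<le> 4" using a(1) by (rule dvd_imp_le) simp
    then have "?o \<in> {0, 1, 2, 3, 4}" by auto
    then show ?thesis using a by auto
  qed
  then have "inj_on (\<lambda>k::nat. ?p x [^]\<^bsub>G Mod ?N\<^esub> k) {0..3}" using P.H.ord_inj[OF px] by simp
  then have "card ((\<lambda>k::nat. ?p x [^]\<^bsub>G Mod ?N\<^esub> k) ` {0..3}) = 4" by (simp add: card_image)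
  moreover have "(\<lambda>k::nat. ?p x [^]\<^bsub>G Mod ?N\<^esub> k) ` {0..3} \<subseteq> carrier (G Mod ?N)"
    using P.H.nat_pow_closed[OF px] by blast
  ultimately have all: "(\<lambda>k::nat. ?p x [^]\<^bsub>G Mod ?N\<^esub> k) ` {0..3} = carrier (G Mod ?N)"
    using order4(2) finQ by (intro card_subset_eq) simp_all
  have "\<exists>k::nat. \<exists>h\<in>?N. g = x [^] k \<otimes> h" if g: "g \<in> carrier G" for g
  proof -
    from P.hom_closed[OF g] obtain k :: nat where "?p g = ?p x [^]\<^bsub>G Mod ?N\<^esub> k"
      unfolding all[symmetric] by blast
    then have "?p g = ?p (x [^] k)" by (simp only: P.hom_nat_pow[OF x])
    then have "inv (x [^] k) \<otimes> g \<in> ?N" using P.same_image[OF g, of "x [^] k"] x by blast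
    moreover have "g = x [^] k \<otimes> (inv (x [^] k) \<otimes> g)" using x g by (simp flip: m_assoc)
    ultimately show ?thesis by blast
  qed
  then show False using not_cyclic_mod[OF x] by blast
qed

lemma lc_index_two: "1 \<le> i \<Longrightarrow> i < n \<Longrightarrow> card (lc i) \<le> 2 * card (lc (Suc i))"
proof -
  assume i: "1 \<le> i" "i < n"
  then have "n - i = Suc (n - Suc i)" by simp
  then show ?thesis using card_lc[of i] card_lc[of "Suc i"] i by simp
qed

lemma square_in_lc: "1 \<le> i \<Longrightarrow> i < n \<Longrightarrow> x \<in> lc i \<Longrightarrow> x \<otimes> x \<in> lc (Suc i)"
  by (rule index_two_square[OF lower_central_normal lc_subgroup lower_central_Suc_subset lc_fin lc_index_two])

lemma lc_coset:
  assumes "1 \<le> i" "i < n" "x \<in> lc i" "x \<notin> lc (Suc i)" "y \<in> lc i"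
  obtains d where "d \<in> lc (Suc i)" "y = d \<or> y = x \<otimes> d"
  by (rule index_two_coset[OF lc_subgroup lc_subgroup lower_central_Suc_subset lc_fin
        lc_index_two[OF assms(1,2)] assms(3-5)])

text \<open>Otherwise the quotient has exponent 2 and is abelian.\<close>

lemma exists_square: "\<exists>a\<in>carrier G. a \<otimes> a \<notin> lc (Suc (Suc 0))"
proof (rule ccontr)
  let ?N = "lc (Suc (Suc 0))"
  interpret P: projection G "G Mod ?N" "\<lambda>x. ?N #> x" ?N by (rule proj)
  assume "\<not> ?thesis"
  then have sq: "a \<otimes> a \<in> ?N" if "a \<in> carrier G" for a using that by blast
  have sq': "(?N #> a) \<otimes>\<^bsub>G Mod ?N\<^esub> (?N #> a) = \<one>\<^bsub>G Mod ?N\<^esub>" if "a \<in> carrier G" for a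
    unfolding P.hom_mult[OF that that, symmetric] using P.kernel_iff[of "a \<otimes> a"] sq[OF that] that by blast
  have "group_commutator G x y \<in> ?N" if xy: "x \<in> carrier G" "y \<in> carrier G" for x y
    unfolding P.commutator_in_iff[OF xy]
    by (rule P.H.involutions_commute[OF P.hom_closed[OF xy(1)] P.hom_closed[OF xy(2)] sq'[OF xy(1)] sq'[OF xy(2)]])
      (simp only: P.hom_mult[OF xy, symmetric] sq' xy m_closed)
  then show False using not_all_commutators[of 0] n2 by simp
qed


lemma two_power_in_lc:
  assumes a: "a \<in> carrier G"
  shows "1 \<le> k \<Longrightarrow> k \<le> n \<Longrightarrow> a [^] ((2::nat) ^ k) \<in> lc k"
proof (induction k rule: dec_induct)
  case base
  then show ?case using square_in_lc1[OF a] a by (simp add: numeral_2_eq_2)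
next
  case (step k)
  have "a [^] ((2::nat) ^ Suc k) = a [^] ((2::nat) ^ k) \<otimes> a [^] ((2::nat) ^ k)"
    using a by (simp add: nat_pow_mult mult_2)
  then show ?case using step square_in_lc[of k] by simp
qed

text \<open>As long as the powers \<open>a\<^bsup>2^j\<^esup>\<close> stay outside the next term, they represent the nontrivial cosets
  of the factors of order 2.\<close>

lemma lc1_expand:
  assumes a: "a \<in> carrier G" and k: "1 \<le> i" "i \<le> n"
    and not_in: "\<And>j. 1 \<le> j \<Longrightarrow> j < i \<Longrightarrow> a [^] ((2::nat) ^ j) \<notin> lc (Suc j)"
    and g: "g \<in> lc (Suc 0)"
  shows "\<exists>j::nat. \<exists>d\<in>lc i. g = a [^] (2 * j) \<otimes> d"
  using k not_in
proof (induction i rule: dec_induct)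
  case base
  show ?case by (rule exI[of _ 0], rule bexI[of _ g]) (use g lc_closed in auto)
next
  case (step i)
  then obtain j d where jd: "d \<in> lc i" "g = a [^] (2 * j :: nat) \<otimes> d" by fastforce
  have i: "1 \<le> i" "i < n" using step by simp_all
  have "a [^] ((2::nat) ^ i) \<in> lc i" using two_power_in_lc[OF a] i by simp
  from lc_coset[OF i this step.prems(2)[OF i(1)] jd(1)] obtain d'
    where d': "d' \<in> lc (Suc i)" "d = d' \<or> d = a [^] ((2::nat) ^ i) \<otimes> d'" by blast
  have d'c: "d' \<in> carrier G" using d'(1) by (rule lc_closed)
  from d'(2) show ?case
  proof
    assume "d = d'"
    then show ?thesis using jd d' by blast
  next
    assume d: "d = a [^] ((2::nat) ^ i) \<otimes> d'"
    obtain i' where "i = Suc i'" using i by (cases i) auto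
    then have e: "2 * j + 2 ^ i = 2 * (j + 2 ^ i')" by simp
    have "g = a [^] (2 * j + 2 ^ i) \<otimes> d'"
      unfolding jd(2) d using a d'c by (simp add: m_assoc[symmetric] nat_pow_mult)
    then show ?thesis unfolding e using d'(1) by blast
  qed
qed

text \<open>The key step of the classification.  Let \<open>x = a\<^bsup>2^l\<^esup>\<close> and \<open>k = l + 1\<close>, and suppose that \<open>x\<^sup>2\<close>
  is trivial modulo \<open>lc (k+1)\<close>.  Any conjugate of \<open>a\<close> is \<open>a\<^bsup>1+2j\<^esup>d\<close> with \<open>d \<in> lc k\<close>, and modulo \<open>lc (k+1)\<close>
  such a \<open>d\<close> is central with \<open>d\<^sup>2 = 1\<close>.  Raising to the power \<open>2^l\<close> shows that \<open>x\<close> is fixed by all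
  conjugations.  But \<open>x\<close> and \<open>lc k\<close> together generate \<open>lc l\<close>, so \<open>lc l\<close> is central modulo
  \<open>lc (k+1)\<close>, contrary to the strictness of the series.\<close>

lemma two_power_not_in_lc:
  assumes a: "a \<in> carrier G" "a \<otimes> a \<notin> lc (Suc (Suc 0))"
  shows "1 \<le> k \<Longrightarrow> k < n \<Longrightarrow> a [^] ((2::nat) ^ k) \<notin> lc (Suc k)"
proof (induction k rule: less_induct)
  case (less k)
  show ?case
  proof (cases "k = 1")
    case True
    then show ?thesis using a by (simp add: numeral_2_eq_2)
  next
    case False
    then obtain l where l: "k = Suc l" "1 \<le> l" using less.prems by (cases k) auto
    define x where "x = a [^] ((2::nat) ^ l)"
    have xc: "x \<in> carrier G" unfolding x_def using a by simp
    have x_in: "x \<in> lc l" unfolding x_def using two_power_in_lc[OF a(1), of l] l less.prems by simp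
    have x_not: "x \<notin> lc k" unfolding x_def using less.IH[of l] l less.prems by simp
    let ?N = "lc (Suc k)"
    let ?Q = "G Mod ?N"
    let ?p = "\<lambda>x. ?N #> x"
    interpret P: projection G ?Q ?p ?N by (rule proj)
    show ?thesis
    proof
      assume sq: "a [^] ((2::nat) ^ k) \<in> ?N"
      have "a [^] ((2::nat) ^ k) = x \<otimes> x"
        unfolding x_def l using a by (simp add: nat_pow_mult mult_2)
      then have pxx: "?p x \<otimes>\<^bsub>?Q\<^esub> ?p x = \<one>\<^bsub>?Q\<^esub>"
        using sq P.kernel_iff[of "x \<otimes> x"] xc by (simp only: P.hom_mult[symmetric] m_closed)
      have x_central: "group_commutator G x b \<in> ?N" if b: "b \<in> carrier G" for b
      proof -
        have "group_commutator G a b \<in> lc (Suc 0)" using lc_commutator[of a 0] a b by simp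
        moreover have "a [^] ((2::nat) ^ i) \<notin> lc (Suc i)" if "1 \<le> i" "i < k" for i
          using less.IH[OF that(2,1)] that less.prems by simp
        ultimately obtain j d where jd: "d \<in> lc k" "group_commutator G a b = a [^] (2 * j :: nat) \<otimes> d"
          using lc1_expand[OF a(1) less.prems(1) less_imp_le[OF less.prems(2)]] by blast
        have dc: "d \<in> carrier G" using jd(1) by (rule lc_closed)
        have "a \<otimes> group_commutator G a b = inv b \<otimes> a \<otimes> b"
          using a b by (simp add: group_commutator_def m_assoc[symmetric])
        then have conj: "inv b \<otimes> a \<otimes> b = a [^] (1 + 2 * j) \<otimes> d"
          unfolding jd(2) using a dc nat_pow_mult[OF a(1), of 1 "2 * j"] by (simp add: m_assoc[symmetric])
        have pa: "?p a \<in> carrier ?Q" and pd: "?p d \<in> carrier ?Q" and px: "?p x \<in> carrier ?Q"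
          and pb: "?p b \<in> carrier ?Q"
          using P.hom_closed a dc xc b by blast+
        have pxa: "?p x = ?p a [^]\<^bsub>?Q\<^esub> ((2::nat) ^ l)"
          unfolding x_def by (rule P.hom_nat_pow[OF a(1)])
        have comm: "?p (a [^] (1 + 2 * j)) \<otimes>\<^bsub>?Q\<^esub> ?p d = ?p d \<otimes>\<^bsub>?Q\<^esub> ?p (a [^] (1 + 2 * j))"
          using P.commutator_in_iff[OF dc, of "a [^] (1 + 2 * j)"] lc_commutator[OF jd(1), of "a [^] (1 + 2 * j)"] a
          by (metis nat_pow_closed)
        have "d \<otimes> d \<in> ?N" using square_in_lc[of k d] jd(1) less.prems by simp
        then have "?p d \<otimes>\<^bsub>?Q\<^esub> ?p d = \<one>\<^bsub>?Q\<^esub>"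
          using P.kernel_iff[of "d \<otimes> d"] dc by (simp only: P.hom_mult[symmetric] m_closed)
        then have d2: "?p d [^]\<^bsub>?Q\<^esub> (2::nat) = \<one>\<^bsub>?Q\<^esub>"
          using pd by (simp add: numeral_2_eq_2 del: one_FactGroup mult_FactGroup)
        have x2: "?p x [^]\<^bsub>?Q\<^esub> (2::nat) = \<one>\<^bsub>?Q\<^esub>"
          using pxx px by (simp add: numeral_2_eq_2 del: one_FactGroup mult_FactGroup)
        obtain l' where l': "l = Suc l'" using l by (cases l) auto
        have "inv b \<otimes> x \<otimes> b = (a [^] (1 + 2 * j) \<otimes> d) [^] ((2::nat) ^ l)"
          unfolding x_def conj[symmetric] by (rule conj_pow[OF a(1) b, symmetric])
        also have "?p \<dots> = (?p (a [^] (1 + 2 * j)) \<otimes>\<^bsub>?Q\<^esub> ?p d) [^]\<^bsub>?Q\<^esub> ((2::nat) ^ l)"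
          using a dc by (simp only: P.hom_nat_pow P.hom_mult m_closed nat_pow_closed)
        also have "\<dots> = ?p (a [^] (1 + 2 * j)) [^]\<^bsub>?Q\<^esub> ((2::nat) ^ l) \<otimes>\<^bsub>?Q\<^esub> ?p d [^]\<^bsub>?Q\<^esub> ((2::nat) ^ l)"
          using a by (intro P.H.pow_mult_distrib comm pd P.hom_closed nat_pow_closed)
        also have "?p d [^]\<^bsub>?Q\<^esub> ((2::nat) ^ l) = \<one>\<^bsub>?Q\<^esub>"
          unfolding l' power_Suc P.H.nat_pow_pow[OF pd, symmetric] d2 by (rule P.H.nat_pow_one)
        also have "?p (a [^] (1 + 2 * j)) [^]\<^bsub>?Q\<^esub> ((2::nat) ^ l) = ?p x [^]\<^bsub>?Q\<^esub> (1 + 2 * j)"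
          unfolding pxa P.hom_nat_pow[OF a(1)] P.H.nat_pow_pow[OF pa] by (simp only: mult.commute)
        also have "?p x [^]\<^bsub>?Q\<^esub> (1 + 2 * j) = ?p x"
          unfolding P.H.nat_pow_mult[OF px, symmetric] P.H.nat_pow_pow[OF px, symmetric] x2
          using px by (simp del: one_FactGroup mult_FactGroup)
        finally have e: "?p (inv b \<otimes> x \<otimes> b) = ?p x"
          using px by (simp del: one_FactGroup mult_FactGroup)
        have "?p b \<otimes>\<^bsub>?Q\<^esub> ?p (inv b \<otimes> x \<otimes> b) = ?p (x \<otimes> b)"
          using xc b by (subst P.hom_mult[symmetric]) (simp_all add: m_assoc[symmetric])
        then have "?p x \<otimes>\<^bsub>?Q\<^esub> ?p b = ?p b \<otimes>\<^bsub>?Q\<^esub> ?p x"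
          unfolding e P.hom_mult[OF xc b] by simp
        then show ?thesis using P.commutator_in_iff[OF xc b] by blast
      qed
      have "group_commutator G y b \<in> ?N" if y: "y \<in> lc l" and b: "b \<in> carrier G" for y b
      proof -
        obtain d where d: "d \<in> lc k" "y = d \<or> y = x \<otimes> d"
          using lc_coset[OF l(2) _ x_in _ y] x_not l less.prems by (metis Suc_lessD)
        have dc: "d \<in> carrier G" using d(1) by (rule lc_closed)
        have pd: "?p d \<otimes>\<^bsub>?Q\<^esub> ?p b = ?p b \<otimes>\<^bsub>?Q\<^esub> ?p d"
          using P.commutator_in_iff[OF dc b] lc_commutator[OF d(1) b] by blast
        have px: "?p x \<otimes>\<^bsub>?Q\<^esub> ?p b = ?p b \<otimes>\<^bsub>?Q\<^esub> ?p x"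
          using P.commutator_in_iff[OF xc b] x_central[OF b] by blast
        have "?p (x \<otimes> d) \<otimes>\<^bsub>?Q\<^esub> ?p b = ?p b \<otimes>\<^bsub>?Q\<^esub> ?p (x \<otimes> d)"
          unfolding P.hom_mult[OF xc dc]
          by (rule P.H.commute_mult[OF P.hom_closed[OF xc] P.hom_closed[OF dc] P.hom_closed[OF b] px pd])
        then have "group_commutator G (x \<otimes> d) b \<in> ?N"
          using P.commutator_in_iff[of "x \<otimes> d" b] xc dc b by blast
        moreover have "group_commutator G d b \<in> ?N" using lc_commutator[OF d(1) b] .
        ultimately show ?thesis using d(2) by blast
      qed
      then show False using not_all_commutators[of l] l less.prems by simp
    qed
  qed
qed

lemma ord_two_power:
  assumes a: "a \<in> carrier G" "a \<otimes> a \<notin> lc (Suc (Suc 0))"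
  shows "ord a = 2 ^ n"
proof -
  have "a [^] ((2::nat) ^ n) = \<one>" using two_power_in_lc[OF a(1), of n] n2 lc_n by simp
  then have "ord a dvd 2 ^ n" using pow_eq_id[OF a(1)] by blast
  then obtain i where i: "i \<le> n" "ord a = 2 ^ i"
    using divides_primepow_nat[OF two_is_prime_nat] by blast
  have "Suc (n - 1) = n" using n2 by simp
  then have "a [^] ((2::nat) ^ (n - 1)) \<notin> lc n" using two_power_not_in_lc[OF a, of "n - 1"] n2 by simp
  then have "\<not> ord a dvd 2 ^ (n - 1)" using pow_eq_id[OF a(1)] lc_n by auto
  then have "\<not> i \<le> n - 1" using i le_imp_power_dvd by metis
  then show ?thesis using i by (cases "i = n") auto
qed

end

text \<open>The normal form \<open>a\<^sup>i b\<^sup>s\<close>, with \<open>s \<in> {0, 1}\<close> encoded as a truth value.\<close>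

definition rot_refl :: "('a, 'm) monoid_scheme \<Rightarrow> 'a \<Rightarrow> 'a \<Rightarrow> nat \<times> bool \<Rightarrow> 'a" where
  "rot_refl G a b = (\<lambda>(i, s). a [^]\<^bsub>G\<^esub> i \<otimes>\<^bsub>G\<^esub> (if s then b else \<one>\<^bsub>G\<^esub>))"

text \<open>The order \<open>2 q\<close> of the group is contained in the last condition.\<close>

definition presented :: "('a, 'm) monoid_scheme \<Rightarrow> nat \<Rightarrow> nat \<Rightarrow> nat \<Rightarrow> 'a \<Rightarrow> 'a \<Rightarrow> bool" where
  "presented G q e m a b \<longleftrightarrow> group G \<and> q > 0 \<and> a \<in> carrier G \<and> b \<in> carrier G \<and>
     a [^]\<^bsub>G\<^esub> q = \<one>\<^bsub>G\<^esub> \<and> b \<otimes>\<^bsub>G\<^esub> a = a [^]\<^bsub>G\<^esub> e \<otimes>\<^bsub>G\<^esub> b \<and> b \<otimes>\<^bsub>G\<^esub> b = a [^]\<^bsub>G\<^esub> m \<and>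
     bij_betw (rot_refl G a b) ({..<q} \<times> UNIV) (carrier G)"

lemma (in group) pow_mod_exponent:
  assumes "a \<in> carrier G" "a [^] q = \<one>"
  shows "a [^] (k mod q :: nat) = a [^] k"
proof -
  have "a [^] k = (a [^] q) [^] (k div q) \<otimes> a [^] (k mod q)"
    using assms(1) by (simp only: nat_pow_pow nat_pow_mult mult_div_mod_eq)
  then show ?thesis using assms by (simp add: nat_pow_one)
qed

lemma (in group) pow_eq_iff_mod:
  assumes "a \<in> carrier G" "ord a = q" "q > 0"
  shows "a [^] (i::nat) = a [^] (j::nat) \<longleftrightarrow> i mod q = j mod q"
proof
  have aq: "a [^] q = \<one>" using pow_ord_eq_1[OF assms(1)] assms(2) by simp
  assume "a [^] i = a [^] j"
  then have eq: "a [^] (i mod q) = a [^] (j mod q)" by (simp only: pow_mod_exponent[OF assms(1) aq])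
  have inj: "inj_on (\<lambda>x. a [^] x) {0..q - 1}" using ord_inj[OF assms(1)] assms(2) by simp
  have mem: "k mod q \<in> {0..q - 1}" for k
    using mod_less_divisor[OF assms(3), of k] by simp
  show "i mod q = j mod q" by (rule inj_onD[OF inj eq mem mem])
next
  have aq: "a [^] q = \<one>" using pow_ord_eq_1[OF assms(1)] assms(2) by simp
  assume "i mod q = j mod q"
  then show "a [^] i = a [^] j" using pow_mod_exponent[OF assms(1) aq] by metis
qed

lemma (in group) conj_pow_exponent:
  assumes "a \<in> carrier G" "b \<in> carrier G" "b \<otimes> a = a [^] (e::nat) \<otimes> b"
  shows "b \<otimes> a [^] (k::nat) = a [^] (e * k) \<otimes> b"
proof (induction k)
  case (Suc k)
  have "b \<otimes> a [^] Suc k = (b \<otimes> a [^] k) \<otimes> a" using assms by (simp add: m_assoc)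
  also have "\<dots> = a [^] (e * k) \<otimes> (b \<otimes> a)" unfolding Suc using assms(1,2) by (simp add: m_assoc)
  also have "\<dots> = (a [^] (e * k) \<otimes> a [^] e) \<otimes> b" unfolding assms(3) using assms(1,2) by (simp add: m_assoc)
  also have "a [^] (e * k) \<otimes> a [^] e = a [^] (e * Suc k)" using assms(1) by (simp add: nat_pow_mult add.commute)
  finally show ?case .
qed (use assms in simp)

lemma (in group) rot_refl_bij:
  assumes a: "a \<in> carrier G" "ord a = q" and b: "b \<in> carrier G" "\<And>i::nat. b \<noteq> a [^] i"
    and order: "order G = 2 * q" and q: "q > 0"
  shows "bij_betw (rot_refl G a b) ({..<q} \<times> UNIV) (carrier G)"
proof -
  let ?I = "{..<q} \<times> (UNIV :: bool set)"
  have aq: "a [^] q = \<one>" using pow_ord_eq_1[OF a(1)] a(2) by simp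
  have fin: "finite (carrier G)" using order q order_gt_0_iff_finite by simp
  have no: "a [^] i \<otimes> b \<noteq> a [^] j" if "i < q" for i j :: nat
  proof
    assume e: "a [^] i \<otimes> b = a [^] j"
    have "a [^] (q - i) \<otimes> (a [^] i \<otimes> b) = a [^] (q - i + i) \<otimes> b"
      using a b(1) by (simp only: m_assoc[symmetric] nat_pow_closed nat_pow_mult)
    then have "a [^] (q - i) \<otimes> (a [^] i \<otimes> b) = b" using that aq b(1) by simp
    then have "b = a [^] (q - i + j)" unfolding e using a by (simp add: nat_pow_mult)
    then show False using b(2) by blast
  qed
  have inj: "inj_on (rot_refl G a b) ?I"
  proof (rule inj_onI)
    fix x y assume xy: "x \<in> ?I" "y \<in> ?I" "rot_refl G a b x = rot_refl G a b y"
    obtain i s where x: "x = (i, s)" by (cases x)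
    obtain j t where y: "y = (j, t)" by (cases y)
    from xy have ij: "i < q" "j < q" and e: "rot_refl G a b (i, s) = rot_refl G a b (j, t)"
      by (simp_all add: x y)
    have st: "s = t"
      using e no[of i j] no[of j i] ij a b(1) by (cases s; cases t) (auto simp: rot_refl_def)
    then have "a [^] i = a [^] j" using e a b(1) by (auto simp: rot_refl_def split: if_splits)
    then have "i = j" using pow_eq_iff_mod[OF a q, of i j] ij by simp
    then show "x = y" using st x y by simp
  qed
  have "rot_refl G a b ` ?I \<subseteq> carrier G" using a b(1) by (auto simp: rot_refl_def)
  moreover have "card (rot_refl G a b ` ?I) = card (carrier G)"
    unfolding card_image[OF inj] using order by (simp add: card_cartesian_product Coset.order_def)
  ultimately have "rot_refl G a b ` ?I = carrier G" using fin by (intro card_subset_eq)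
  then show ?thesis using inj by (simp add: bij_betw_def)
qed

text \<open>Used with \<open>2 u = e - 1\<close> both for \<open>k = e + 1\<close> and for the exponent \<open>k\<close> of \<open>b\<^sup>2\<close>.\<close>

lemma two_power_dvd_cases:
  fixes k :: nat
  assumes "2 ^ n dvd 2 * u * k" "odd u" "k \<le> 2 ^ n" "n > 0"
  shows "k = 0 \<or> k = 2 ^ n div 2 \<or> k = 2 ^ n"
proof -
  obtain l where l: "n = Suc l" using assms(4) by (cases n) auto
  have "2 * 2 ^ l dvd 2 * (u * k)" using assms(1) by (simp add: l mult.assoc)
  then have "2 ^ l dvd u * k" by simp
  moreover have "coprime (2 ^ l) u" using assms(2) by (simp add: coprime_power_left_iff)
  ultimately have "2 ^ l dvd k" by (simp add: coprime_dvd_mult_right_iff)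
  then obtain c where c: "k = 2 ^ l * c" ..
  then have "2 ^ l * c \<le> 2 ^ l * 2" using assms(3) l by simp
  then have "c \<le> 2" by simp
  then have "c = 0 \<or> c = 1 \<or> c = 2" by auto
  then show ?thesis using c l by auto
qed

context maximal_class
begin

text \<open>Take \<open>a\<close> from \<open>exists_square\<close> and any \<open>b\<close> outside \<open>\<langle>a\<rangle>\<close>.  If \<open>e \<equiv> 1\<close> modulo 4, then \<open>a\<close>
  and \<open>b\<close> commute modulo the third term of the lower central series, which is impossible; so
  \<open>(e - 1)/2\<close> is odd.  As \<open>b\<^sup>2\<close> is a power of \<open>a\<close>, it commutes with both \<open>a\<close> and \<open>b\<close>, so
  \<open>(e - 1)(e + 1)\<close> and \<open>(e - 1) m\<close> vanish modulo \<open>q\<close>, and this leaves few values of \<open>e\<close> and \<open>m\<close>.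
  If \<open>e = q/2 - 1\<close> and \<open>m = q/2\<close>, replacing \<open>b\<close> by \<open>ab\<close> gives \<open>m = 0\<close>.\<close>

lemma classification:
  "\<exists>a b e m. presented G (2 ^ n) e m a b \<and>
     (e = 2 ^ n - 1 \<and> (m = 0 \<or> m = 2 ^ n div 2) \<or> n \<ge> 3 \<and> e = 2 ^ n div 2 - 1 \<and> m = 0)"
proof -
  define q :: nat where "q = 2 ^ n"
  have q: "q > 0" "4 dvd q" using le_imp_power_dvd[OF n2, of "2::nat"] by (simp_all add: q_def)
  obtain a where a: "a \<in> carrier G" and aa: "a \<otimes> a \<notin> lc (Suc (Suc 0))" using exists_square by blast
  have oa: "ord a = q" unfolding q_def using a aa by (rule ord_two_power)
  have aq: "a [^] q = \<one>" using pow_ord_eq_1[OF a] oa by simp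
  have order: "order G = 2 * q" using order_G by (simp add: q_def)
  note pow_eq = pow_eq_iff_mod[OF a oa q(1)]
  have "\<exists>b\<in>carrier G. \<forall>i::nat. b \<noteq> a [^] i"
  proof (rule ccontr)
    assume "\<not> ?thesis"
    then have "carrier G \<subseteq> (\<lambda>i. a [^] i) ` {..<q}"
      using pow_mod_exponent[OF a aq] mod_less_divisor[OF q(1)] by (metis image_eqI lessThan_iff subsetI)
    then have "card (carrier G) \<le> card ((\<lambda>i. a [^] i) ` {..<q})" by (intro card_mono) simp_all
    also have "\<dots> \<le> q" using card_image_le[of "{..<q}"] by simp
    finally show False using order q(1) by (simp add: Coset.order_def)
  qed
  then obtain b where b: "b \<in> carrier G" and nb: "\<And>i::nat. b \<noteq> a [^] i" by blast
  have bij: "bij_betw (rot_refl G a b) ({..<q} \<times> UNIV) (carrier G)"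
    by (rule rot_refl_bij[OF a oa b nb order q(1)])
  have el: "(\<exists>i<q. g = a [^] i) \<or> (\<exists>i<q. g = a [^] i \<otimes> b)" if "g \<in> carrier G" for g
  proof -
    have "g \<in> rot_refl G a b ` ({..<q} \<times> UNIV)" using that bij by (simp only: bij_betw_def)
    then obtain i s where "i < q" "g = rot_refl G a b (i, s)" by auto
    then show ?thesis using a b by (cases s) (auto simp: rot_refl_def)
  qed
  have cancel: "g \<otimes> b = h \<otimes> b \<longleftrightarrow> g = h" if "g \<in> carrier G" "h \<in> carrier G" for g h
    using that b by simp
  obtain m where m: "m < q" "b \<otimes> b = a [^] m"
  proof -
    have "\<not> (\<exists>i<q. b \<otimes> b = a [^] i \<otimes> b)" using cancel[OF b] a nb by auto
    then show thesis using el[of "b \<otimes> b"] b that by blast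
  qed
  obtain e where e: "e < q" "b \<otimes> a = a [^] e \<otimes> b"
  proof -
    have "b \<otimes> a \<noteq> a [^] i" if i: "i < q" for i
    proof
      assume "b \<otimes> a = a [^] i"
      then have "b \<otimes> a \<otimes> a [^] (q - 1) = a [^] (i + (q - 1))" using a by (simp add: nat_pow_mult)
      moreover have "a \<otimes> a [^] (q - 1) = \<one>"
        using nat_pow_mult[OF a, of 1 "q - 1"] a aq q(1) by simp
      ultimately have "b = a [^] (i + (q - 1))" using a b by (simp add: m_assoc)
      then show False using nb by blast
    qed
    then show thesis using el[of "b \<otimes> a"] a b that by blast
  qed
  note conj = conj_pow_exponent[OF a b e(2)]
  have "e mod 4 \<noteq> 1"
  proof
    let ?N = "lc (Suc (Suc 0))"
    let ?p = "\<lambda>x. ?N #> x"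
    interpret P: projection G "G Mod ?N" ?p ?N by (rule proj)
    assume e1: "e mod 4 = 1"
    have "a [^] (4::nat) \<in> ?N" using two_power_in_lc[OF a, of "Suc (Suc 0)"] n2 by simp
    then have "?p a [^]\<^bsub>G Mod ?N\<^esub> (4::nat) = \<one>\<^bsub>G Mod ?N\<^esub>"
      using P.kernel_iff[of "a [^] (4::nat)"] a P.hom_nat_pow[OF a, of 4] nat_pow_closed by metis
    then have "?p a [^]\<^bsub>G Mod ?N\<^esub> e = ?p a [^]\<^bsub>G Mod ?N\<^esub> (1::nat)"
      using P.H.pow_mod_exponent[OF P.hom_closed[OF a], of 4 e] e1 by metis
    then have "?p (a [^] e) = ?p a"
      using P.hom_nat_pow[OF a, of e] P.H.nat_pow_eone[OF P.hom_closed[OF a]] by metis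
    then have ba: "?p b \<otimes>\<^bsub>G Mod ?N\<^esub> ?p a = ?p a \<otimes>\<^bsub>G Mod ?N\<^esub> ?p b"
      using e(2) P.hom_mult[OF b a] P.hom_mult[of "a [^] e" b] a b nat_pow_closed by metis
    have bpow: "group_commutator G (a [^] k) b \<in> ?N" for k :: nat
    proof (induction k)
      case (Suc k)
      then have "?p (a [^] k) \<otimes>\<^bsub>G Mod ?N\<^esub> ?p b = ?p b \<otimes>\<^bsub>G Mod ?N\<^esub> ?p (a [^] k)"
        using P.commutator_in_iff[of "a [^] k" b] a b by blast
      then have "?p (a [^] k \<otimes> a) \<otimes>\<^bsub>G Mod ?N\<^esub> ?p b = ?p b \<otimes>\<^bsub>G Mod ?N\<^esub> ?p (a [^] k \<otimes> a)"
        unfolding P.hom_mult[OF nat_pow_closed[OF a] a]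
        by (rule P.H.commute_mult[OF P.hom_closed[OF nat_pow_closed[OF a]] P.hom_closed[OF a] P.hom_closed[OF b] _ ba[symmetric]])
      then show ?case using P.commutator_in_iff[of "a [^] k \<otimes> a" b] a b by simp
    next
      case 0
      have "group_commutator G \<one> b = \<one>" using commutator_eq_one_iff[of \<one> b] b by simp
      then show ?case using subgroup.one_closed[OF lc_subgroup] by simp
    qed
    have comm: "?p g \<otimes>\<^bsub>G Mod ?N\<^esub> ?p (a [^] k) = ?p (a [^] k) \<otimes>\<^bsub>G Mod ?N\<^esub> ?p g"
      "?p g \<otimes>\<^bsub>G Mod ?N\<^esub> ?p b = ?p b \<otimes>\<^bsub>G Mod ?N\<^esub> ?p g" if g: "g \<in> carrier G" for g and k :: nat
    proof -
      have 1: "?p (a [^] i) \<otimes>\<^bsub>G Mod ?N\<^esub> ?p b = ?p b \<otimes>\<^bsub>G Mod ?N\<^esub> ?p (a [^] i)" for i :: nat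
        using P.commutator_in_iff[OF nat_pow_closed[OF a] b] bpow by blast
      have 2: "?p (a [^] i) \<otimes>\<^bsub>G Mod ?N\<^esub> ?p (a [^] k) = ?p (a [^] k) \<otimes>\<^bsub>G Mod ?N\<^esub> ?p (a [^] i)" for i :: nat
        using a by (simp only: P.hom_mult[symmetric] nat_pow_closed nat_pow_mult add.commute)
      note cl = P.hom_closed[OF nat_pow_closed[OF a]] P.hom_closed[OF b]
      have 3: "?p (a [^] i \<otimes> b) \<otimes>\<^bsub>G Mod ?N\<^esub> ?p (a [^] k) = ?p (a [^] k) \<otimes>\<^bsub>G Mod ?N\<^esub> ?p (a [^] i \<otimes> b)" for i :: nat
        unfolding P.hom_mult[OF nat_pow_closed[OF a] b]
        by (rule P.H.commute_mult[OF cl(1) cl(2) cl(1) 2 1[symmetric]])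
      have 4: "?p (a [^] i \<otimes> b) \<otimes>\<^bsub>G Mod ?N\<^esub> ?p b = ?p b \<otimes>\<^bsub>G Mod ?N\<^esub> ?p (a [^] i \<otimes> b)" for i :: nat
        unfolding P.hom_mult[OF nat_pow_closed[OF a] b]
        by (rule P.H.commute_mult[OF cl(1) cl(2) cl(2) 1 refl])
      show "?p g \<otimes>\<^bsub>G Mod ?N\<^esub> ?p (a [^] k) = ?p (a [^] k) \<otimes>\<^bsub>G Mod ?N\<^esub> ?p g"
        using el[OF g] 2 3 by blast
      show "?p g \<otimes>\<^bsub>G Mod ?N\<^esub> ?p b = ?p b \<otimes>\<^bsub>G Mod ?N\<^esub> ?p g"
        using el[OF g] 1 4 by blast
    qed
    have "group_commutator G x y \<in> ?N" if x: "x \<in> carrier G" and y: "y \<in> carrier G" for x y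
    proof -
      have "?p (a [^] i \<otimes> b) \<otimes>\<^bsub>G Mod ?N\<^esub> ?p x = ?p x \<otimes>\<^bsub>G Mod ?N\<^esub> ?p (a [^] i \<otimes> b)" for i :: nat
        unfolding P.hom_mult[OF nat_pow_closed[OF a] b]
        by (rule P.H.commute_mult[OF P.hom_closed[OF nat_pow_closed[OF a]] P.hom_closed[OF b] P.hom_closed[OF x]
              comm(1)[OF x, symmetric] comm(2)[OF x, symmetric]])
      then have "?p y \<otimes>\<^bsub>G Mod ?N\<^esub> ?p x = ?p x \<otimes>\<^bsub>G Mod ?N\<^esub> ?p y"
        using el[OF y] comm(1)[OF x] by metis
      then show ?thesis using P.commutator_in_iff[OF x y] by simp
    qed
    then show False using not_all_commutators[of 0] n2 by simp
  qed
  \<comment> \<open>\<open>b\<^sup>2\<close> commutes with \<open>a\<close>\<close>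
  have bba: "b \<otimes> b \<otimes> a = a [^] (e * e) \<otimes> (b \<otimes> b)"
    using a b conj[of e] by (simp add: m_assoc e(2)) (simp add: m_assoc[symmetric])
  have "a [^] (m + 1) = a [^] (e * e + m)"
    using bba a unfolding m(2) by (simp add: nat_pow_mult)
  then have "a [^] m \<otimes> a [^] (1::nat) = a [^] m \<otimes> a [^] (e * e)"
    using a by (simp only: nat_pow_mult add.commute)
  then have "a [^] (1::nat) = a [^] (e * e)" using a by (simp only: l_cancel nat_pow_closed)
  then have ee: "1 mod q = (e * e) mod q" using pow_eq by blast
  have q1: "1 mod q = 1" using q by (cases "q = 1") auto
  have "e \<noteq> 0" using ee unfolding q1 by (intro notI) simp
  then have "q dvd (e - 1) * (e + 1)"
  proof -
    obtain f where f: "e = Suc f" using \<open>e \<noteq> 0\<close> by (cases e) auto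
    then have "(e - 1) * (e + 1) = e * e - 1" by simp
    moreover have "1 \<le> e * e" using \<open>e \<noteq> 0\<close> by simp
    then have "q dvd e * e - 1" using mod_eq_dvd_iff_nat[of 1 "e * e" q] ee by metis
    ultimately show ?thesis by simp
  qed
  moreover have "odd e"
  proof
    assume "even e"
    moreover have "even q" using q(2) by presburger
    ultimately have "even (e * e mod q)" by (simp add: dvd_mod_iff)
    then show False unfolding ee[symmetric] q1 by simp
  qed
  ultimately obtain u where u: "odd u" "e - 1 = 2 * u" "q dvd 2 * u * (e + 1)"
  proof -
    assume d: "q dvd (e - 1) * (e + 1)"
    have "e mod 4 = 3" using \<open>odd e\<close> \<open>e mod 4 \<noteq> 1\<close> by presburger
    then have "odd ((e - 1) div 2)" "e - 1 = 2 * ((e - 1) div 2)" by presburger+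
    then show thesis using that d by metis
  qed
  have "e + 1 = 0 \<or> e + 1 = q div 2 \<or> e + 1 = q"
    unfolding q_def by (rule two_power_dvd_cases[of n u]) (use u e n2 in \<open>simp_all add: q_def\<close>)
  then have e': "e = q div 2 - 1 \<or> e = q - 1" by auto
  \<comment> \<open>\<open>b\<^sup>2\<close> commutes with \<open>b\<close>\<close>
  have "a [^] m \<otimes> b = a [^] (e * m) \<otimes> b"
    using conj[of m] b by (simp add: m(2)[symmetric] m_assoc)
  then have "a [^] m = a [^] (e * m)" using a b by simp
  then have "m mod q = (e * m) mod q" using pow_eq by blast
  moreover have "m \<le> e * m" using \<open>e \<noteq> 0\<close> by simp
  ultimately have "q dvd e * m - m" using mod_eq_dvd_iff_nat[of m "e * m" q] by metis
  then have "q dvd 2 * u * m" unfolding u(2)[symmetric] by (simp add: diff_mult_distrib)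
  then have "m = 0 \<or> m = q div 2 \<or> m = q"
    unfolding q_def by (intro two_power_dvd_cases[of n u]) (use u m n2 in \<open>simp_all add: q_def\<close>)
  then have m': "m = 0 \<or> m = q div 2" using m by auto
  have gp: "group G" by (rule group_axioms)
  have pres: "presented G q e m a b"
    unfolding presented_def using gp q a b aq e m bij by blast
  show ?thesis
  proof (cases "e = q - 1")
    case True
    then show ?thesis using pres m' unfolding q_def by blast
  next
    case False
    then have eh: "e = q div 2 - 1" using e' by blast
    have n3: "n \<ge> 3"
    proof (rule ccontr)
      assume "\<not> n \<ge> 3"
      then have "n = 2" using n2 by simp
      then show False using eh \<open>e mod 4 \<noteq> 1\<close> by (simp add: q_def)
    qed
    show ?thesis
    proof (cases "m = 0")
      case True
      then show ?thesis using pres n3 eh unfolding q_def by blast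
    next
      case False
      then have mh: "m = q div 2" using m' by blast
      \<comment> \<open>the semidihedral group has elements of order 4 outside \<open>\<langle>a\<rangle>\<close>; their products with \<open>a\<close> have order 2\<close>
      let ?b = "a \<otimes> b"
      have bc: "?b \<in> carrier G" using a b by simp
      have nb': "?b \<noteq> a [^] i" for i :: nat
      proof
        assume "?b = a [^] i"
        then have "a [^] (q - 1) \<otimes> (a \<otimes> b) = a [^] (q - 1 + i)" using a by (simp add: nat_pow_mult)
        moreover have "a [^] (q - 1) \<otimes> a = \<one>"
          using nat_pow_mult[OF a, of "q - 1" 1] a aq q(1) by simp
        ultimately have "b = a [^] (q - 1 + i)" using a b by (simp add: m_assoc[symmetric])
        then show False using nb by blast
      qed
      have "?b \<otimes> a = a [^] e \<otimes> ?b"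
      proof -
        have "?b \<otimes> a = (a [^] (1::nat) \<otimes> a [^] e) \<otimes> b" using a b e(2) by (simp add: m_assoc)
        also have "\<dots> = (a [^] e \<otimes> a [^] (1::nat)) \<otimes> b" using a by (simp only: nat_pow_mult add.commute)
        finally show ?thesis using a b by (simp add: m_assoc)
      qed
      moreover have "?b \<otimes> ?b = a [^] (0::nat)"
      proof -
        have "?b \<otimes> ?b = a [^] (1::nat) \<otimes> (b \<otimes> a) \<otimes> b" using a b by (simp add: m_assoc)
        also have "\<dots> = a [^] (1::nat) \<otimes> a [^] e \<otimes> (b \<otimes> b)" unfolding e(2) using a b by (simp add: m_assoc)
        also have "\<dots> = a [^] (1 + e + m)" unfolding m(2) using a by (simp only: nat_pow_mult)
        also have "1 + e + m = q"
          using eh mh q by (auto elim!: dvdE)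
        finally show ?thesis using aq by simp
      qed
      ultimately have "presented G q e 0 a ?b"
        unfolding presented_def using gp q a bc aq rot_refl_bij[OF a oa bc nb' order q(1)] by blast
      then show ?thesis using n3 eh unfolding q_def by blast
    qed
  qed
qed

end

lemma maximal_class_presented:
  assumes "maximal_class_2_group G"
  obtains n a b e m where "n \<ge> 2" "presented G (2 ^ n) e m a b"
    "e = 2 ^ n - 1 \<and> (m = 0 \<or> m = 2 ^ n div 2) \<or> n \<ge> 3 \<and> e = 2 ^ n div 2 - 1 \<and> m = 0"
proof -
  from assms obtain n where n: "n \<ge> 2" "group G" "order G = 2 ^ (n + 1)" "has_nilpotency_class G n"
    by (auto simp: maximal_class_2_group_def)
  then interpret maximal_class G n by (simp add: maximal_class_def maximal_class_axioms_def)
  show thesis using classification that n(1) by blast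
qed

section \<open>Elements of order two in the group algebra\<close>


lemma rot_refl_mult:
  assumes "presented G q e m a b"
  shows "rot_refl G a b (i, s) \<otimes>\<^bsub>G\<^esub> rot_refl G a b (j, t)
    = rot_refl G a b ((i + (if s then e * j else j) + (if s \<and> t then m else 0)) mod q, s \<noteq> t)"
proof -
  from assms interpret group G by (simp add: presented_def)
  from assms have a: "a \<in> carrier G" "a [^]\<^bsub>G\<^esub> q = \<one>\<^bsub>G\<^esub>" and b: "b \<in> carrier G"
    and ba: "b \<otimes>\<^bsub>G\<^esub> a = a [^]\<^bsub>G\<^esub> e \<otimes>\<^bsub>G\<^esub> b" and bb: "b \<otimes>\<^bsub>G\<^esub> b = a [^]\<^bsub>G\<^esub> m"
    by (auto simp: presented_def)
  note red = pow_mod_exponent[OF a]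
  note conj = conj_pow_exponent[OF a(1) b ba]
  show ?thesis
  proof (cases s)
    case False
    then show ?thesis using a(1) b
      by (simp add: rot_refl_def red m_assoc[symmetric] nat_pow_mult)
  next
    case True
    have "a [^]\<^bsub>G\<^esub> i \<otimes>\<^bsub>G\<^esub> b \<otimes>\<^bsub>G\<^esub> (a [^]\<^bsub>G\<^esub> j \<otimes>\<^bsub>G\<^esub> c)
        = a [^]\<^bsub>G\<^esub> (i + e * j) \<otimes>\<^bsub>G\<^esub> (b \<otimes>\<^bsub>G\<^esub> c)" if c: "c \<in> carrier G" for c
    proof -
      have "a [^]\<^bsub>G\<^esub> i \<otimes>\<^bsub>G\<^esub> b \<otimes>\<^bsub>G\<^esub> (a [^]\<^bsub>G\<^esub> j \<otimes>\<^bsub>G\<^esub> c)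
          = a [^]\<^bsub>G\<^esub> i \<otimes>\<^bsub>G\<^esub> (b \<otimes>\<^bsub>G\<^esub> a [^]\<^bsub>G\<^esub> j) \<otimes>\<^bsub>G\<^esub> c"
        using a(1) b c by (simp add: m_assoc)
      also have "\<dots> = a [^]\<^bsub>G\<^esub> i \<otimes>\<^bsub>G\<^esub> a [^]\<^bsub>G\<^esub> (e * j) \<otimes>\<^bsub>G\<^esub> (b \<otimes>\<^bsub>G\<^esub> c)"
        unfolding conj using a(1) b c by (simp add: m_assoc)
      finally show ?thesis using a(1) by (simp only: nat_pow_mult)
    qed
    from this[of "if t then b else \<one>\<^bsub>G\<^esub>"] True show ?thesis
      using a(1) b by (cases t) (simp_all add: rot_refl_def red bb nat_pow_mult)
  qed
qed

lemma presented_cases: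
  assumes "presented G q e m a b" "x \<in> carrier G"
  obtains i s where "i < q" "x = rot_refl G a b (i, s)"
proof -
  have "x \<in> rot_refl G a b ` ({..<q} \<times> UNIV)"
    using assms by (simp add: presented_def bij_betw_def)
  then show thesis using that by auto
qed

lemma presented_finite: "presented G q e m a b \<Longrightarrow> finite (carrier G)"
  unfolding presented_def by (auto dest!: bij_betw_finite)

text \<open>Both groups have the multiplication table of \<open>rot_refl_mult\<close>.\<close>

lemma presented_iso:
  assumes G: "presented G q e m a b" and H: "presented H q e m c d"
  shows "G \<cong> H"
proof -
  let ?I = "{..<q} \<times> (UNIV :: bool set)"
  let ?g = "rot_refl G a b" and ?h = "rot_refl H c d"
  let ?f = "\<lambda>x. ?h (inv_into ?I ?g x)"
  have bg: "bij_betw ?g ?I (carrier G)" and bh: "bij_betw ?h ?I (carrier H)" and q: "q > 0"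
    using G H by (simp_all add: presented_def)
  have inv: "inv_into ?I ?g (?g p) = p" if "p \<in> ?I" for p
    using bg that by (simp add: bij_betw_def)
  have "bij_betw ?f (carrier G) (carrier H)"
    using bij_betw_trans[OF bij_betw_inv_into[OF bg] bh] by (simp add: o_def)
  moreover have "?f (x \<otimes>\<^bsub>G\<^esub> y) = ?f x \<otimes>\<^bsub>H\<^esub> ?f y" if "x \<in> carrier G" "y \<in> carrier G" for x y
  proof -
    obtain i s where i: "i < q" and x: "x = ?g (i, s)"
      by (rule presented_cases[OF G \<open>x \<in> carrier G\<close>])
    obtain j t where j: "j < q" and y: "y = ?g (j, t)"
      by (rule presented_cases[OF G \<open>y \<in> carrier G\<close>])
    have ij: "(i, s) \<in> ?I" "(j, t) \<in> ?I" using i j by simp_all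
    have "((i + (if s then e * j else j) + (if s \<and> t then m else 0)) mod q, s \<noteq> t) \<in> ?I" using q by simp
    then show ?thesis
      unfolding x y rot_refl_mult[OF G] inv[OF ij(1)] inv[OF ij(2)] rot_refl_mult[OF H] by (rule arg_cong[OF inv])
  qed
  ultimately have "?f \<in> iso G H" by (auto simp: iso_def hom_def bij_betw_def)
  then show ?thesis by (auto simp: is_iso_def)
qed

text \<open>The identity is included.\<close>

definition involutions :: "('a, 'm) monoid_scheme \<Rightarrow> ('a \<Rightarrow> bit) set" where
  "involutions G = {f \<in> carrier (group_algebra G). f \<otimes>\<^bsub>group_algebra G\<^esub> f = \<one>\<^bsub>group_algebra G\<^esub>}"

lemma group_algebra_simps:
  "f \<in> carrier (group_algebra G) \<longleftrightarrow> (\<forall>x. x \<notin> carrier G \<longrightarrow> f x = 0)"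
  "\<one>\<^bsub>group_algebra G\<^esub> = (\<lambda>x. if x = \<one>\<^bsub>G\<^esub> then 1 else 0)"
  "(f \<otimes>\<^bsub>group_algebra G\<^esub> g) = (\<lambda>x. if x \<in> carrier G
        then \<Sum>y\<in>carrier G. f y * g (inv\<^bsub>G\<^esub> y \<otimes>\<^bsub>G\<^esub> x) else 0)"
  by (simp_all add: group_algebra_def)

context cyclic_algebra
begin

lemma fold_coeff_expand:
  assumes x: "degree x < q" and y: "degree y < q"
  shows "fold_coeff k (x * (y \<circ>\<^sub>p \<xi> ^ e) * \<xi> ^ m) =
    (\<Sum>i<q. \<Sum>j<q. coeff x i * coeff y j * of_bool ((i + e * j + m) mod q = k))"
proof -
  have y': "y \<circ>\<^sub>p \<xi> ^ e = (\<Sum>j<q. smult (coeff y j) (\<xi> ^ (e * j)))"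
    by (subst poly_as_sum[OF y])
      (simp only: pcompose_sum pcompose_smult pcompose_power pcompose_xi power_mult)
  have "x * (y \<circ>\<^sub>p \<xi> ^ e) * \<xi> ^ m = (\<Sum>i<q. \<Sum>j<q. smult (coeff x i * coeff y j) (\<xi> ^ (i + e * j + m)))"
    unfolding y'
    by (subst (1) poly_as_sum[OF x], unfold sum_distrib_right sum_distrib_left, subst sum.swap, intro sum.cong refl)
      (simp only: power_add mult_smult_left mult_smult_right smult_smult mult_ac)
  then show ?thesis by (simp only: fold_coeff_sum fold_coeff_smult fold_coeff_xi_power)
qed

text \<open>An element \<open>f\<close> of the group algebra is \<open>p + r b\<close> with polynomials \<open>p\<close> and \<open>r\<close> in \<open>a\<close>.  The
  coefficients of its square on \<open>\<langle>a\<rangle>\<close> and on \<open>\<langle>a\<rangle>b\<close> give the two equations of \<open>sols\<close> for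
  \<open>x = p + 1\<close> and \<open>y = r\<close>.\<close>

lemma card_involutions:
  fixes G :: "('a, 'm) monoid_scheme" (structure)
  assumes G: "presented G q e m a b"
  shows "card (involutions G) = card (sols e m)"
proof -
  from assms interpret group G by (simp add: presented_def)
  let ?I = "{..<q} \<times> (UNIV :: bool set)"
  let ?\<phi> = "rot_refl G a b"
  let ?A = "group_algebra G :: ('a \<Rightarrow> bit) ring"
  have bij: "bij_betw ?\<phi> ?I (carrier G)" using G by (simp add: presented_def)
  have inj: "?\<phi> (i, s) = ?\<phi> (j, t) \<longleftrightarrow> i = j \<and> s = t" if "i < q" "j < q" for i j s t
  proof -
    have "(i, s) \<in> ?I" "(j, t) \<in> ?I" using that by simp_all
    then show ?thesis using inj_on_eq_iff[OF bij_betw_imp_inj_on[OF bij]] by simp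
  qed
  have \<phi>: "?\<phi> (i, s) \<in> carrier G" if "i < q" for i s
    using bij_betw_apply[OF bij, of "(i, s)"] that by simp
  have fin: "finite (carrier G)" using G by (rule presented_finite)
  have q0: "q > 0" using q_ge by simp
  have sum_G: "(\<Sum>y\<in>carrier G. F y) = (\<Sum>i<q. F (?\<phi> (i, False))) + (\<Sum>i<q. F (?\<phi> (i, True)))"
    for F :: "'a \<Rightarrow> bit"
  proof -
    have "(\<Sum>p\<in>?I. F (?\<phi> p)) = (\<Sum>i<q. \<Sum>s\<in>UNIV. F (?\<phi> (i, s)))"
      by (simp only: sum.cartesian_product) simp
    then have "(\<Sum>y\<in>carrier G. F y) = (\<Sum>i<q. \<Sum>s\<in>UNIV. F (?\<phi> (i, s)))"
      by (simp only: sum.reindex_bij_betw[OF bij])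
    moreover have "(\<Sum>s\<in>UNIV. F (?\<phi> (i, s))) = F (?\<phi> (i, False)) + F (?\<phi> (i, True))" for i
      by (simp add: UNIV_bool)
    ultimately show ?thesis by (simp only: sum.distrib)
  qed
  define P where "P f s = (\<Sum>i<q. monom (f (?\<phi> (i, s))) i)" for f :: "'a \<Rightarrow> bit" and s
  have coeff_P: "coeff (P f s) i = (if i < q then f (?\<phi> (i, s)) else 0)" for f s i
    by (simp add: P_def coeff_sum)
  have deg_P: "degree (P f s) < q" for f s
  proof -
    have "degree (P f s) \<le> q - 1" by (intro degree_le allI impI) (use q0 in \<open>simp add: coeff_P\<close>)
    then show ?thesis using q0 by linarith
  qed
  have conv: "(f \<otimes>\<^bsub>?A\<^esub> f) g = (\<Sum>y\<in>carrier G. \<Sum>z\<in>carrier G. f y * f z * of_bool (y \<otimes> z = g))"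
    if g: "g \<in> carrier G" for f g
  proof -
    have "(f \<otimes>\<^bsub>?A\<^esub> f) g = (\<Sum>y\<in>carrier G. f y * f (inv y \<otimes> g))" using g by (simp only: group_algebra_simps if_True)
    also have "\<dots> = (\<Sum>y\<in>carrier G. \<Sum>z\<in>carrier G. f y * f z * of_bool (y \<otimes> z = g))"
    proof (rule sum.cong[OF refl])
      fix y assume y: "y \<in> carrier G"
      have "(\<Sum>z\<in>carrier G. f y * f z * of_bool (y \<otimes> z = g)) = (\<Sum>z\<in>carrier G. if z = inv y \<otimes> g then f y * f z else 0)"
      proof (rule sum.cong[OF refl])
        fix z assume "z \<in> carrier G"
        then have "y \<otimes> z = g \<longleftrightarrow> z = inv y \<otimes> g" using y g by (metis inv_solve_left)
        then show "f y * f z * of_bool (y \<otimes> z = g) = (if z = inv y \<otimes> g then f y * f z else 0)" by simp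
      qed
      also have "\<dots> = f y * f (inv y \<otimes> g)" using y g by (subst sum.delta[OF fin]) simp
      finally show "f y * f (inv y \<otimes> g) = (\<Sum>z\<in>carrier G. f y * f z * of_bool (y \<otimes> z = g))" by simp
    qed
    finally show ?thesis .
  qed
  have prod: "?\<phi> (i, s) \<otimes> ?\<phi> (j, t) = ?\<phi> (k, u) \<longleftrightarrow>
      (i + (if s then e * j else j) + (if s \<and> t then m else 0)) mod q = k \<and> u = (s \<noteq> t)"
    if "k < q" for i j k s t u
    unfolding rot_refl_mult[OF G] using inj[of "(i + (if s then e * j else j) + (if s \<and> t then m else 0)) mod q" k] q0 that
    by auto
  have sq_F: "(f \<otimes>\<^bsub>?A\<^esub> f) (?\<phi> (k, False)) = fold_coeff k ((P f False)\<^sup>2 + P f True * (P f True \<circ>\<^sub>p \<xi> ^ e) * \<xi> ^ m)"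
    and sq_T: "(f \<otimes>\<^bsub>?A\<^esub> f) (?\<phi> (k, True)) = fold_coeff k (P f True * P f False + P f True * (P f False \<circ>\<^sub>p \<xi> ^ e))"
    if k: "k < q" for f k
  proof -
    have S: "(\<Sum>i<q. \<Sum>j<q. f (?\<phi> (i, s)) * f (?\<phi> (j, t)) * of_bool ((i + e' * j + m') mod q = k))
        = fold_coeff k (P f s * (P f t \<circ>\<^sub>p \<xi> ^ e') * \<xi> ^ m')" for s t e' m'
      unfolding fold_coeff_expand[OF deg_P deg_P] by (intro sum.cong refl) (simp add: coeff_P)
    have z: "(\<Sum>i<q. \<Sum>j<q. f (?\<phi> (i, s)) * f (?\<phi> (j, t)) * of_bool False) = 0" for s t by simp
    have "(f \<otimes>\<^bsub>?A\<^esub> f) (?\<phi> (k, False))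
        = fold_coeff k (P f False * (P f False \<circ>\<^sub>p \<xi> ^ 1) * \<xi> ^ 0) + fold_coeff k (P f True * (P f True \<circ>\<^sub>p \<xi> ^ e) * \<xi> ^ m)"
      unfolding conv[OF \<phi>[OF k]] sum_G prod[OF k] S[symmetric] sum.distrib by simp
    then show "(f \<otimes>\<^bsub>?A\<^esub> f) (?\<phi> (k, False)) = fold_coeff k ((P f False)\<^sup>2 + P f True * (P f True \<circ>\<^sub>p \<xi> ^ e) * \<xi> ^ m)"
      by (simp only: fold_coeff_add power_one_right pcompose_idR power_0 mult_1_right power2_eq_square)
    have "(f \<otimes>\<^bsub>?A\<^esub> f) (?\<phi> (k, True))
        = fold_coeff k (P f True * (P f False \<circ>\<^sub>p \<xi> ^ e) * \<xi> ^ 0) + fold_coeff k (P f False * (P f True \<circ>\<^sub>p \<xi> ^ 1) * \<xi> ^ 0)"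
      unfolding conv[OF \<phi>[OF k]] sum_G prod[OF k] S[symmetric] sum.distrib
      by (simp only: simp_thms if_True if_False of_bool_eq(1) mult_zero_right sum.neutral_const
          add_0_left add_0_right mult_1)
    then show "(f \<otimes>\<^bsub>?A\<^esub> f) (?\<phi> (k, True)) = fold_coeff k (P f True * P f False + P f True * (P f False \<circ>\<^sub>p \<xi> ^ e))"
      by (simp only: fold_coeff_add power_one_right pcompose_idR power_0 mult_1_left mult_1_right mult.commute add.commute)
  qed
  have one: "\<one>\<^bsub>?A\<^esub> (?\<phi> (k, s)) = (if s then 0 else fold_coeff k 1)" if "k < q" for k s
  proof -
    have "\<one> = ?\<phi> (0, False)" by (simp add: rot_refl_def)
    then have "?\<phi> (k, s) = \<one> \<longleftrightarrow> k = 0 \<and> \<not> s" using inj[of k 0 s False] that q0 by simp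
    moreover have "fold_coeff k 1 = of_bool (k = 0)" using fold_coeff_xi_power[of k 0] by simp
    ultimately show ?thesis by (simp add: group_algebra_simps)
  qed
  have inv_iff: "f \<otimes>\<^bsub>?A\<^esub> f = \<one>\<^bsub>?A\<^esub> \<longleftrightarrow> (P f False + 1, P f True) \<in> sols e m" for f
  proof -
    let ?x = "P f False" and ?y = "P f True"
    have "f \<otimes>\<^bsub>?A\<^esub> f = \<one>\<^bsub>?A\<^esub> \<longleftrightarrow> (\<forall>g\<in>carrier G. (f \<otimes>\<^bsub>?A\<^esub> f) g = \<one>\<^bsub>?A\<^esub> g)"
      by (auto simp: fun_eq_iff group_algebra_simps)
    also have "\<dots> \<longleftrightarrow> (\<forall>k<q. \<forall>s. (f \<otimes>\<^bsub>?A\<^esub> f) (?\<phi> (k, s)) = \<one>\<^bsub>?A\<^esub> (?\<phi> (k, s)))"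
    proof -
      have "carrier G = ?\<phi> ` ?I" using bij by (simp add: bij_betw_def)
      then show ?thesis by (simp only: ball_simps) auto
    qed
    also have "\<dots> \<longleftrightarrow> (\<forall>k<q. fold_coeff k (?x\<^sup>2 + ?y * (?y \<circ>\<^sub>p \<xi> ^ e) * \<xi> ^ m) = fold_coeff k 1 \<and>
        fold_coeff k (?y * ?x + ?y * (?x \<circ>\<^sub>p \<xi> ^ e)) = fold_coeff k 0)"
      by (auto simp: all_bool_eq one sq_F sq_T)
    also have "\<dots> \<longleftrightarrow> M dvd ?x\<^sup>2 + ?y * (?y \<circ>\<^sub>p \<xi> ^ e) * \<xi> ^ m + 1 \<and> M dvd ?y * ?x + ?y * (?x \<circ>\<^sub>p \<xi> ^ e)"
    proof -
      have "c = d \<longleftrightarrow> c + d = 0" for c d :: bit by (cases c; cases d) simp_all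
      then have "fold_coeff k p = fold_coeff k 1 \<longleftrightarrow> fold_coeff k (p + 1) = 0" for k p unfolding fold_coeff_add .
      then show ?thesis unfolding dvd_iff_fold_coeff by (simp only: fold_coeff_0) blast
    qed
    also have "?x\<^sup>2 + ?y * (?y \<circ>\<^sub>p \<xi> ^ e) * \<xi> ^ m + 1 = (?x + 1)\<^sup>2 + ?y * (?y \<circ>\<^sub>p \<xi> ^ e) * \<xi> ^ m"
    proof -
      have "(?x + 1)\<^sup>2 = ?x\<^sup>2 + 1"
        using frobenius[of ?x 1 1] by (simp only: power_one_right power_one)
      then show ?thesis by (simp only: add_ac)
    qed
    also have "?y * ?x + ?y * (?x \<circ>\<^sub>p \<xi> ^ e) = ?y * ((?x + 1) \<circ>\<^sub>p \<xi> ^ e) + ?y * (?x + 1)"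
      unfolding pcompose_add pcompose_1 distrib_left
      by (simp only: add_ac bit_poly_cancel)
    finally show ?thesis
      using deg_P[of f] q0 by (auto simp: sols_def cong_iff_dvd intro: degree_add_less)
  qed
  have "bij_betw (\<lambda>f. (P f False + 1, P f True)) (involutions G) (sols e m)"
  proof (rule bij_betw_imageI)
    show "inj_on (\<lambda>f. (P f False + 1, P f True)) (involutions G)"
    proof (rule inj_onI)
      fix f g assume fg: "f \<in> involutions G" "g \<in> involutions G"
        and eq: "(P f False + 1, P f True) = (P g False + 1, P g True)"
      from eq have P: "P f s = P g s" for s by (cases s) simp_all
      show "f = g"
      proof
        fix x
        show "f x = g x"
        proof (cases "x \<in> carrier G")
          case True
          then obtain i s where "i < q" "x = ?\<phi> (i, s)" using presented_cases[OF G] by metis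
          then show ?thesis using coeff_P[of f s i] coeff_P[of g s i] P[of s] by simp
        next
          case False
          then show ?thesis using fg by (simp add: involutions_def group_algebra_simps)
        qed
      qed
    qed
    show "(\<lambda>f. (P f False + 1, P f True)) ` involutions G = sols e m"
    proof (intro subset_antisym subsetI)
      fix v assume "v \<in> (\<lambda>f. (P f False + 1, P f True)) ` involutions G"
      then show "v \<in> sols e m" using inv_iff by (auto simp: involutions_def)
    next
      fix v assume v: "v \<in> sols e m"
      obtain x y where xy: "v = (x, y)" by (cases v)
      define z where "z s = (if s then y else x + 1)" for s
      define F where "F = (\<lambda>(i, s). coeff (z s) i)"
      define f where "f g = (if g \<in> carrier G then F (inv_into ?I ?\<phi> g) else 0)" for g
      have f\<phi>: "f (?\<phi> (i, s)) = coeff (z s) i" if "i < q" for i s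
      proof -
        have "inv_into ?I ?\<phi> (?\<phi> (i, s)) = (i, s)" using bij that by (simp add: bij_betw_def)
        then show ?thesis using \<phi>[OF that] by (simp add: f_def F_def)
      qed
      have deg: "degree (z s) < q" for s
        using v xy q0 by (auto simp: z_def sols_def intro: degree_add_less)
      have P: "P f s = z s" for s
      proof (rule poly_eqI)
        fix i
        show "coeff (P f s) i = coeff (z s) i"
        proof (cases "i < q")
          case True
          then show ?thesis by (simp only: coeff_P f\<phi> if_True)
        next
          case False
          then have "degree (z s) < i" using deg[of s] by simp
          then show ?thesis using False by (simp only: coeff_P if_False coeff_eq_0)
        qed
      qed
      have "(P f False + 1, P f True) = v" by (simp add: P z_def xy add.assoc)
      moreover have "f \<in> involutions G"
        using inv_iff[of f] v calculation by (simp add: involutions_def group_algebra_simps f_def)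
      ultimately show "v \<in> (\<lambda>f. (P f False + 1, P f True)) ` involutions G" by (intro image_eqI[of _ _ f]) simp_all
    qed
  qed
  then show ?thesis by (rule bij_betw_same_card)
qed

end

section \<open>The group of normalized units\<close>

lemma normalized_units_simps:
  "u \<in> carrier (V_F2 G) \<longleftrightarrow> u \<in> Units (group_algebra G) \<and> augmentation G u = 1"
  "u \<otimes>\<^bsub>V_F2 G\<^esub> v = u \<otimes>\<^bsub>group_algebra G\<^esub> v"
  by (simp_all add: normalized_units_def units_of_def)

context group
begin

lemma group_algebra_one:
  assumes fin: "finite (carrier G)" and f: "f \<in> carrier (group_algebra G :: ('a \<Rightarrow> bit) ring)"
  shows "\<one>\<^bsub>group_algebra G\<^esub> \<otimes>\<^bsub>group_algebra G\<^esub> f = f"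
    and "f \<otimes>\<^bsub>group_algebra G\<^esub> \<one>\<^bsub>group_algebra G\<^esub> = f"
proof -
  have "(\<one>\<^bsub>group_algebra G\<^esub> \<otimes>\<^bsub>group_algebra G\<^esub> f) x = f x" for x
  proof (cases "x \<in> carrier G")
    case True
    have "(\<Sum>y\<in>carrier G. (if y = \<one> then 1 else 0) * f (inv y \<otimes> x)) = (\<Sum>y\<in>carrier G. if y = \<one> then f x else 0)"
      by (intro sum.cong refl) (use True in simp)
    then show ?thesis using True fin by (simp add: group_algebra_simps(2,3))
  next
    case False
    then show ?thesis using f by (simp add: group_algebra_simps)
  qed
  then show "\<one>\<^bsub>group_algebra G\<^esub> \<otimes>\<^bsub>group_algebra G\<^esub> f = f" by (rule ext)
  have "(f \<otimes>\<^bsub>group_algebra G\<^esub> \<one>\<^bsub>group_algebra G\<^esub>) x = f x" for x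
  proof (cases "x \<in> carrier G")
    case True
    have "(\<Sum>y\<in>carrier G. f y * (if inv y \<otimes> x = \<one> then 1 else 0)) = (\<Sum>y\<in>carrier G. if y = x then f x else 0)"
    proof (intro sum.cong refl)
      fix y assume y: "y \<in> carrier G"
      have "inv y \<otimes> x = \<one> \<longleftrightarrow> y = x" using inv_mult_eq_one_iff[OF y True] by blast
      then show "f y * (if inv y \<otimes> x = \<one> then 1 else 0) = (if y = x then f x else 0)" by simp
    qed
    then show ?thesis using True fin by (simp add: group_algebra_simps(2,3))
  next
    case False
    then show ?thesis using f by (simp add: group_algebra_simps)
  qed
  then show "f \<otimes>\<^bsub>group_algebra G\<^esub> \<one>\<^bsub>group_algebra G\<^esub> = f" by (rule ext)
qed

lemma translate_sum:
  assumes "y \<in> carrier G"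
  shows "(\<Sum>x\<in>carrier G. g (inv y \<otimes> x)) = (\<Sum>x\<in>carrier G. g x)"
proof (rule sum.reindex_bij_betw)
  show "bij_betw (\<lambda>x. inv y \<otimes> x) (carrier G) (carrier G)"
  proof (rule bij_betw_byWitness[where f' = "\<lambda>x. y \<otimes> x"])
    show "\<forall>x\<in>carrier G. y \<otimes> (inv y \<otimes> x) = x" "\<forall>x\<in>carrier G. inv y \<otimes> (y \<otimes> x) = x"
      using assms by (auto simp flip: m_assoc)
  qed (use assms in auto)
qed

text \<open>Only associativity takes work; it comes from the substitution \<open>y = z w\<close> in the inner sum.\<close>

lemma monoid_group_algebra:
  assumes fin: "finite (carrier G)"
  shows "monoid (group_algebra G :: ('a \<Rightarrow> bit) ring)"
proof (rule monoidI)
  let ?A = "group_algebra G :: ('a \<Rightarrow> bit) ring"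
  fix f g h assume f: "f \<in> carrier ?A" and g: "g \<in> carrier ?A" and h: "h \<in> carrier ?A"
  show "f \<otimes>\<^bsub>?A\<^esub> g \<in> carrier ?A" by (simp add: group_algebra_simps)
  show "\<one>\<^bsub>?A\<^esub> \<otimes>\<^bsub>?A\<^esub> f = f" "f \<otimes>\<^bsub>?A\<^esub> \<one>\<^bsub>?A\<^esub> = f"
    by (rule group_algebra_one[OF fin f])+
  have "(f \<otimes>\<^bsub>?A\<^esub> g \<otimes>\<^bsub>?A\<^esub> h) x = (f \<otimes>\<^bsub>?A\<^esub> (g \<otimes>\<^bsub>?A\<^esub> h)) x" if x: "x \<in> carrier G" for x
  proof -
    have "(f \<otimes>\<^bsub>?A\<^esub> g \<otimes>\<^bsub>?A\<^esub> h) x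
        = (\<Sum>y\<in>carrier G. \<Sum>z\<in>carrier G. f z * (g (inv z \<otimes> y) * h (inv y \<otimes> x)))"
      unfolding group_algebra_simps(3)[of _ "f \<otimes>\<^bsub>?A\<^esub> g"] if_P[OF x]
      by (intro sum.cong refl) (simp only: group_algebra_simps(3) if_True sum_distrib_right mult.assoc)
    also have "\<dots> = (\<Sum>z\<in>carrier G. f z * (\<Sum>y\<in>carrier G. g (inv z \<otimes> y) * h (inv y \<otimes> x)))"
      by (subst sum.swap) (simp only: sum_distrib_left)
    also have "\<dots> = (\<Sum>z\<in>carrier G. f z * (g \<otimes>\<^bsub>?A\<^esub> h) (inv z \<otimes> x))"
    proof (intro sum.cong refl arg_cong2[of _ _ _ _ "(*)"])
      fix z assume z: "z \<in> carrier G"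
      have "(\<Sum>y\<in>carrier G. g (inv z \<otimes> y) * h (inv y \<otimes> x))
          = (\<Sum>y\<in>carrier G. g (inv z \<otimes> y) * h (inv (inv z \<otimes> y) \<otimes> (inv z \<otimes> x)))"
      proof (intro sum.cong refl)
        fix y assume y: "y \<in> carrier G"
        have "inv (inv z \<otimes> y) \<otimes> (inv z \<otimes> x) = inv y \<otimes> ((z \<otimes> inv z) \<otimes> x)"
          using x y z by (simp only: inv_mult_group inv_closed inv_inv m_assoc m_closed)
        then show "g (inv z \<otimes> y) * h (inv y \<otimes> x)
            = g (inv z \<otimes> y) * h (inv (inv z \<otimes> y) \<otimes> (inv z \<otimes> x))"
          using x y z by simp
      qed
      also have "\<dots> = (\<Sum>w\<in>carrier G. g w * h (inv w \<otimes> (inv z \<otimes> x)))"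
        by (rule translate_sum[OF z])
      also have "\<dots> = (g \<otimes>\<^bsub>?A\<^esub> h) (inv z \<otimes> x)"
        using x z by (simp only: group_algebra_simps(3) m_closed inv_closed if_True)
      finally show "(\<Sum>y\<in>carrier G. g (inv z \<otimes> y) * h (inv y \<otimes> x)) = (g \<otimes>\<^bsub>?A\<^esub> h) (inv z \<otimes> x)" .
    qed
    finally show ?thesis
      unfolding group_algebra_simps(3)[of _ f "g \<otimes>\<^bsub>?A\<^esub> h"] if_P[OF x] .
  qed
  moreover have "(f \<otimes>\<^bsub>?A\<^esub> g \<otimes>\<^bsub>?A\<^esub> h) x = (f \<otimes>\<^bsub>?A\<^esub> (g \<otimes>\<^bsub>?A\<^esub> h)) x" if "x \<notin> carrier G" for x
    unfolding group_algebra_simps(3)[of _ _ h] group_algebra_simps(3)[of _ f] using that by (simp only: if_False)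
  ultimately show "f \<otimes>\<^bsub>?A\<^esub> g \<otimes>\<^bsub>?A\<^esub> h = f \<otimes>\<^bsub>?A\<^esub> (g \<otimes>\<^bsub>?A\<^esub> h)" by (metis ext)
qed (simp add: group_algebra_simps)

lemma augmentation_one:
  assumes "finite (carrier G)"
  shows "augmentation G \<one>\<^bsub>group_algebra G\<^esub> = (1 :: bit)"
  using assms by (simp add: augmentation_def group_algebra_simps(2))

lemma augmentation_mult:
  fixes f g :: "'a \<Rightarrow> bit"
  shows "augmentation G (f \<otimes>\<^bsub>group_algebra G\<^esub> g) = augmentation G f * augmentation G g"
proof -
  have "augmentation G (f \<otimes>\<^bsub>group_algebra G\<^esub> g) = (\<Sum>x\<in>carrier G. \<Sum>y\<in>carrier G. f y * g (inv y \<otimes> x))"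
    unfolding augmentation_def by (intro sum.cong refl) (simp only: group_algebra_simps(3) if_True)
  also have "\<dots> = (\<Sum>y\<in>carrier G. f y * (\<Sum>x\<in>carrier G. g (inv y \<otimes> x)))"
    by (subst sum.swap) (simp only: sum_distrib_left)
  also have "\<dots> = (\<Sum>y\<in>carrier G. f y * augmentation G g)"
    by (intro sum.cong refl) (simp only: translate_sum augmentation_def)
  finally show ?thesis by (simp only: augmentation_def sum_distrib_right)
qed

lemma one_in_V:
  assumes "finite (carrier G)"
  shows "\<one>\<^bsub>group_algebra G\<^esub> \<in> carrier (V_F2 G)"
proof -
  have 1: "\<one>\<^bsub>group_algebra G\<^esub> \<in> carrier (group_algebra G :: ('a \<Rightarrow> bit) ring)"
    by (auto simp: group_algebra_simps)
  then have "\<one>\<^bsub>group_algebra G\<^esub> \<in> Units (group_algebra G :: ('a \<Rightarrow> bit) ring)"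
    using group_algebra_one[OF assms 1] by (auto simp: Units_def)
  then show ?thesis using augmentation_one[OF assms] by (simp add: normalized_units_simps)
qed

text \<open>An element with \<open>f\<^sup>2 = 1\<close> is its own inverse, and the augmentation is multiplicative.\<close>

lemma involutions_eq:
  assumes "finite (carrier G)"
  shows "involutions G = {u \<in> carrier (V_F2 G). u \<otimes>\<^bsub>V_F2 G\<^esub> u = \<one>\<^bsub>group_algebra G\<^esub>}"
proof (intro subset_antisym subsetI)
  fix f assume "f \<in> involutions G"
  then have f: "f \<in> carrier (group_algebra G)" "f \<otimes>\<^bsub>group_algebra G\<^esub> f = \<one>\<^bsub>group_algebra G\<^esub>"
    by (simp_all add: involutions_def)
  have "augmentation G f * augmentation G f = 1"
    using augmentation_mult[of f f] augmentation_one[OF assms] f(2) by simp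
  then have "augmentation G f = 1" by (cases "augmentation G f") simp_all
  moreover have "f \<in> Units (group_algebra G)" using f by (auto simp: Units_def)
  ultimately show "f \<in> {u \<in> carrier (V_F2 G). u \<otimes>\<^bsub>V_F2 G\<^esub> u = \<one>\<^bsub>group_algebra G\<^esub>}"
    using f by (simp add: normalized_units_simps)
next
  fix f assume "f \<in> {u \<in> carrier (V_F2 G). u \<otimes>\<^bsub>V_F2 G\<^esub> u = \<one>\<^bsub>group_algebra G\<^esub>}"
  then show "f \<in> involutions G"
    by (auto simp: involutions_def normalized_units_simps Units_def)
qed

end

text \<open>If \<open>h v = 1\<close>, then \<open>1 = h (v 1) = (h v) (h 1) = h 1\<close>, so an isomorphism \<open>h\<close> preserves the
  equation \<open>u\<^sup>2 = 1\<close>.\<close>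

lemma card_involutions_V:
  assumes G: "group G" "finite (carrier G)" and H: "group H" "finite (carrier H)"
    and iso: "V_F2 G \<cong> V_F2 H"
  shows "card (involutions G) = card (involutions H)"
proof -
  interpret G: group G by fact
  interpret H: group H by fact
  let ?eG = "\<one>\<^bsub>group_algebra G\<^esub> :: 'a \<Rightarrow> bit" and ?eH = "\<one>\<^bsub>group_algebra H\<^esub> :: 'c \<Rightarrow> bit"
  obtain h where "h \<in> iso (V_F2 G) (V_F2 H)" using iso by (auto simp: is_iso_def)
  then have bij: "bij_betw h (carrier (V_F2 G)) (carrier (V_F2 H))"
    and hom: "\<And>u v. u \<in> carrier (V_F2 G) \<Longrightarrow> v \<in> carrier (V_F2 G) \<Longrightarrow>
      h (u \<otimes>\<^bsub>V_F2 G\<^esub> v) = h u \<otimes>\<^bsub>V_F2 H\<^esub> h v"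
    by (auto simp: iso_def hom_mult)
  note eG = G.one_in_V[OF G(2)] and eH = H.one_in_V[OF H(2)]
  have alg: "u \<in> carrier (group_algebra G)" if "u \<in> carrier (V_F2 G)" for u
    using that by (auto simp: normalized_units_simps Units_def)
  have algH: "u \<in> carrier (group_algebra H)" if "u \<in> carrier (V_F2 H)" for u
    using that by (auto simp: normalized_units_simps Units_def)
  have hc: "h u \<in> carrier (V_F2 H)" if "u \<in> carrier (V_F2 G)" for u
    using bij that by (rule bij_betw_apply)
  have "?eH \<in> h ` carrier (V_F2 G)" using bij eH by (simp add: bij_betw_def)
  then obtain v where v: "v \<in> carrier (V_F2 G)" "?eH = h v" by blast
  have "h (v \<otimes>\<^bsub>V_F2 G\<^esub> ?eG) = h v \<otimes>\<^bsub>V_F2 H\<^esub> h ?eG" by (rule hom[OF v(1) eG])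
  then have h1: "h ?eG = ?eH"
    using G.group_algebra_one(2)[OF G(2) alg[OF v(1)]] H.group_algebra_one(1)[OF H(2) algH[OF hc[OF eG]]] v(2)
    by (simp only: normalized_units_simps(2))
  have "h ` involutions G = involutions H"
  proof (intro subset_antisym subsetI)
    fix w assume "w \<in> h ` involutions G"
    then obtain u where u: "w = h u" "u \<in> carrier (V_F2 G)" "u \<otimes>\<^bsub>V_F2 G\<^esub> u = ?eG"
      unfolding G.involutions_eq[OF G(2)] by blast
    then have "h u \<otimes>\<^bsub>V_F2 H\<^esub> h u = ?eH" using hom[OF u(2) u(2)] h1 by simp
    then show "w \<in> involutions H" unfolding H.involutions_eq[OF H(2)] using u hc by blast
  next
    fix w assume "w \<in> involutions H"
    then have w: "w \<in> carrier (V_F2 H)" "w \<otimes>\<^bsub>V_F2 H\<^esub> w = ?eH" unfolding H.involutions_eq[OF H(2)] by auto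
    then obtain u where u: "u \<in> carrier (V_F2 G)" "w = h u" using bij unfolding bij_betw_def by blast
    interpret A: monoid "group_algebra G :: ('a \<Rightarrow> bit) ring" by (rule G.monoid_group_algebra[OF G(2)])
    have uu: "u \<otimes>\<^bsub>V_F2 G\<^esub> u \<in> carrier (V_F2 G)"
      using u(1) A.Units_m_closed[of u u] by (simp add: normalized_units_simps G.augmentation_mult)
    have "h (u \<otimes>\<^bsub>V_F2 G\<^esub> u) = h ?eG" using hom[OF u(1) u(1)] w(2) u(2) h1 by simp
    then have "u \<otimes>\<^bsub>V_F2 G\<^esub> u = ?eG"
      using bij uu eG by (auto simp: bij_betw_def dest: inj_onD)
    then show "w \<in> h ` involutions G" unfolding G.involutions_eq[OF G(2)] using u by blast
  qed
  moreover have "inj_on h (involutions G)"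
    using bij unfolding bij_betw_def by (rule conjE) (erule inj_on_subset, simp add: G.involutions_eq[OF G(2)])
  ultimately show ?thesis using card_image[of h "involutions G"] by simp
qed

text \<open>Transport of coefficient functions along \<open>\<psi>: H \<rightarrow> G\<close>, extended by \<open>0\<close>.\<close>

definition pullback :: "('b, 'n) monoid_scheme \<Rightarrow> ('b \<Rightarrow> 'a) \<Rightarrow> ('a \<Rightarrow> bit) \<Rightarrow> 'b \<Rightarrow> bit" where
  "pullback H \<psi> f = (\<lambda>x. if x \<in> carrier H then f (\<psi> x) else 0)"

lemma V_iso_of_iso:
  fixes G :: "('a, 'm) monoid_scheme" and H :: "('b, 'n) monoid_scheme"
  assumes G: "group G" and H: "group H" and iso: "G \<cong> H"
  shows "V_F2 G \<cong> V_F2 H"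
proof -
  interpret G: group G by fact
  interpret H: group H by fact
  obtain \<psi> where \<psi>: "\<psi> \<in> iso H G" using G.iso_sym[OF iso] by (auto simp: is_iso_def)
  interpret \<psi>: group_hom H G \<psi>
    using \<psi> by unfold_locales (simp add: iso_def)
  have bij: "bij_betw \<psi> (carrier H) (carrier G)" using \<psi> by (simp add: iso_def)
  have inj: "\<psi> x = \<psi> y \<longleftrightarrow> x = y" if "x \<in> carrier H" "y \<in> carrier H" for x y
    using inj_on_eq_iff[OF bij_betw_imp_inj_on[OF bij] that] .
  let ?T = "pullback H \<psi>"
  let ?A = "group_algebra G :: ('a \<Rightarrow> bit) ring" and ?B = "group_algebra H :: ('b \<Rightarrow> bit) ring"
  have bijT: "bij_betw ?T (carrier ?A) (carrier ?B)"
  proof (rule bij_betw_byWitness[where f' = "\<lambda>g x. if x \<in> carrier G then g (inv_into (carrier H) \<psi> x) else 0"])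
    show "\<forall>f\<in>carrier ?A. (\<lambda>x. if x \<in> carrier G then ?T f (inv_into (carrier H) \<psi> x) else 0) = f"
      using bij_betw_inv_into_right[OF bij] bij_betw_apply[OF bij_betw_inv_into[OF bij]]
      by (auto simp: pullback_def group_algebra_simps fun_eq_iff)
    show "\<forall>g\<in>carrier ?B. ?T (\<lambda>x. if x \<in> carrier G then g (inv_into (carrier H) \<psi> x) else 0) = g"
      using bij_betw_inv_into_left[OF bij] by (auto simp: pullback_def group_algebra_simps fun_eq_iff)
  qed (auto simp: pullback_def group_algebra_simps)
  have mult: "?T (f \<otimes>\<^bsub>?A\<^esub> g) = ?T f \<otimes>\<^bsub>?B\<^esub> ?T g" for f g
  proof
    fix x
    show "?T (f \<otimes>\<^bsub>?A\<^esub> g) x = (?T f \<otimes>\<^bsub>?B\<^esub> ?T g) x"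
    proof (cases "x \<in> carrier H")
      case True
      have "?T (f \<otimes>\<^bsub>?A\<^esub> g) x = (\<Sum>z\<in>carrier G. f z * g (inv\<^bsub>G\<^esub> z \<otimes>\<^bsub>G\<^esub> \<psi> x))"
        using True by (simp only: pullback_def group_algebra_simps(3) if_True \<psi>.hom_closed)
      also have "\<dots> = (\<Sum>y\<in>carrier H. f (\<psi> y) * g (inv\<^bsub>G\<^esub> (\<psi> y) \<otimes>\<^bsub>G\<^esub> \<psi> x))"
        by (rule sum.reindex_bij_betw[OF bij, symmetric])
      also have "\<dots> = (\<Sum>y\<in>carrier H. ?T f y * ?T g (inv\<^bsub>H\<^esub> y \<otimes>\<^bsub>H\<^esub> x))"
        by (intro sum.cong refl)
          (use True in \<open>simp only: pullback_def if_True H.m_closed H.inv_closed \<psi>.hom_mult \<psi>.hom_inv\<close>)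
      finally show ?thesis using True by (simp only: group_algebra_simps(3) if_True)
    next
      case False
      then show ?thesis by (simp only: pullback_def group_algebra_simps(3) if_False)
    qed
  qed
  have one: "?T \<one>\<^bsub>?A\<^esub> = \<one>\<^bsub>?B\<^esub>"
  proof
    show "?T \<one>\<^bsub>?A\<^esub> x = \<one>\<^bsub>?B\<^esub> x" for x
      using inj[of x "\<one>\<^bsub>H\<^esub>"] by (auto simp: pullback_def group_algebra_simps(2))
  qed
  have aug: "augmentation H (?T f) = augmentation G f" for f
  proof -
    have "augmentation H (?T f) = (\<Sum>y\<in>carrier H. f (\<psi> y))"
      unfolding augmentation_def by (intro sum.cong refl) (simp only: pullback_def if_True)
    also have "\<dots> = augmentation G f"
      unfolding augmentation_def by (rule sum.reindex_bij_betw[OF bij])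
    finally show ?thesis .
  qed
  have TA: "?T f \<in> carrier ?B" for f by (auto simp: pullback_def group_algebra_simps)
  have one_A: "\<one>\<^bsub>?A\<^esub> \<in> carrier ?A" by (auto simp: group_algebra_simps)
  have units: "?T f \<in> Units ?B \<longleftrightarrow> f \<in> Units ?A" if f: "f \<in> carrier ?A" for f
  proof
    assume "f \<in> Units ?A"
    then obtain g where "g \<in> carrier ?A" "g \<otimes>\<^bsub>?A\<^esub> f = \<one>\<^bsub>?A\<^esub>" "f \<otimes>\<^bsub>?A\<^esub> g = \<one>\<^bsub>?A\<^esub>"
      by (auto simp: Units_def)
    then have "?T g \<otimes>\<^bsub>?B\<^esub> ?T f = \<one>\<^bsub>?B\<^esub>" "?T f \<otimes>\<^bsub>?B\<^esub> ?T g = \<one>\<^bsub>?B\<^esub>"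
      by (simp_all only: mult[symmetric] one)
    then show "?T f \<in> Units ?B" using TA by (auto simp: Units_def)
  next
    assume "?T f \<in> Units ?B"
    then obtain k where k: "k \<in> carrier ?B" "k \<otimes>\<^bsub>?B\<^esub> ?T f = \<one>\<^bsub>?B\<^esub>" "?T f \<otimes>\<^bsub>?B\<^esub> k = \<one>\<^bsub>?B\<^esub>"
      by (auto simp: Units_def)
    obtain g where g: "g \<in> carrier ?A" "k = ?T g"
      using k(1) bijT unfolding bij_betw_def by blast
    have cl: "u \<otimes>\<^bsub>?A\<^esub> v \<in> carrier ?A" for u v by (simp add: group_algebra_simps)
    have "?T (g \<otimes>\<^bsub>?A\<^esub> f) = ?T \<one>\<^bsub>?A\<^esub>" "?T (f \<otimes>\<^bsub>?A\<^esub> g) = ?T \<one>\<^bsub>?A\<^esub>"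
      using k(2,3) by (simp_all only: mult one g(2))
    then have "g \<otimes>\<^bsub>?A\<^esub> f = \<one>\<^bsub>?A\<^esub>" "f \<otimes>\<^bsub>?A\<^esub> g = \<one>\<^bsub>?A\<^esub>"
      using inj_onD[OF bij_betw_imp_inj_on[OF bijT] _ cl one_A] by blast+
    then show "f \<in> Units ?A" using f g(1) by (auto simp: Units_def)
  qed
  have carrier: "carrier (V_F2 G) \<subseteq> carrier ?A" "carrier (V_F2 H) \<subseteq> carrier ?B"
    by (auto simp: normalized_units_simps Units_def)
  have "?T ` carrier (V_F2 G) = carrier (V_F2 H)"
  proof (intro subset_antisym subsetI)
    fix w assume "w \<in> ?T ` carrier (V_F2 G)"
    then obtain u where u: "u \<in> carrier (V_F2 G)" "w = ?T u" by blast
    then show "w \<in> carrier (V_F2 H)"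
      using units[of u] carrier(1) aug[of u] by (simp add: normalized_units_simps subset_iff)
  next
    fix w assume w: "w \<in> carrier (V_F2 H)"
    then obtain u where u: "u \<in> carrier ?A" "w = ?T u"
      using carrier(2) bijT unfolding bij_betw_def by blast
    then have "u \<in> carrier (V_F2 G)"
      using w units[of u] aug[of u] by (simp add: normalized_units_simps)
    then show "w \<in> ?T ` carrier (V_F2 G)" using u by blast
  qed
  then have "bij_betw ?T (carrier (V_F2 G)) (carrier (V_F2 H))"
    using inj_on_subset[OF bij_betw_imp_inj_on[OF bijT] carrier(1)] by (simp add: bij_betw_def)
  then have "?T \<in> iso (V_F2 G) (V_F2 H)"
    using mult by (auto simp: iso_def hom_def bij_betw_apply normalized_units_simps(2))
  then show ?thesis by (auto simp: is_iso_def)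
qed

lemma cyclic_algebra_two_power: "n \<ge> 2 \<Longrightarrow> cyclic_algebra n (2 ^ n)"
  by (simp add: cyclic_algebra_def)

text \<open>The bounds \<open>2\<^sup>q \<le> |sols e m| < 2\<^bsup>2q\<^esup>\<close> for \<open>q = 2\<^sup>n\<close> do not overlap for different \<open>n\<close>.\<close>

lemma presented_same_length:
  assumes n: "n \<ge> 2" and n': "n' \<ge> 2"
    and G: "presented G (2 ^ n) e m a b" and H: "presented H (2 ^ n') e' m' c d"
    and eq: "card (involutions G) = card (involutions H)"
  shows "n' \<le> n"
proof (rule ccontr)
  assume "\<not> n' \<le> n"
  then have "2 * 2 ^ n \<le> (2::nat) ^ n'" using power_increasing[of "Suc n" n' "2::nat"] by simp
  then have "(2::nat) ^ (2 * 2 ^ n) \<le> 2 ^ (2 ^ n')" by (intro power_increasing) simp_all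
  also have "\<dots> \<le> card (involutions H)"
    using cyclic_algebra.card_sols_ge[OF cyclic_algebra_two_power[OF n']] cyclic_algebra.card_involutions[OF cyclic_algebra_two_power[OF n'] H] by simp
  also have "\<dots> < 2 ^ (2 * 2 ^ n)"
    using cyclic_algebra.card_sols_less[OF cyclic_algebra_two_power[OF n]] cyclic_algebra.card_involutions[OF cyclic_algebra_two_power[OF n] G]
    by (simp add: eq[symmetric])
  finally show False by simp
qed

theorem mainTheorem2:
  fixes G :: "('a, 'm) monoid_scheme" and H :: "('b, 'n) monoid_scheme"
  assumes "maximal_class_2_group G" and "maximal_class_2_group H"
  shows "V_F2 G \<cong> V_F2 H \<longleftrightarrow> G \<cong> H"
proof
  obtain n a b e m where n: "n \<ge> 2" and G: "presented G (2 ^ n) e m a b"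
    and em: "e = 2 ^ n - 1 \<and> (m = 0 \<or> m = 2 ^ n div 2) \<or> n \<ge> 3 \<and> e = 2 ^ n div 2 - 1 \<and> m = 0"
    by (rule maximal_class_presented[OF assms(1)])
  obtain n' c d e' m' where n': "n' \<ge> 2" and H: "presented H (2 ^ n') e' m' c d"
    and em': "e' = 2 ^ n' - 1 \<and> (m' = 0 \<or> m' = 2 ^ n' div 2) \<or> n' \<ge> 3 \<and> e' = 2 ^ n' div 2 - 1 \<and> m' = 0"
    by (rule maximal_class_presented[OF assms(2)])
  have grp: "group G" "group H" using G H by (simp_all add: presented_def)
  have fin: "finite (carrier G)" "finite (carrier H)"
    using presented_finite[OF G] presented_finite[OF H] .
  show "G \<cong> H \<Longrightarrow> V_F2 G \<cong> V_F2 H" by (rule V_iso_of_iso[OF grp])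
  assume "V_F2 G \<cong> V_F2 H"
  then have card: "card (involutions G) = card (involutions H)"
    by (rule card_involutions_V[OF grp(1) fin(1) grp(2) fin(2)])
  have nn: "n' = n"
    using presented_same_length[OF n n' G H card] presented_same_length[OF n' n H G card[symmetric]] by simp
  interpret cyclic_algebra n "2 ^ n" by (rule cyclic_algebra_two_power[OF n])
  have sols: "card (sols e m) = card (sols e' m')"
    using card card_involutions[OF G] card_involutions[OF H[unfolded nn]] by simp
  have "e = e' \<and> m = m'"
    using em em' sols card_quaternion_le card_nonunit_less card_twisted_less card_semidihedral
    unfolding nn by auto
  then show "G \<cong> H" using presented_iso[OF G] H nn by simp
qed

end
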